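(* Let $\mathfrak{g}$ be a complete AE-Lie algebra in which there are elements $\xi,\eta$ for which the Baker-Campbell-Hausdorff series does not converge. Then there is no locally convex topology on $\mathrm{S}^\bullet(\mathfrak{g})$ such that all of the following hold: (i) the Gutt star product $\star_G$ is continuous; (ii) for every $\xi\in\mathfrak{g}$ the series $\exp(\xi)=\sum_{n\ge0}\frac{\xi^n}{n!}$ converges absolutely in the completion of $\mathrm{S}^\bullet(\mathfrak{g})$; (iii) for all $n\in\mathbb{N}$ the projection and inclusion maps with respect to the graded structure, $\mathrm{S}^\bullet(\mathfrak{g})\xrightarrow{\pi_n}\mathrm{S}^n(\mathfrak{g})\xrightarrow{\iota_n}\mathrm{S}^\bullet(\mathfrak{g})$, are continuous.
   Context: All spaces are over $\mathbb{K}\in\{\mathbb{R},\mathbb{C}\}$; locally convex spaces are Hausdorff. An AE-Lie algebra is a locally convex Lie algebra with continuous bracket in which every continuous seminorm $p$ has an asymptotic estimate: a continuous seminorm $q$ with $p(w_n(x_1,\ldots,x_n))\le q(x_1)\cdots q(x_n)$ for all $n\ge1$, all $x_i\in\mathfrak{g}$ and all words $w_n$ made out of $n-1$ Lie brackets of $x_1,\ldots,x_n$ with arbitrary bracketing. $\mathrm{S}^\bullet(\mathfrak{g})=\bigoplus_n\mathrm{S}^n(\mathfrak{g})$ is the symmetric tensor algebra; $\mathrm{S}^n(\mathfrak{g})\subseteq\mathfrak{g}^{\otimes n}$ carries the projective tensor product topology (in particular $\mathrm{S}^1(\mathfrak{g})=\mathfrak{g}$ with its original topology). The Gutt star product with formal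 parameter $z=1$ is $f\star_Gg=\mathfrak{q}^{-1}(\mathfrak{q}(f)\odot\mathfrak{q}(g))$, where $\odot$ is the product of the universal enveloping algebra $\mathcal{U}(\mathfrak{g})$ and $\mathfrak{q}\colon \mathrm{S}^\bullet(\mathfrak{g})\to\mathcal{U}(\mathfrak{g})$, $\mathfrak{q}(\xi_1\cdots\xi_n)=\frac1{n!}\sum_\sigma\xi_{\sigma(1)}\odot\cdots\odot\xi_{\sigma(n)}$. The Baker-Campbell-Hausdorff series of $\xi,\eta$ is $\sum_{n\ge1}\mathrm{BCH}_n(\xi,\eta)$, where $\mathrm{BCH}_n(\xi,\eta)$ is the part of total degree $n$ of $\log(\exp\xi\exp\eta)$, written in Lie brackets; convergence is meant in the topology of $\mathfrak{g}$. Absolute convergence of a series means convergence of the series of values of every continuous seminorm. *)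

theory Defs
  imports
    "HOL-Analysis.Analysis"
    "HOL-Library.Poly_Mapping"
    "HOL-Combinatorics.Permutations"
    "HOL-Computational_Algebra.Formal_Power_Series"
    "HOL-Algebra.QuotRing"
    "HOL-Algebra.Algebraic_Closure_Type"
begin

section \<open>The scalar field\<close>

text \<open>The instances of this class are, up to isomorphism of normed fields, exactly the real and
  the complex numbers: a multiplicative norm on the complex numbers that extends the absolute
  value of the reals is the usual modulus.\<close>

class real_or_complex = real_normed_field +
  assumes real_or_complex:
    "(\<forall>z. \<exists>a. z = scaleR a 1) \<or> (\<exists>i. i * i = - 1 \<and> (\<forall>z. \<exists>a b. z = scaleR a 1 + scaleR b i))"

instance real :: real_or_complex
  by standard simp

instance complex :: real_or_complex
proof
  have "z = Re z *\<^sub>R 1 + Im z *\<^sub>R \<i>" for z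
    by (simp add: complex_eq_iff)
  then show "(\<forall>z::complex. \<exists>a. z = a *\<^sub>R 1) \<or>
      (\<exists>i::complex. i * i = - 1 \<and> (\<forall>z. \<exists>a b. z = a *\<^sub>R 1 + b *\<^sub>R i))"
    by (intro disjI2 exI[of _ \<i>]) (auto intro!: exI)
qed


section \<open>Locally convex spaces\<close>

text \<open>A vector space is given here by its carrier \<open>V\<close>, its addition and its scalar
  multiplication, because the tensor spaces below are sets of cosets and not types.\<close>

definition is_seminorm ::
    "'v set \<Rightarrow> ('v \<Rightarrow> 'v \<Rightarrow> 'v) \<Rightarrow> ('k::real_normed_field \<Rightarrow> 'v \<Rightarrow> 'v) \<Rightarrow> ('v \<Rightarrow> real) \<Rightarrow> bool"
  where "is_seminorm V vadd vscale p \<longleftrightarrow>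
    (\<forall>x\<in>V. 0 \<le> p x) \<and>
    (\<forall>x\<in>V. \<forall>y\<in>V. p (vadd x y) \<le> p x + p y) \<and>
    (\<forall>c. \<forall>x\<in>V. p (vscale c x) = norm c * p x)"

text \<open>The carrier is added to the subbasis so that it is the whole space even when \<open>P\<close> is empty.\<close>

definition seminorm_topology ::
    "'v set \<Rightarrow> ('v \<Rightarrow> 'v \<Rightarrow> 'v) \<Rightarrow> ('k::real_normed_field \<Rightarrow> 'v \<Rightarrow> 'v) \<Rightarrow> ('v \<Rightarrow> real) set
      \<Rightarrow> 'v topology"
  where "seminorm_topology V vadd vscale P = topology_generated_by
    (insert V {{y\<in>V. p (vadd y (vscale (- 1) x)) < e} | p x e. p \<in> P \<and> x \<in> V \<and> 0 < e})"

definition locally_convex_topology ::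
    "'v set \<Rightarrow> ('v \<Rightarrow> 'v \<Rightarrow> 'v) \<Rightarrow> ('k::real_normed_field \<Rightarrow> 'v \<Rightarrow> 'v) \<Rightarrow> 'v topology \<Rightarrow> bool"
  where "locally_convex_topology V vadd vscale T \<longleftrightarrow> Hausdorff_space T \<and>
    (\<exists>P. (\<forall>p\<in>P. is_seminorm V vadd vscale p) \<and> T = seminorm_topology V vadd vscale P)"

definition continuous_seminorm ::
    "'v set \<Rightarrow> ('v \<Rightarrow> 'v \<Rightarrow> 'v) \<Rightarrow> ('k::real_normed_field \<Rightarrow> 'v \<Rightarrow> 'v) \<Rightarrow> 'v topology
      \<Rightarrow> ('v \<Rightarrow> real) \<Rightarrow> bool"
  where "continuous_seminorm V vadd vscale T p \<longleftrightarrow>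
    is_seminorm V vadd vscale p \<and> continuous_map T euclideanreal p"

text \<open>Completeness with respect to arbitrary Cauchy filters, equivalently Cauchy nets.\<close>

definition lc_cauchy_filter ::
    "'v set \<Rightarrow> ('v \<Rightarrow> 'v \<Rightarrow> 'v) \<Rightarrow> ('k::real_normed_field \<Rightarrow> 'v \<Rightarrow> 'v) \<Rightarrow> 'v topology
      \<Rightarrow> 'v filter \<Rightarrow> bool"
  where "lc_cauchy_filter V vadd vscale T F \<longleftrightarrow> F \<noteq> bot \<and>
    (\<forall>p e. continuous_seminorm V vadd vscale T p \<and> 0 < e \<longrightarrow>
      (\<exists>A\<subseteq>V. eventually (\<lambda>x. x \<in> A) F \<and> (\<forall>x\<in>A. \<forall>y\<in>A. p (vadd x (vscale (- 1) y)) < e)))"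

definition lc_complete ::
    "'v set \<Rightarrow> ('v \<Rightarrow> 'v \<Rightarrow> 'v) \<Rightarrow> ('k::real_normed_field \<Rightarrow> 'v \<Rightarrow> 'v) \<Rightarrow> 'v topology \<Rightarrow> bool"
  where "lc_complete V vadd vscale T \<longleftrightarrow>
    (\<forall>F. lc_cauchy_filter V vadd vscale T F \<longrightarrow> (\<exists>l. limitin T (\<lambda>x. x) l F))"

text \<open>Absolute convergence, in the completion, of a series with terms in \<open>V\<close>: the values of every
  continuous seminorm of the completion are summable. Restriction to \<open>V\<close> is a bijection from the
  continuous seminorms of the completion to those of \<open>V\<close>, and the terms lie in \<open>V\<close>, so the
  completion does not occur in the formula. No limit in \<open>V\<close> is required, and the limit in the
  completion exists because the partial sums form a Cauchy sequence.\<close>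

definition abs_convergent_in_completion ::
    "'v set \<Rightarrow> ('v \<Rightarrow> 'v \<Rightarrow> 'v) \<Rightarrow> ('k::real_normed_field \<Rightarrow> 'v \<Rightarrow> 'v) \<Rightarrow> 'v topology
      \<Rightarrow> (nat \<Rightarrow> 'v) \<Rightarrow> bool"
  where "abs_convergent_in_completion V vadd vscale T a \<longleftrightarrow>
    (\<forall>p. continuous_seminorm V vadd vscale T p \<longrightarrow> summable (\<lambda>n. p (a n)))"


section \<open>AE-Lie algebras\<close>

locale lie_algebra = vector_space smul
  for smul :: "'k::field \<Rightarrow> 'g::ab_group_add \<Rightarrow> 'g" +
  fixes bracket :: "'g \<Rightarrow> 'g \<Rightarrow> 'g"
  assumes bracket_add_left: "bracket (x + y) z = bracket x z + bracket y z"
    and bracket_add_right: "bracket x (y + z) = bracket x y + bracket x z"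
    and bracket_scale_left: "bracket (smul c x) y = smul c (bracket x y)"
    and bracket_scale_right: "bracket x (smul c y) = smul c (bracket x y)"
    and bracket_self: "bracket x x = 0"
    and jacobi: "bracket x (bracket y z) + bracket y (bracket z x) + bracket z (bracket x y) = 0"

text \<open>A word made out of \<open>n - 1\<close> brackets of \<open>x\<^sub>1, \<dots>, x\<^sub>n\<close> is a binary tree with \<open>n\<close> leaves.\<close>

datatype 'a lie_word = Letter 'a | Bracket "'a lie_word" "'a lie_word"

primrec word_letters :: "'a lie_word \<Rightarrow> 'a list" where
  "word_letters (Letter x) = [x]"
| "word_letters (Bracket v w) = word_letters v @ word_letters w"

primrec word_value :: "('a \<Rightarrow> 'a \<Rightarrow> 'a) \<Rightarrow> 'a lie_word \<Rightarrow> 'a" where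
  "word_value br (Letter x) = x"
| "word_value br (Bracket v w) = br (word_value br v) (word_value br w)"

locale ae_lie_algebra = lie_algebra smul bracket
  for smul :: "'k::real_normed_field \<Rightarrow> 'g::ab_group_add \<Rightarrow> 'g" and bracket +
  fixes T :: "'g topology"
  assumes locally_convex: "locally_convex_topology UNIV (+) smul T"
    and continuous_bracket: "continuous_map (prod_topology T T) T (\<lambda>(x, y). bracket x y)"
    and asymptotic_estimate: "continuous_seminorm UNIV (+) smul T p \<Longrightarrow>
      \<exists>q. continuous_seminorm UNIV (+) smul T q \<and>
        (\<forall>w. p (word_value bracket w) \<le> (\<Prod>x\<leftarrow>word_letters w. q x))"


section \<open>Free, tensor and universal enveloping algebra\<close>

text \<open>With concatenation as addition, \<^typ>\<open>'g list\<close> is the free monoid on \<^typ>\<open>'g\<close>, and the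
  convolution ring \<open>'g list \<Rightarrow>\<^sub>0 'k\<close> of finitely supported functions is the free associative unital
  algebra on the set \<^typ>\<open>'g\<close>. A scalar \<open>c\<close> is identified with \<^term>\<open>Poly_Mapping.single [] c\<close>.\<close>

instantiation list :: (type) monoid_add
begin

definition zero_list :: "'a list" where "zero_list = []"

definition plus_list :: "'a list \<Rightarrow> 'a list \<Rightarrow> 'a list" where "plus_list xs ys = xs @ ys"

instance
  by standard (simp_all add: zero_list_def plus_list_def)

end

abbreviation free_algebra :: "('g list \<Rightarrow>\<^sub>0 'k::field) ring"
  where "free_algebra \<equiv> ring_of_type_algebra"

definition scalar :: "'k::field \<Rightarrow> ('g list \<Rightarrow>\<^sub>0 'k)"
  where "scalar c = Poly_Mapping.single [] c"

definition monomial :: "'g list \<Rightarrow> ('g list \<Rightarrow>\<^sub>0 'k::field)"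
  where "monomial xs = Poly_Mapping.single xs 1"

definition linearity_relations ::
    "('k::field \<Rightarrow> 'g::ab_group_add \<Rightarrow> 'g) \<Rightarrow> ('g list \<Rightarrow>\<^sub>0 'k) set"
  where "linearity_relations smul =
    {monomial [x + y] - monomial [x] - monomial [y] | x y. True} \<union>
    {monomial [smul c x] - scalar c * monomial [x] | c x. True}"

definition commutator_relations :: "('g \<Rightarrow> 'g \<Rightarrow> 'g) \<Rightarrow> ('g list \<Rightarrow>\<^sub>0 'k::field) set"
  where "commutator_relations br =
    {monomial [x] * monomial [y] - monomial [y] * monomial [x] - monomial [br x y] | x y. True}"

definition tensor_ideal :: "('k::field \<Rightarrow> 'g::ab_group_add \<Rightarrow> 'g) \<Rightarrow> ('g list \<Rightarrow>\<^sub>0 'k) set"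
  where "tensor_ideal smul = genideal free_algebra (linearity_relations smul)"

definition tensor_algebra ::
    "('k::field \<Rightarrow> 'g::ab_group_add \<Rightarrow> 'g) \<Rightarrow> ('g list \<Rightarrow>\<^sub>0 'k) set ring"
  where "tensor_algebra smul = free_algebra Quot tensor_ideal smul"

text \<open>The image in the tensor algebra: \<^term>\<open>monomial [x, y, z]\<close> becomes \<open>x \<otimes> y \<otimes> z\<close>.\<close>

definition tensor_class ::
    "('k::field \<Rightarrow> 'g::ab_group_add \<Rightarrow> 'g) \<Rightarrow> ('g list \<Rightarrow>\<^sub>0 'k) \<Rightarrow> ('g list \<Rightarrow>\<^sub>0 'k) set"
  where "tensor_class smul f = tensor_ideal smul +>\<^bsub>free_algebra\<^esub> f"

definition tensor_add ::
    "('k::field \<Rightarrow> 'g::ab_group_add \<Rightarrow> 'g)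
      \<Rightarrow> ('g list \<Rightarrow>\<^sub>0 'k) set \<Rightarrow> ('g list \<Rightarrow>\<^sub>0 'k) set \<Rightarrow> ('g list \<Rightarrow>\<^sub>0 'k) set"
  where "tensor_add smul s t = s \<oplus>\<^bsub>tensor_algebra smul\<^esub> t"

definition tensor_scale ::
    "('k::field \<Rightarrow> 'g::ab_group_add \<Rightarrow> 'g)
      \<Rightarrow> 'k \<Rightarrow> ('g list \<Rightarrow>\<^sub>0 'k) set \<Rightarrow> ('g list \<Rightarrow>\<^sub>0 'k) set"
  where "tensor_scale smul c t = tensor_class smul (scalar c) \<otimes>\<^bsub>tensor_algebra smul\<^esub> t"

definition enveloping_ideal ::
    "('k::field \<Rightarrow> 'g::ab_group_add \<Rightarrow> 'g) \<Rightarrow> ('g \<Rightarrow> 'g \<Rightarrow> 'g) \<Rightarrow> ('g list \<Rightarrow>\<^sub>0 'k) set"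
  where "enveloping_ideal smul br =
    genideal free_algebra (linearity_relations smul \<union> commutator_relations br)"

definition enveloping_algebra ::
    "('k::field \<Rightarrow> 'g::ab_group_add \<Rightarrow> 'g) \<Rightarrow> ('g \<Rightarrow> 'g \<Rightarrow> 'g) \<Rightarrow> ('g list \<Rightarrow>\<^sub>0 'k) set ring"
  where "enveloping_algebra smul br = free_algebra Quot enveloping_ideal smul br"

definition enveloping_class ::
    "('k::field \<Rightarrow> 'g::ab_group_add \<Rightarrow> 'g) \<Rightarrow> ('g \<Rightarrow> 'g \<Rightarrow> 'g)
      \<Rightarrow> ('g list \<Rightarrow>\<^sub>0 'k) \<Rightarrow> ('g list \<Rightarrow>\<^sub>0 'k) set"
  where "enveloping_class smul br f = enveloping_ideal smul br +>\<^bsub>free_algebra\<^esub> f"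


section \<open>The symmetric tensor algebra\<close>

definition homogeneous :: "nat \<Rightarrow> ('g list \<Rightarrow>\<^sub>0 'k::field) set"
  where "homogeneous n = {f. \<forall>xs\<in>Poly_Mapping.keys f. length xs = n}"

definition homogeneous_part :: "nat \<Rightarrow> ('g list \<Rightarrow>\<^sub>0 'k::field) \<Rightarrow> ('g list \<Rightarrow>\<^sub>0 'k)"
  where "homogeneous_part n f =
    (\<Sum>xs | xs \<in> Poly_Mapping.keys f \<and> length xs = n.
      Poly_Mapping.single xs (Poly_Mapping.lookup f xs))"

text \<open>The linear map that sends the monomial \<open>x\<^sub>1 \<cdots> x\<^sub>n\<close> to the mean of its \<open>n!\<close> rearrangements.\<close>

definition symmetrize :: "('g list \<Rightarrow>\<^sub>0 'k::field_char_0) \<Rightarrow> ('g list \<Rightarrow>\<^sub>0 'k)"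
  where "symmetrize f =
    (\<Sum>xs\<in>Poly_Mapping.keys f. \<Sum>\<sigma> | \<sigma> permutes {..<length xs}.
      Poly_Mapping.single (permute_list \<sigma> xs) (Poly_Mapping.lookup f xs / fact (length xs)))"

definition tensor_power ::
    "('k::field_char_0 \<Rightarrow> 'g::ab_group_add \<Rightarrow> 'g) \<Rightarrow> nat \<Rightarrow> ('g list \<Rightarrow>\<^sub>0 'k) set set"
  where "tensor_power smul n = tensor_class smul ` homogeneous n"

definition sym_power ::
    "('k::field_char_0 \<Rightarrow> 'g::ab_group_add \<Rightarrow> 'g) \<Rightarrow> nat \<Rightarrow> ('g list \<Rightarrow>\<^sub>0 'k) set set"
  where "sym_power smul n = (\<lambda>f. tensor_class smul (symmetrize f)) ` homogeneous n"

text \<open>The direct sum of the symmetric powers, inside the tensor algebra.\<close>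

definition sym_algebra ::
    "('k::field_char_0 \<Rightarrow> 'g::ab_group_add \<Rightarrow> 'g) \<Rightarrow> ('g list \<Rightarrow>\<^sub>0 'k) set set"
  where "sym_algebra smul = range (\<lambda>f. tensor_class smul (symmetrize f))"

text \<open>The symmetric product \<open>\<xi>\<^sub>1 \<cdots> \<xi>\<^sub>n\<close> of elements of the Lie algebra.\<close>

definition sym_product ::
    "('k::field_char_0 \<Rightarrow> 'g::ab_group_add \<Rightarrow> 'g) \<Rightarrow> 'g list \<Rightarrow> ('g list \<Rightarrow>\<^sub>0 'k) set"
  where "sym_product smul xs = tensor_class smul (symmetrize (monomial xs))"

text \<open>The result does not depend on the chosen representative, because \<^const>\<open>tensor_ideal\<close> is
  generated by homogeneous elements.\<close>

definition sym_projection ::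
    "('k::field_char_0 \<Rightarrow> 'g::ab_group_add \<Rightarrow> 'g) \<Rightarrow> nat
      \<Rightarrow> ('g list \<Rightarrow>\<^sub>0 'k) set \<Rightarrow> ('g list \<Rightarrow>\<^sub>0 'k) set"
  where "sym_projection smul n t = tensor_class smul (homogeneous_part n (SOME f. f \<in> t))"

text \<open>The projective seminorm \<open>p\<^sub>1 \<otimes> \<cdots> \<otimes> p\<^sub>n\<close>. The representatives \<open>f \<in> t\<close> of degree \<open>n\<close> are the
  ways to write \<open>t\<close> as a finite sum of elementary tensors \<open>c x\<^sub>1 \<otimes> \<cdots> \<otimes> x\<^sub>n\<close>.\<close>

definition projective_seminorm ::
    "('g \<Rightarrow> real) list \<Rightarrow> ('g list \<Rightarrow>\<^sub>0 'k::real_normed_field) set \<Rightarrow> real"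
  where "projective_seminorm ps t =
    Inf {\<Sum>xs\<in>Poly_Mapping.keys f.
          norm (Poly_Mapping.lookup f xs) * (\<Prod>i<length ps. (ps ! i) (xs ! i))
        | f. f \<in> t \<and> f \<in> homogeneous (length ps)}"

definition tensor_power_topology ::
    "('k::real_normed_field \<Rightarrow> 'g::ab_group_add \<Rightarrow> 'g) \<Rightarrow> 'g topology \<Rightarrow> nat
      \<Rightarrow> ('g list \<Rightarrow>\<^sub>0 'k) set topology"
  where "tensor_power_topology smul T n =
    seminorm_topology (tensor_power smul n) (tensor_add smul) (tensor_scale smul)
      {projective_seminorm ps | ps. length ps = n \<and>
        (\<forall>p\<in>set ps. continuous_seminorm UNIV (+) smul T p)}"

definition sym_power_topology ::
    "('k::real_normed_field \<Rightarrow> 'g::ab_group_add \<Rightarrow> 'g) \<Rightarrow> 'g topology \<Rightarrow> nat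
      \<Rightarrow> ('g list \<Rightarrow>\<^sub>0 'k) set topology"
  where "sym_power_topology smul T n =
    subtopology (tensor_power_topology smul T n) (sym_power smul n)"


section \<open>The Gutt star product\<close>

text \<open>The linear map \<open>\<xi>\<^sub>1 \<cdots> \<xi>\<^sub>n \<mapsto> 1/n! \<Sum>\<^sub>\<sigma> \<xi>\<^sub>\<sigma>\<^sub>(\<^sub>1\<^sub>) \<odot> \<cdots> \<odot> \<xi>\<^sub>\<sigma>\<^sub>(\<^sub>n\<^sub>)\<close> on \<^const>\<open>sym_algebra\<close>: if \<open>f\<close> represents
  a symmetric tensor \<open>t\<close>, then \<open>t\<close> is the linear combination of the symmetric products of the
  monomials of \<open>f\<close>, with the same coefficients.\<close>

definition symmetrization_map ::
    "('k::field_char_0 \<Rightarrow> 'g::ab_group_add \<Rightarrow> 'g) \<Rightarrow> ('g \<Rightarrow> 'g \<Rightarrow> 'g)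
      \<Rightarrow> ('g list \<Rightarrow>\<^sub>0 'k) set \<Rightarrow> ('g list \<Rightarrow>\<^sub>0 'k) set"
  where "symmetrization_map smul br t = enveloping_class smul br (symmetrize (SOME f. f \<in> t))"

text \<open>By the Poincare-Birkhoff-Witt theorem \<^const>\<open>symmetrization_map\<close> is a bijection from
  \<^const>\<open>sym_algebra\<close> onto the enveloping algebra.\<close>

definition gutt_star ::
    "('k::field_char_0 \<Rightarrow> 'g::ab_group_add \<Rightarrow> 'g) \<Rightarrow> ('g \<Rightarrow> 'g \<Rightarrow> 'g)
      \<Rightarrow> ('g list \<Rightarrow>\<^sub>0 'k) set \<Rightarrow> ('g list \<Rightarrow>\<^sub>0 'k) set \<Rightarrow> ('g list \<Rightarrow>\<^sub>0 'k) set"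
  where "gutt_star smul br s t =
    inv_into (sym_algebra smul) (symmetrization_map smul br)
      (symmetrization_map smul br s \<otimes>\<^bsub>enveloping_algebra smul br\<^esub> symmetrization_map smul br t)"


section \<open>The Baker-Campbell-Hausdorff series\<close>

text \<open>The series \<open>exp (t \<xi>)\<close> over the free algebra; the variable \<open>t\<close> records the total degree.\<close>

definition exp_series :: "'g \<Rightarrow> ('g list \<Rightarrow>\<^sub>0 'k::field_char_0) fps"
  where "exp_series \<xi> = Abs_fps (\<lambda>n. scalar (1 / fact n) * monomial (replicate n \<xi>))"

text \<open>The part of degree \<open>n\<close> of \<open>log (exp \<xi> exp \<eta>)\<close> in the noncommuting letters \<open>\<xi>\<close> and \<open>\<eta>\<close>. The
  logarithm is \<open>\<Sum>\<^sub>k (-1)\<^bsup>k+1\<^esup>/k (exp \<xi> exp \<eta> - 1)\<^bsup>k\<^esup>\<close>, and only \<open>k \<le> n\<close> contributes to degree \<open>n\<close>.\<close>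

definition bch_polynomial :: "nat \<Rightarrow> 'g \<Rightarrow> 'g \<Rightarrow> ('g list \<Rightarrow>\<^sub>0 'k::field_char_0)"
  where "bch_polynomial n \<xi> \<eta> =
    (\<Sum>k = 1..n. scalar ((- 1) ^ (k + 1) / of_nat k) *
      fps_nth ((exp_series \<xi> * exp_series \<eta> - 1) ^ k) n)"

fun nested_bracket :: "('g \<Rightarrow> 'g \<Rightarrow> 'g) \<Rightarrow> 'g::zero list \<Rightarrow> 'g" where
  "nested_bracket br [] = 0"
| "nested_bracket br [x] = x"
| "nested_bracket br (x # y # xs) = br x (nested_bracket br (y # xs))"

text \<open>Dynkin's form of the series: a homogeneous Lie polynomial of degree \<open>n\<close> is written in Lie
  brackets by replacing each monomial \<open>x\<^sub>1 \<cdots> x\<^sub>n\<close> by \<open>1/n [x\<^sub>1, [x\<^sub>2, \<dots>, [x\<^sub>n\<^sub>-\<^sub>1, x\<^sub>n] \<dots>]]\<close>. This commutes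
  with substitution of the letters, so it is harmless that \<open>\<xi>\<close> and \<open>\<eta>\<close> are equal or linearly
  dependent elements of the Lie algebra.\<close>

definition BCH ::
    "('k::field_char_0 \<Rightarrow> 'g::ab_group_add \<Rightarrow> 'g) \<Rightarrow> ('g \<Rightarrow> 'g \<Rightarrow> 'g) \<Rightarrow> nat \<Rightarrow> 'g \<Rightarrow> 'g \<Rightarrow> 'g"
  where "BCH smul br n \<xi> \<eta> =
    (let f = bch_polynomial n \<xi> \<eta> in
      \<Sum>xs\<in>Poly_Mapping.keys f.
        smul (Poly_Mapping.lookup f xs / of_nat n) (nested_bracket br xs))"

definition BCH_converges ::
    "('k::field_char_0 \<Rightarrow> 'g::ab_group_add \<Rightarrow> 'g) \<Rightarrow> ('g \<Rightarrow> 'g \<Rightarrow> 'g) \<Rightarrow> 'g topology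
      \<Rightarrow> 'g \<Rightarrow> 'g \<Rightarrow> bool"
  where "BCH_converges smul br T \<xi> \<eta> \<longleftrightarrow>
    (\<exists>l. limitin T (\<lambda>N. \<Sum>n = 1..N. BCH smul br n \<xi> \<eta>) l sequentially)"

end

theory Submission
  imports Defs
begin

text \<open>Suppose that such a topology exists. Continuity of the star product at the origin and absolute
  convergence of \<open>exp \<xi>\<close> and \<open>exp \<eta>\<close> make the double series of the \<open>\<xi>\<^sup>i \<star> \<eta>\<^sup>j / (i! j!)\<close> converge
  absolutely, hence so does the series of its projections to the Lie algebra. These projections are the parts of
  bidegree \<open>(i, j)\<close> of the Baker-Campbell-Hausdorff series, which therefore converges by completeness.

  The projection of the star product is computed without the Poincare-Birkhoff-Witt theorem, by means
  of a linear functional on the free algebra: Dynkin's operator applied to the logarithm of the identity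
  for the convolution product (the first Eulerian idempotent). On \<open>\<xi>\<^sup>i \<eta>\<^sup>j\<close> it is a part of the
  Baker-Campbell-Hausdorff series by definition, and symmetry makes it the projection to degree one on
  symmetrized words. It vanishes on the enveloping ideal because the logarithm at a word can be written as
  nested commutators that start with any prescribed letter of the word; choosing for this letter one of two
  neighbours, exchanging them adds a bracket.\<close>

section \<open>The free algebra\<close>

text \<open>A marked gap makes insertion of a letter a derivation of the convolution ring, so the
  logarithm can be differentiated. Let J be the identity minus the unit, and l and r multiplication
  by J from the left and from the right. Insertion of a letter a turns J into
  \<open>word_ins a\<close>, and the derivative of log (1 + J) is the integral over [0, 1] of (1 +
  (1 - t) l + t r)^-1 applied to \<open>word_ins a\<close>. On the other side, commutators starting
  with a turn right multiplication by words into conjugation, so those built from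
  \<open>word_right\<close> times J^k are (1 + l)^(-k-1) (r - l)^k applied to
  \<open>word_ins a\<close>. Weighted by (-1)^k / (k + 1), with 1 / (k + 1) the integral of t^k,
  they sum to the same integral. The polynomial inside the commutators comes from
  \<open>word_right\<close> times log (1 + J) / J and does not depend on a: hence linearity in each
  letter and the comparison of neighbouring letters. The star product is given by chosen preimages
  and representatives; its degree one part is accessible because symmetrization is onto and the
  functional vanishes on the ideal.\<close>

abbreviation letter :: "'a \<Rightarrow> ('a list \<Rightarrow>\<^sub>0 'k::field)"
  where "letter x \<equiv> monomial [x]"

lemma scalar_mult: "scalar a * scalar b = scalar (a * b)"
  by (simp add: scalar_def mult_single plus_list_def)

lemma scalar_0 [simp]: "scalar 0 = 0"
  by (simp add: scalar_def)

lemma scalar_1 [simp]: "scalar 1 = 1"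
  by (simp add: scalar_def flip: single_one zero_list_def)

lemma scalar_add: "scalar (a + b) = scalar a + scalar b"
  by (simp add: scalar_def single_add)

lemma scalar_uminus: "scalar (- a) = - scalar a"
  by (simp add: scalar_def single_uminus)

lemma scalar_mult_monomial: "scalar c * monomial xs = Poly_Mapping.single xs c"
  by (simp add: scalar_def monomial_def mult_single plus_list_def)

lemma monomial_mult: "monomial xs * monomial ys = monomial (xs @ ys)"
  by (simp add: monomial_def mult_single plus_list_def)

lemma monomial_Nil [simp]: "monomial [] = 1"
  by (simp add: monomial_def flip: single_one zero_list_def)

lemma poly_mapping_sum_single:
  "(\<Sum>k\<in>Poly_Mapping.keys P. Poly_Mapping.single k (Poly_Mapping.lookup P k)) = P"
  by (rule poly_mapping_eqI)
    (auto simp: lookup_sum lookup_single when_def in_keys_iff)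

lemma single_induct [case_names single add]:
  assumes "\<And>k c. Q (Poly_Mapping.single k c)" "\<And>f g. Q f \<Longrightarrow> Q g \<Longrightarrow> Q (f + g)"
  shows "Q (P :: 'a \<Rightarrow>\<^sub>0 'b::comm_monoid_add)"
proof -
  have "Q (\<Sum>k\<in>A. Poly_Mapping.single k (Poly_Mapping.lookup P k))" if "finite A" for A
    using that
  proof induction
    case empty
    \<comment> \<open>The zero mapping is the multiple 0 of an arbitrary word.\<close>
    show ?case using assms(1)[of undefined 0] by simp
  qed (simp add: assms)
  from this[of "Poly_Mapping.keys P"] show ?thesis
    by (simp add: poly_mapping_sum_single)
qed

lemma scalar_commute: "scalar c * P = P * scalar c"
  by (induction P rule: single_induct)
    (simp_all add: algebra_simps scalar_def mult_single plus_list_def)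

lemma mult_scalar: "P * (scalar c * Q) = scalar c * (P * Q)"
  by (metis mult.assoc scalar_commute)

lemma lookup_scalar_mult:
  "Poly_Mapping.lookup (scalar c * P) xs = c * Poly_Mapping.lookup P xs"
  by (induction P rule: single_induct)
    (simp_all add: algebra_simps scalar_def mult_single plus_list_def lookup_add lookup_single when_def)

lemma keys_scalar_mult: "Poly_Mapping.keys (scalar c * P) \<subseteq> Poly_Mapping.keys P"
  by (auto simp: in_keys_iff lookup_scalar_mult)

lemma keys_multE:
  assumes "zs \<in> Poly_Mapping.keys (P * Q)"
  obtains xs ys where "xs \<in> Poly_Mapping.keys P" "ys \<in> Poly_Mapping.keys Q" "zs = xs @ ys"
  using assms keys_mult[of P Q] by (auto simp: plus_list_def)

text \<open>The scalar multiplication \<open>s\<close> is a parameter because values are taken both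
  in the Lie algebra, with \<open>smul\<close>, and in the free algebra, with multiplication by
  \<open>scalar c\<close>.\<close>

definition lin_ext :: "('k \<Rightarrow> 'b \<Rightarrow> 'b) \<Rightarrow> ('a \<Rightarrow> 'b) \<Rightarrow> ('a \<Rightarrow>\<^sub>0 'k::zero) \<Rightarrow> 'b::comm_monoid_add"
  where "lin_ext s f P = (\<Sum>k\<in>Poly_Mapping.keys P. s (Poly_Mapping.lookup P k) (f k))"

context vector_space begin

lemma lin_ext_superset:
  "finite A \<Longrightarrow> Poly_Mapping.keys P \<subseteq> A \<Longrightarrow>
    lin_ext scale f P = (\<Sum>k\<in>A. scale (Poly_Mapping.lookup P k) (f k))"
  unfolding lin_ext_def by (intro sum.mono_neutral_left) (auto simp: in_keys_iff)

lemma lin_ext_single [simp]: "lin_ext scale f (Poly_Mapping.single k c) = scale c (f k)"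
  by (subst lin_ext_superset[of "{k}"]) auto

lemma lin_ext_0 [simp]: "lin_ext scale f 0 = 0"
  by (simp add: lin_ext_def)

lemma lin_ext_add: "lin_ext scale f (P + Q) = lin_ext scale f P + lin_ext scale f Q"
proof -
  let ?A = "Poly_Mapping.keys P \<union> Poly_Mapping.keys Q"
  have "finite ?A" "Poly_Mapping.keys (P + Q) \<subseteq> ?A"
    using keys_add[of P Q] by auto
  then show ?thesis
    by (simp add: lin_ext_superset[where A = ?A] lookup_add scale_left_distrib sum.distrib)
qed

lemma lin_ext_sum: "lin_ext scale f (\<Sum>i\<in>I. P i) = (\<Sum>i\<in>I. lin_ext scale f (P i))"
  by (induction I rule: infinite_finite_induct) (simp_all add: lin_ext_add)

lemma lin_ext_uminus: "lin_ext scale f (- P) = - lin_ext scale f P"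
  using lin_ext_add[of f P "- P"] by (simp add: eq_neg_iff_add_eq_0 add.commute)

lemma lin_ext_diff: "lin_ext scale f (P - Q) = lin_ext scale f P - lin_ext scale f Q"
  using lin_ext_add[of f P "- Q"] by (simp add: lin_ext_uminus)

lemma lin_ext_add_fun:
  "lin_ext scale (\<lambda>x. f x + g x) P = lin_ext scale f P + lin_ext scale g P"
  by (simp add: lin_ext_def scale_right_distrib sum.distrib)

lemma lin_ext_cong:
  "(\<And>k. k \<in> Poly_Mapping.keys P \<Longrightarrow> f k = g k) \<Longrightarrow> lin_ext scale f P = lin_ext scale g P"
  by (simp add: lin_ext_def)

lemma lin_ext_fun_comp:
  assumes "\<And>x y. h (x + y) = h x + h y" "\<And>c x. h (scale c x) = scale c (h x)"
  shows "h (lin_ext scale f P) = lin_ext scale (\<lambda>k. h (f k)) P"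
  by (induction P rule: single_induct) (simp_all add: assms lin_ext_add)

lemma lin_ext_scalar: "lin_ext scale f (scalar c * P) = scale c (lin_ext scale f P)"
  by (induction P rule: single_induct)
    (simp_all add: lin_ext_add distrib_left scale_right_distrib scalar_def mult_single plus_list_def)

lemma lin_ext_monomial [simp]: "lin_ext scale f (monomial xs) = f xs"
  by (simp add: monomial_def)

lemma lin_ext_mult_monomial:
  "lin_ext scale f (P * monomial ys) = lin_ext scale (\<lambda>xs. f (xs @ ys)) P"
  by (induction P rule: single_induct)
    (simp_all add: lin_ext_add distrib_right monomial_def mult_single plus_list_def)

lemma lin_ext_monomial_mult:
  "lin_ext scale f (monomial ys * P) = lin_ext scale (\<lambda>xs. f (ys @ xs)) P"
  by (induction P rule: single_induct)
    (simp_all add: lin_ext_add distrib_left monomial_def mult_single plus_list_def)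

end

interpretation free_space: vector_space "\<lambda>c (P :: 'a list \<Rightarrow>\<^sub>0 'k::field). scalar c * P"
  by unfold_locales (simp_all add: distrib_left distrib_right scalar_add scalar_mult flip: mult.assoc)

section \<open>Word functions under convolution\<close>

text \<open>A pair \<open>(u, v)\<close> stands for the word \<open>rev u @ v\<close> with a marked gap, so that inserting a letter at
  the gap is a derivation for the convolution, which distributes the letters over two factors.\<close>

typedef ('a, 'r) word_fun = "UNIV :: ('a list \<Rightarrow> 'a list \<Rightarrow> 'r) set"
  morphisms ev Word_Fun ..

setup_lifting type_definition_word_fun

lemma word_fun_eqI: "(\<And>u v. ev f u v = ev g u v) \<Longrightarrow> f = g"
  by (metis ev_inverse ext)

text \<open>Convolution for the unshuffle coproduct: the letters are distributed in all ways to two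
  subwords, both of which keep the gap. The recursion is the Leibniz rule for a letter next to the
  gap.\<close>

fun conv :: "('a list \<Rightarrow> 'a list \<Rightarrow> 'r) \<Rightarrow> ('a list \<Rightarrow> 'a list \<Rightarrow> 'r) \<Rightarrow> 'a list \<Rightarrow> 'a list \<Rightarrow> 'r::semiring_0"
  where
  "conv f g [] [] = f [] [] * g [] []"
| "conv f g [] (x # v) = conv (\<lambda>u v. f u (x # v)) g [] v + conv f (\<lambda>u v. g u (x # v)) [] v"
| "conv f g (x # u) v = conv (\<lambda>u. f (x # u)) g u v + conv f (\<lambda>u. g (x # u)) u v"

text \<open>The recursion consumes the letters left of the gap first. That the rule on the right
  holds at every \<open>u\<close> makes insertion on the right a derivation too.\<close>

lemma conv_Cons2:
  "conv f g u (x # v) = conv (\<lambda>u v. f u (x # v)) g u v + conv f (\<lambda>u v. g u (x # v)) u v"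
  by (induction u arbitrary: f g) (simp_all add: ac_simps)

lemma conv_add_left: "conv (\<lambda>u v. f u v + f' u v) g u v = conv f g u v + conv f' g u v"
proof (induction u arbitrary: f f' g)
  case Nil
  show ?case by (induction v arbitrary: f f' g) (simp_all add: algebra_simps)
qed (simp_all add: algebra_simps)

lemma conv_add_right: "conv f (\<lambda>u v. g u v + g' u v) u v = conv f g u v + conv f g' u v"
proof (induction u arbitrary: f g g')
  case Nil
  show ?case by (induction v arbitrary: f g g') (simp_all add: algebra_simps)
qed (simp_all add: algebra_simps)

lemma conv_zero_left: "conv (\<lambda>u v. 0) g u v = 0"
proof (induction u arbitrary: g)
  case Nil
  show ?case by (induction v arbitrary: g) (simp_all add: ac_simps)
qed (simp_all add: ac_simps)

lemma conv_zero_right: "conv f (\<lambda>u v. 0) u v = 0"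
proof (induction u arbitrary: f)
  case Nil
  show ?case by (induction v arbitrary: f) (simp_all add: ac_simps)
qed (simp_all add: ac_simps)

text \<open>Unfolding either side sends each letter to one of the three factors, so both satisfy the
  same recursion.\<close>

lemma conv_assoc:
  fixes f :: "'a list \<Rightarrow> 'a list \<Rightarrow> 'b::semiring_0"
  shows "conv (conv f g) h u v = conv f (conv g h) u v"
proof (induction u arbitrary: f g h)
  case Nil
  show ?case
    by (induction v arbitrary: f g h)
      (simp_all add: conv_Cons2 conv_add_left conv_add_right algebra_simps)
next
  case (Cons x u)
  have "(\<lambda>u. conv f g (x # u)) = (\<lambda>u v. conv (\<lambda>u. f (x # u)) g u v + conv f (\<lambda>u. g (x # u)) u v)"
    for f g :: "'a list \<Rightarrow> 'a list \<Rightarrow> 'b"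
    by (simp add: fun_eq_iff)
  with Cons show ?case
    by (simp add: conv_add_left conv_add_right algebra_simps)
qed

instantiation word_fun :: (type, ring_1) ring_1
begin

lift_definition zero_word_fun :: "('a, 'b) word_fun" is "\<lambda>u v. 0" .
lift_definition one_word_fun :: "('a, 'b) word_fun" is "\<lambda>u v. if u = [] \<and> v = [] then 1 else 0" .
lift_definition plus_word_fun :: "('a, 'b) word_fun \<Rightarrow> ('a, 'b) word_fun \<Rightarrow> ('a, 'b) word_fun"
  is "\<lambda>f g u v. f u v + g u v" .
lift_definition minus_word_fun :: "('a, 'b) word_fun \<Rightarrow> ('a, 'b) word_fun \<Rightarrow> ('a, 'b) word_fun"
  is "\<lambda>f g u v. f u v - g u v" .
lift_definition uminus_word_fun :: "('a, 'b) word_fun \<Rightarrow> ('a, 'b) word_fun"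
  is "\<lambda>f u v. - f u v" .
lift_definition times_word_fun :: "('a, 'b) word_fun \<Rightarrow> ('a, 'b) word_fun \<Rightarrow> ('a, 'b) word_fun"
  is conv .

lemma conv_one_left: "conv (\<lambda>u v. if u = [] \<and> v = [] then 1 else 0) g u v = (g u v :: 'b)"
proof (induction u arbitrary: g)
  case Nil
  show ?case by (induction v arbitrary: g) (simp_all add: conv_zero_left)
qed (simp add: conv_zero_left)

lemma conv_one_right: "conv f (\<lambda>u v. if u = [] \<and> v = [] then 1 else 0) u v = (f u v :: 'b)"
proof (induction u arbitrary: f)
  case Nil
  show ?case by (induction v arbitrary: f) (simp_all add: conv_zero_right)
qed (simp add: conv_zero_right)

instance
proof
  fix a b c :: "('a, 'b) word_fun"
  show "0 \<noteq> (1 :: ('a, 'b) word_fun)"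
    by transfer (metis zero_neq_one)
  show "a * b * c = a * (b * c)" by transfer (simp add: conv_assoc fun_eq_iff)
  show "1 * a = a" by transfer (simp add: conv_one_left fun_eq_iff)
  show "a * 1 = a" by transfer (simp add: conv_one_right fun_eq_iff)
  show "(a + b) * c = a * c + b * c" by transfer (simp add: conv_add_left fun_eq_iff)
  show "a * (b + c) = a * b + a * c" by transfer (simp add: conv_add_right fun_eq_iff)
qed (transfer; simp add: algebra_simps)+

end

lemma ev_0 [simp]: "ev 0 u v = 0" by transfer simp
lemma ev_add [simp]: "ev (f + g) u v = ev f u v + ev g u v" by transfer simp
lemma ev_diff [simp]: "ev (f - g) u v = ev f u v - ev g u v" by transfer simp
lemma ev_1: "ev 1 u v = (if u = [] \<and> v = [] then 1 else 0)" by transfer simp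
lemma ev_mult_Nil [simp]: "ev (f * g) [] [] = ev f [] [] * ev g [] []" by transfer simp
lemma ev_sum [simp]: "ev (\<Sum>i\<in>A. f i) u v = (\<Sum>i\<in>A. ev (f i) u v)"
  by (induction A rule: infinite_finite_induct) simp_all

section \<open>Insertion of letters as derivations\<close>

lift_definition dleft :: "'a \<Rightarrow> ('a, 'r) word_fun \<Rightarrow> ('a, 'r) word_fun" is "\<lambda>x f u. f (x # u)" .
lift_definition dright :: "'a \<Rightarrow> ('a, 'r) word_fun \<Rightarrow> ('a, 'r) word_fun" is "\<lambda>x f u v. f u (x # v)" .

lemma ev_dleft: "ev (dleft x f) u v = ev f (x # u) v" by transfer simp
lemma ev_dright: "ev (dright x f) u v = ev f u (x # v)" by transfer simp

locale derivation =
  fixes d :: "'c::ring_1 \<Rightarrow> 'c"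
  assumes add: "d (f + g) = d f + d g"
    and mult: "d (f * g) = d f * g + f * d g"
begin

lemma zero [simp]: "d 0 = 0"
  using add[of 0 0] by simp

lemma one [simp]: "d 1 = 0"
  using mult[of 1 1] by simp

lemma uminus: "d (- f) = - d f"
  using add[of f "- f"] by (simp add: eq_neg_iff_add_eq_0 add.commute)

lemma diff: "d (f - g) = d f - d g"
  using add[of f "- g"] by (simp add: uminus)

lemma sum: "d (\<Sum>i\<in>A. f i) = (\<Sum>i\<in>A. d (f i))"
  by (induction A rule: infinite_finite_induct) (simp_all add: add)

lemma power: "d (f ^ n) = (\<Sum>i<n. f ^ i * d f * f ^ (n - Suc i))"
proof (induction n)
  case (Suc n)
  have "d (f ^ Suc n) = d f * f ^ n + (\<Sum>i<n. f ^ Suc i * d f * f ^ (n - Suc i))"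
    by (simp add: mult Suc sum_distrib_left mult.assoc)
  also have "\<dots> = (\<Sum>i<Suc n. f ^ i * d f * f ^ (Suc n - Suc i))"
    by (subst sum.lessThan_Suc_shift) simp
  finally show ?case .
qed simp

end

interpretation dleft: derivation "dleft x :: ('a, 'r::ring_1) word_fun \<Rightarrow> _"
  by unfold_locales (transfer; simp add: fun_eq_iff)+

interpretation dright: derivation "dright x :: ('a, 'r::ring_1) word_fun \<Rightarrow> _"
  by unfold_locales (transfer; simp add: fun_eq_iff conv_Cons2)+

text \<open>Functions supported on the empty word; convolution with \<open>const c\<close>
  multiplies all values by \<open>c\<close> on the respective side.\<close>

lift_definition const :: "'r::zero \<Rightarrow> ('a, 'r) word_fun"
  is "\<lambda>c u v. if u = [] \<and> v = [] then c else 0" .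

lemma dleft_const [simp]: "dleft x (const c) = 0" by transfer simp
lemma dright_const [simp]: "dright x (const c) = 0" by transfer simp
lemma ev_const: "ev (const c) u v = (if u = [] \<and> v = [] then c else 0)" by transfer simp

lemma ev_const_mult [simp]: "ev (const c * f) u v = c * ev f u v"
proof (induction u arbitrary: f)
  case Nil
  show ?case
    by (induction v arbitrary: f) (simp_all add: ev_const dright.mult flip: ev_dright)
qed (simp add: dleft.mult flip: ev_dleft)

lemma ev_mult_const [simp]: "ev (f * const c) u v = ev f u v * c"
proof (induction u arbitrary: f)
  case Nil
  show ?case
    by (induction v arbitrary: f) (simp_all add: ev_const dright.mult flip: ev_dright)
qed (simp add: dleft.mult flip: ev_dleft)

lemma const_mult: "const a * const b = (const (a * b) :: ('a, 'r::ring_1) word_fun)"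
  by (rule word_fun_eqI) (simp add: ev_const)

lemma const_0 [simp]: "const 0 = (0 :: ('a, 'r::ring_1) word_fun)"
  by (rule word_fun_eqI) (simp add: ev_const)

lemma const_1 [simp]: "const 1 = (1 :: ('a, 'r::ring_1) word_fun)"
  by (rule word_fun_eqI) (simp add: ev_const ev_1)

lemma const_add: "const (a + b) = (const a + const b :: ('a, 'r::ring_1) word_fun)"
  by (rule word_fun_eqI) (simp add: ev_const)

definition scale_wf :: "'k::field \<Rightarrow> ('a, 'b list \<Rightarrow>\<^sub>0 'k) word_fun \<Rightarrow> ('a, 'b list \<Rightarrow>\<^sub>0 'k) word_fun"
  where "scale_wf c f = const (scalar c) * f"

interpretation word_space: vector_space "scale_wf :: 'k::field \<Rightarrow> ('a, 'b list \<Rightarrow>\<^sub>0 'k) word_fun \<Rightarrow> _"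
  by unfold_locales
    (simp_all add: scale_wf_def algebra_simps scalar_add const_add const_mult scalar_mult flip: mult.assoc)

lemma ev_scale_wf [simp]: "ev (scale_wf c f) u v = scalar c * ev f u v"
  by (simp add: scale_wf_def)

lemma scale_wf_mult_left [simp]: "scale_wf c f * g = scale_wf c (f * g)"
  by (simp add: scale_wf_def mult.assoc)

lemma scale_wf_mult_right [simp]: "f * scale_wf c g = scale_wf c (f * g)"
proof -
  have "f * const (scalar c) = const (scalar c) * f"
    by (rule word_fun_eqI) (simp add: scalar_commute)
  then show ?thesis
    by (simp add: scale_wf_def flip: mult.assoc)
qed

lemma dleft_scale_wf: "dleft x (scale_wf c f) = scale_wf c (dleft x f)"
  by (simp add: scale_wf_def dleft.mult)

lemma dright_scale_wf: "dright x (scale_wf c f) = scale_wf c (dright x f)"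
  by (simp add: scale_wf_def dright.mult)

lift_definition wf_map :: "('r \<Rightarrow> 's) \<Rightarrow> ('a, 'r) word_fun \<Rightarrow> ('a, 's) word_fun"
  is "\<lambda>h f u v. h (f u v)" .

lemma ev_wf_map [simp]: "ev (wf_map h f) u v = h (ev f u v)"
  by transfer simp

lemma dleft_wf_map: "dleft x (wf_map h f) = wf_map h (dleft x f)"
  by transfer simp

lemma dright_wf_map: "dright x (wf_map h f) = wf_map h (dright x f)"
  by transfer simp

text \<open>Pascal's rule under a summation sign. It drives two binomial expansions: that of the
  integral for the derivative of the logarithm, and that of the iterated derivation behind the
  Baker-Campbell-Hausdorff series.\<close>

lemma (in vector_space) sum_pascal:
  fixes T :: "nat \<Rightarrow> nat \<Rightarrow> 'b"
  shows "(\<Sum>i\<le>n. scale (of_nat (n choose i)) (T (Suc i) (n - i) + T i (Suc n - i))) =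
    (\<Sum>i\<le>Suc n. scale (of_nat (Suc n choose i)) (T i (Suc n - i)))"
proof -
  have "(\<Sum>i\<le>Suc n. scale (of_nat (Suc n choose i)) (T i (Suc n - i))) =
      (\<Sum>i\<le>n. scale (of_nat (n choose i)) (T (Suc i) (n - i)))
      + (T 0 (Suc n) + (\<Sum>i\<le>n. scale (of_nat (n choose Suc i)) (T (Suc i) (n - i))))"
    by (subst sum.atMost_Suc_shift) (simp add: scale_left_distrib sum.distrib algebra_simps)
  also have "T 0 (Suc n) + (\<Sum>i\<le>n. scale (of_nat (n choose Suc i)) (T (Suc i) (n - i))) =
      (\<Sum>i\<le>Suc n. scale (of_nat (n choose i)) (T i (Suc n - i)))"
    by (subst sum.atMost_Suc_shift) (simp add: binomial_eq_0)
  finally show ?thesis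
    by (simp add: scale_right_distrib sum.distrib binomial_eq_0 del: binomial_Suc_Suc)
qed

subsection \<open>Order of vanishing\<close>

text \<open>The filtration by word length. It takes the place of convergence: series are truncated,
  and identities hold up to a high order of vanishing.\<close>

definition vanishes :: "nat \<Rightarrow> ('a, 'r::ring_1) word_fun \<Rightarrow> bool"
  where "vanishes n f \<longleftrightarrow> (\<forall>u v. length u + length v < n \<longrightarrow> ev f u v = 0)"

lemma vanishesD: "vanishes n f \<Longrightarrow> length u + length v < n \<Longrightarrow> ev f u v = 0"
  by (simp add: vanishes_def)

lemma vanishes_0 [simp]: "vanishes 0 f"
  by (simp add: vanishes_def)

lemma vanishes_zero [simp]: "vanishes n 0"
  by (simp add: vanishes_def)

lemma vanishes_add: "vanishes n f \<Longrightarrow> vanishes n g \<Longrightarrow> vanishes n (f + g)"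
  by (simp add: vanishes_def)

lemma vanishes_diff: "vanishes n f \<Longrightarrow> vanishes n g \<Longrightarrow> vanishes n (f - g)"
  by (simp add: vanishes_def)

lemma vanishes_scale: "vanishes n f \<Longrightarrow> vanishes n (scale_wf c f)"
  by (simp add: vanishes_def)

lemma vanishes_sum: "(\<And>i. i \<in> A \<Longrightarrow> vanishes n (f i)) \<Longrightarrow> vanishes n (\<Sum>i\<in>A. f i)"
  by (simp add: vanishes_def)

lemma vanishes_wf_map: "vanishes n f \<Longrightarrow> h 0 = 0 \<Longrightarrow> vanishes n (wf_map h f)"
  by (simp add: vanishes_def)

text \<open>Each letter goes to one of the factors and lowers its order by at most one; the
  truncated subtraction \<open>m - Suc 0\<close> covers order 0.\<close>

lemma vanishes_mult:
  assumes "vanishes m f" "vanishes n g"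
  shows "vanishes (m + n) (f * g)"
proof -
  have left: "vanishes (m - Suc 0) (dleft x f)" and right: "vanishes (m - Suc 0) (dright x f)"
    if "vanishes m f" for m x and f :: "('a, 'b) word_fun"
    using that by (auto simp: vanishes_def ev_dleft ev_dright)
  have "ev (f * g) u v = 0" if "length u + length v < m + n" for u v
    using that assms
  proof (induction u arbitrary: f g m n)
    case Nil
    then show ?case
    proof (induction v arbitrary: f g m n)
      case Nil
      then have "0 < m \<or> 0 < n" by auto
      with Nil show ?case by (auto simp: vanishes_def)
    next
      case (Cons x v)
      have "ev (dright x f * g) [] v = 0"
        using Cons.prems by (intro Cons.IH[of "m - Suc 0" n]) (auto intro: right)
      moreover have "ev (f * dright x g) [] v = 0"
        using Cons.prems by (intro Cons.IH[of m "n - Suc 0"]) (auto intro: right)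
      ultimately show ?case
        by (simp add: dright.mult flip: ev_dright)
    qed
  next
    case (Cons x u)
    have "ev (dleft x f * g) u v = 0"
      using Cons.prems by (intro Cons.IH[of "m - Suc 0" n]) (auto intro: left)
    moreover have "ev (f * dleft x g) u v = 0"
      using Cons.prems by (intro Cons.IH[of m "n - Suc 0"]) (auto intro: left)
    ultimately show ?case
      by (simp add: dleft.mult flip: ev_dleft)
  qed
  then show ?thesis by (simp add: vanishes_def)
qed

lemma vanishes_mult_left: "vanishes n g \<Longrightarrow> vanishes n (f * g)"
  using vanishes_mult[of 0 f n g] by simp

lemma vanishes_power: "vanishes 1 f \<Longrightarrow> vanishes n (f ^ n)"
  by (induction n) (use vanishes_mult[of 1 f] in simp_all)

subsection \<open>The identity and its logarithm\<close>

lift_definition word_left :: "('a, 'a list \<Rightarrow>\<^sub>0 'k::field) word_fun"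
  is "\<lambda>u v. if v = [] then monomial (rev u) else 0" .

lift_definition word_right :: "('a, 'a list \<Rightarrow>\<^sub>0 'k::field) word_fun"
  is "\<lambda>u v. if u = [] then monomial v else 0" .

text \<open>\<open>word_left\<close> admits no letter right of the gap and \<open>word_right\<close>
  none left of it, so a single splitting survives and the value is the word \<open>rev u @ v\<close>
  itself. The factored form has computable derivatives.\<close>

definition word_id :: "('a, 'a list \<Rightarrow>\<^sub>0 'k::field) word_fun"
  where "word_id = word_left * word_right"

definition word_ins :: "'a \<Rightarrow> ('a, 'a list \<Rightarrow>\<^sub>0 'k::field) word_fun"
  where "word_ins x = word_left * const (letter x) * word_right"

text \<open>The identity on nonempty words and 0 on the empty one; J in the comments below.\<close>

definition word_aug :: "('a, 'a list \<Rightarrow>\<^sub>0 'k::field) word_fun"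
  where "word_aug = word_id - 1"

lemma ev_word_left: "ev word_left u v = (if v = [] then monomial (rev u) else 0)"
  by transfer simp

lemma ev_word_right: "ev word_right u v = (if u = [] then monomial v else 0)"
  by transfer simp

lemma dleft_word_left: "dleft x word_left = word_left * const (letter x)"
  by (rule word_fun_eqI) (simp add: ev_dleft ev_word_left monomial_mult)

lemma dright_word_left: "dright x word_left = 0"
  by (rule word_fun_eqI) (simp add: ev_dright ev_word_left)

lemma dleft_word_right: "dleft x word_right = 0"
  by (rule word_fun_eqI) (simp add: ev_dleft ev_word_right)

lemma dright_word_right: "dright x word_right = const (letter x) * word_right"
  by (rule word_fun_eqI) (simp add: ev_dright ev_word_right monomial_mult)

lemma dleft_word_id: "dleft x word_id = word_ins x"
  by (simp add: word_id_def word_ins_def dleft.mult dleft_word_left dleft_word_right)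

lemma dright_word_id: "dright x word_id = word_ins x"
  by (simp add: word_id_def word_ins_def dright.mult dright_word_left dright_word_right mult.assoc)

lemma dleft_word_aug: "dleft x word_aug = word_ins x"
  by (simp add: word_aug_def dleft.diff dleft_word_id)

lemma dright_word_aug: "dright x word_aug = word_ins x"
  by (simp add: word_aug_def dright.diff dright_word_id)

lemma vanishes_word_aug_power: "vanishes n (word_aug ^ n)"
  by (rule vanishes_power)
    (simp add: vanishes_def word_aug_def word_id_def ev_1 ev_word_left ev_word_right)

text \<open>Truncation of log (1 + J). It is exact at words of length at most \<open>N\<close>,
  because J^m vanishes at words shorter than m.\<close>

definition word_log :: "nat \<Rightarrow> ('a, 'a list \<Rightarrow>\<^sub>0 'k::field_char_0) word_fun"
  where "word_log N = (\<Sum>m<N. scale_wf ((- 1) ^ m / of_nat (Suc m)) (word_aug ^ Suc m))"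

text \<open>\<open>word_right\<close> times the truncation of log (1 + J) / J. Applying
  \<open>left_comm_ext a\<close> turns it, below order \<open>N\<close>, into the derivative of the
  logarithm in the letter \<open>a\<close>.\<close>

definition log_derivative :: "nat \<Rightarrow> ('a, 'a list \<Rightarrow>\<^sub>0 'k::field_char_0) word_fun"
  where "log_derivative N = word_right * (\<Sum>k<N. scale_wf ((- 1) ^ k / of_nat (Suc k)) (word_aug ^ k))"

lemma dright_word_aug_power: "dright x (word_aug ^ n) = dleft x (word_aug ^ n)"
  by (simp add: dleft.power dright.power dleft_word_aug dright_word_aug)

lemma dright_word_log: "dright x (word_log N) = dleft x (word_log N)"
  by (simp add: word_log_def dleft.sum dright.sum dleft_scale_wf dright_scale_wf dright_word_aug_power
      del: power_Suc)

lemma dleft_word_log: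
  "dleft x (word_log N) = (\<Sum>m<N. scale_wf ((- 1) ^ m / of_nat (Suc m))
    (\<Sum>i\<le>m. word_aug ^ i * word_ins x * word_aug ^ (m - i)))"
  by (simp add: word_log_def dleft.sum dleft_scale_wf dleft.power dleft_word_aug lessThan_Suc_atMost
      del: power_Suc)

text \<open>Both insertions agree on powers of \<open>word_aug\<close>, so letters can be carried
  across the gap one by one: the logarithm sees the word and not the position of the gap.\<close>

lemma ev_word_log: "ev (word_log N) u v = ev (word_log N) [] (rev u @ v)"
proof (induction u arbitrary: v)
  case (Cons x u)
  have "ev (word_log N :: ('a, 'a list \<Rightarrow>\<^sub>0 'b) word_fun) (x # u) v = ev (word_log N) u (x # v)"
    by (metis dright_word_log ev_dleft ev_dright)
  then show ?case
    by (simp add: Cons)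
qed simp

lemma word_log_mono:
  assumes "N \<le> N'" "length u + length v \<le> N"
  shows "ev (word_log N') u v = ev (word_log N) u v"
  using assms(1)
proof (induction rule: dec_induct)
  case (step n)
  have "ev (word_aug ^ Suc n :: ('a, 'a list \<Rightarrow>\<^sub>0 'b) word_fun) u v = 0"
    using step.hyps assms(2) by (intro vanishesD[OF vanishes_word_aug_power]) simp
  with step show ?case
    by (simp add: word_log_def del: power_Suc)
qed simp

subsection \<open>The logarithm is a Lie polynomial\<close>

text \<open>The left-normed commutator [...[[a, x1], x2]..., xn], with the prescribed letter
  innermost.\<close>

definition left_comm :: "'a \<Rightarrow> 'a list \<Rightarrow> ('a list \<Rightarrow>\<^sub>0 'k::field)"
  where "left_comm a w = foldl (\<lambda>P x. P * letter x - letter x * P) (letter a) w"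

definition left_comm_ext :: "'a \<Rightarrow> ('a list \<Rightarrow>\<^sub>0 'k::field) \<Rightarrow> ('a list \<Rightarrow>\<^sub>0 'k)"
  where "left_comm_ext a = lin_ext (\<lambda>c P. scalar c * P) (left_comm a)"

lemma left_comm_ext_0 [simp]: "left_comm_ext a 0 = 0"
  by (simp add: left_comm_ext_def)

lemma left_comm_ext_1 [simp]: "left_comm_ext a 1 = letter a"
  using free_space.lin_ext_monomial[of "left_comm a" "[]"]
  by (simp add: left_comm_ext_def left_comm_def)

lemma left_comm_ext_add: "left_comm_ext a (P + Q) = left_comm_ext a P + left_comm_ext a Q"
  by (simp add: left_comm_ext_def free_space.lin_ext_add)

lemma left_comm_ext_diff: "left_comm_ext a (P - Q) = left_comm_ext a P - left_comm_ext a Q"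
  by (simp add: left_comm_ext_def free_space.lin_ext_diff)

lemma left_comm_ext_sum: "left_comm_ext a (\<Sum>i\<in>A. P i) = (\<Sum>i\<in>A. left_comm_ext a (P i))"
  by (simp add: left_comm_ext_def free_space.lin_ext_sum)

lemma left_comm_ext_scalar: "left_comm_ext a (scalar c * P) = scalar c * left_comm_ext a P"
  by (simp add: left_comm_ext_def free_space.lin_ext_scalar)

lemma left_comm_ext_letter:
  "left_comm_ext a (P * letter x) = left_comm_ext a P * letter x - letter x * left_comm_ext a P"
proof -
  let ?h = "\<lambda>P :: 'a list \<Rightarrow>\<^sub>0 'b. P * letter x - letter x * P"
  have "?h (scalar c * P) = scalar c * ?h P" for c P
    by (metis (no_types, lifting) mult.assoc right_diff_distrib scalar_commute)
  then have "?h (lin_ext (\<lambda>c P. scalar c * P) (left_comm a) P) =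
      lin_ext (\<lambda>c P. scalar c * P) (\<lambda>w. ?h (left_comm a w)) P"
    by (intro free_space.lin_ext_fun_comp) (simp_all add: algebra_simps)
  then show ?thesis
    by (simp add: left_comm_ext_def free_space.lin_ext_mult_monomial left_comm_def)
qed

lemma wf_map_left_comm_add:
  "wf_map (left_comm_ext a) (f + g) = wf_map (left_comm_ext a) f + wf_map (left_comm_ext a) g"
  by (rule word_fun_eqI) (simp add: left_comm_ext_add)

lemma wf_map_left_comm_diff:
  "wf_map (left_comm_ext a) (f - g) = wf_map (left_comm_ext a) f - wf_map (left_comm_ext a) g"
  by (rule word_fun_eqI) (simp add: left_comm_ext_diff)

lemma wf_map_left_comm_letter:
  "wf_map (left_comm_ext a) (f * const (letter x)) =
    wf_map (left_comm_ext a) f * const (letter x) - const (letter x) * wf_map (left_comm_ext a) f"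
  by (rule word_fun_eqI) (simp add: left_comm_ext_letter)

text \<open>A letter appended on the right acts as a commutator
  (\<open>left_comm_ext_letter\<close>). Iterating, right multiplication by \<open>word_left\<close>
  under \<open>left_comm_ext a\<close> becomes conjugation by \<open>word_left\<close>, whose
  convolution inverse is the signed reversal; the inverse has been moved to the other side.\<close>

lemma word_left_conjugation:
  "word_left * wf_map (left_comm_ext a) (f * word_left) = wf_map (left_comm_ext a) f * word_left"
proof (rule word_fun_eqI)
  fix u v
  let ?L = "wf_map (left_comm_ext a)"
  show "ev (word_left * ?L (f * word_left)) u v = ev (?L f * word_left) u v"
  proof (induction u arbitrary: f)
    case Nil
    show ?case
    proof (induction v arbitrary: f)
      case Nil
      show ?case by (simp add: ev_word_left)
    next
      case (Cons x v)
      then show ?case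
        by (simp add: dright.mult dright_word_left dright_wf_map flip: ev_dright)
    qed
  next
    case (Cons x u)
    let ?x = "const (letter x) :: ('a, 'a list \<Rightarrow>\<^sub>0 'b) word_fun"
    \<comment> \<open>The term with \<open>?x\<close> on the left cancels the derivative of the
      outer \<open>word_left\<close>.\<close>
    have "?L (f * (word_left * ?x)) = ?L (f * word_left) * ?x - ?x * ?L (f * word_left)"
      using wf_map_left_comm_letter[of a "f * word_left" x] by (simp add: mult.assoc)
    then have "dleft x (word_left * ?L (f * word_left)) =
        word_left * ?L (dleft x f * word_left) + word_left * ?L (f * word_left) * ?x"
      by (simp only: dleft.mult dleft_word_left dleft_wf_map wf_map_left_comm_add mult.assoc)
        (simp add: algebra_simps)
    moreover have "dleft x (?L f * word_left) = ?L (dleft x f) * word_left + ?L f * word_left * ?x"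
      by (simp add: dleft.mult dleft_word_left dleft_wf_map mult.assoc)
    ultimately show ?case
      by (simp add: Cons flip: ev_dleft)
  qed
qed

lemma word_right_conjugation:
  "word_right * wf_map (left_comm_ext a) (f * word_right) = wf_map (left_comm_ext a) f * word_right"
proof (rule word_fun_eqI)
  fix u v
  let ?L = "wf_map (left_comm_ext a)"
  show "ev (word_right * ?L (f * word_right)) u v = ev (?L f * word_right) u v"
  proof (induction u arbitrary: f)
    case Nil
    show ?case
    proof (induction v arbitrary: f)
      case Nil
      show ?case by (simp add: ev_word_right)
    next
      case (Cons x v)
      let ?x = "const (letter x) :: ('a, 'a list \<Rightarrow>\<^sub>0 'b) word_fun"
      \<comment> \<open>In \<open>word_right\<close> a new letter enters on the left, next to
        \<open>f\<close>; the induction hypothesis is therefore also applied to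
        \<open>f * ?x\<close>.\<close>
      have "dright x (word_right * ?L (f * word_right)) = ?x * (word_right * ?L (f * word_right)) +
          word_right * ?L (dright x f * word_right) + word_right * ?L (f * ?x * word_right)"
        by (simp add: dright.mult dright_word_right dright_wf_map wf_map_left_comm_add algebra_simps)
      moreover have "dright x (?L f * word_right) = ?x * (?L f * word_right) +
          ?L (dright x f) * word_right + ?L (f * ?x) * word_right"
        by (simp add: dright.mult dright_word_right dright_wf_map wf_map_left_comm_letter algebra_simps)
      ultimately show ?case
        by (simp add: Cons flip: ev_dright)
    qed
  next
    case (Cons x u)
    then show ?case
      by (simp add: dleft.mult dleft_word_right dleft_wf_map flip: ev_dleft)
  qed
qed

lemma word_id_conjugation:
  "word_id * wf_map (left_comm_ext a) (f * word_id) = wf_map (left_comm_ext a) f * word_id"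
  using word_right_conjugation[of a "f * word_left"] word_left_conjugation[of a f]
  by (simp add: word_id_def mult.assoc) (simp flip: mult.assoc)

section \<open>The derivative of the logarithm as a sum of nested commutators\<close>

definition comm_power :: "'a \<Rightarrow> nat \<Rightarrow> ('a, 'a list \<Rightarrow>\<^sub>0 'k::field) word_fun"
  where "comm_power a k = wf_map (left_comm_ext a) (word_right * word_aug ^ k)"

lemma vanishes_comm_power: "vanishes k (comm_power a k)"
  unfolding comm_power_def
  by (intro vanishes_wf_map vanishes_mult_left vanishes_word_aug_power) simp

text \<open>\<open>left_comm_ext a\<close> sends 1 to the letter \<open>a\<close>, and conjugation
  by \<open>word_right\<close> places it between \<open>word_left\<close> and
  \<open>word_right\<close>.\<close>

lemma word_id_comm_power_0: "word_id * comm_power a 0 = word_ins a"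
proof -
  have "wf_map (left_comm_ext a) (1 :: ('a, 'a list \<Rightarrow>\<^sub>0 'b) word_fun) = const (letter a)"
    by (rule word_fun_eqI) (simp add: ev_1 ev_const)
  then show ?thesis
    using word_right_conjugation[of a "1 :: ('a, 'a list \<Rightarrow>\<^sub>0 'b) word_fun"]
    by (simp add: word_id_def comm_power_def word_ins_def mult.assoc)
qed

text \<open>Since J^(k+1) = J^k \<open>word_id\<close> - J^k, conjugation yields a commutator with
  J. Hence \<open>comm_power a k\<close> is (1 + l)^(-k-1) (r - l)^k applied to
  \<open>word_ins a\<close>.\<close>

lemma word_id_comm_power_Suc:
  "word_id * comm_power a (Suc k) = comm_power a k * word_aug - word_aug * comm_power a k"
proof -
  have "word_right * word_aug ^ Suc k = (word_right * word_aug ^ k * word_id - word_right * word_aug ^ k :: ('a, 'a list \<Rightarrow>\<^sub>0 'b) word_fun)"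
    by (simp add: word_aug_def power_Suc2 algebra_simps del: power_Suc)
  moreover have "x * word_id - word_id * x = x * word_aug - word_aug * (x :: ('a, 'a list \<Rightarrow>\<^sub>0 'b) word_fun)"
    for x
    by (simp add: word_aug_def algebra_simps)
  ultimately show ?thesis
    by (simp only: comm_power_def wf_map_left_comm_diff right_diff_distrib word_id_conjugation)
qed

text \<open>\<open>i! j! / (i + j + 1)!\<close> is the integral of \<open>(1 - t)\<^sup>i t\<^sup>j\<close> over the unit interval. With
  \<open>J = word_aug\<close> acting from the left and from the right as \<open>l\<close>
      and \<open>r\<close>, \<open>comm_integral\<close> is the integral of
  \<open>(1 - t)\<^sup>i t\<^sup>j (1 + (1 - t) l + t r)\<^sup>-\<^sup>1\<close> applied to \<open>word_ins a\<close>; this geometric series, integrated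
  termwise, is the derivative of the logarithm.\<close>

definition beta_weight :: "nat \<Rightarrow> nat \<Rightarrow> 'k::field_char_0"
  where "beta_weight i j = fact i * fact j / fact (i + j + 1)"

lemma beta_weight_0: "beta_weight 0 j = 1 / of_nat (Suc j)"
  by (simp add: beta_weight_def)

text \<open>Under the integral, (1 - t)^(i+1) t^j = (1 - t)^i t^j - (1 - t)^i t^(j+1).\<close>

lemma beta_weight_split:
  "beta_weight (Suc i) j = beta_weight i j - (beta_weight i (Suc j) :: 'k::field_char_0)"
proof -
  have 1: "of_nat (i + j + 2) \<noteq> (0 :: 'k)"
    by (simp only: of_nat_eq_0_iff)
  have "beta_weight (Suc i) j = of_nat (Suc i) / of_nat (i + j + 2) * (beta_weight i j :: 'k)"
    "beta_weight i (Suc j) = of_nat (Suc j) / of_nat (i + j + 2) * (beta_weight i j :: 'k)"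
    by (simp_all add: beta_weight_def)
  then have "beta_weight (Suc i) j + beta_weight i (Suc j) =
      (of_nat (Suc i) + of_nat (Suc j)) / of_nat (i + j + 2) * (beta_weight i j :: 'k)"
    by (simp only: add_divide_distrib distrib_right)
  also have "of_nat (Suc i) + of_nat (Suc j) = (of_nat (i + j + 2) :: 'k)"
    by simp
  finally show ?thesis
    using 1 by (simp add: algebra_simps)
qed

text \<open>All Bernstein polynomials of degree n have the same integral over the unit
  interval.\<close>

lemma binomial_beta_weight:
  assumes "i \<le> n"
  shows "of_nat (n choose i) * beta_weight i (n - i) = (1 / of_nat (Suc n) :: 'k::field_char_0)"
proof -
  have "fact i * fact (n - i) * of_nat (n choose i) = (fact n :: 'k)"
    using binomial_fact_lemma[OF assms] by (metis of_nat_fact of_nat_mult)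
  then have "of_nat (n choose i) * beta_weight i (n - i) = (fact n / fact (Suc n) :: 'k)"
    using assms by (simp add: beta_weight_def mult.commute del: fact_Suc)
  then show ?thesis
    by (simp add: fact_Suc del: of_nat_Suc)
qed

definition comm_integral :: "'a \<Rightarrow> nat \<Rightarrow> nat \<Rightarrow> nat \<Rightarrow> ('a, 'a list \<Rightarrow>\<^sub>0 'k::field_char_0) word_fun"
  where "comm_integral a N i j =
    (\<Sum>k<N. scale_wf ((- 1) ^ k * beta_weight i (j + k)) (comm_power a k))"

text \<open>Applying 1 + (1 - t) l + t r to the integrand cancels the inverse and leaves (1 - t)^i
  t^j. The last term is the truncation error, which vanishes at words shorter than
  \<open>N\<close>.\<close>

lemma comm_integral_recursion:
  "comm_integral a N i j + word_aug * comm_integral a N (Suc i) j + comm_integral a N i (Suc j) * word_aug =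
    scale_wf (beta_weight i j) (word_ins a)
      - scale_wf ((- 1) ^ N * beta_weight i (j + N)) (word_id * comm_power a N)"
proof (induction N)
  case 0
  show ?case by (simp add: comm_integral_def word_id_comm_power_0)
next
  case (Suc N)
  let ?Y = "comm_power a N :: ('a, 'a list \<Rightarrow>\<^sub>0 'b) word_fun"
  \<comment> \<open>The new summand contributes a multiple of \<open>word_id * ?Y\<close>, which
    cancels the old error, and a commutator with J, which is the new error.\<close>
  have id: "word_id * ?Y = ?Y + word_aug * ?Y"
    by (simp add: word_aug_def algebra_simps)
  have "comm_integral a (Suc N) i j + word_aug * comm_integral a (Suc N) (Suc i) j
        + comm_integral a (Suc N) i (Suc j) * word_aug =
      (comm_integral a N i j + word_aug * comm_integral a N (Suc i) j
        + comm_integral a N i (Suc j) * word_aug)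
      + (scale_wf ((- 1) ^ N * beta_weight i (j + N)) ?Y
        + scale_wf ((- 1) ^ N * beta_weight (Suc i) (j + N)) (word_aug * ?Y)
        + scale_wf ((- 1) ^ N * beta_weight i (Suc (j + N))) (?Y * word_aug))"
    by (simp add: comm_integral_def distrib_left distrib_right add_ac)
  also have "\<dots> = scale_wf (beta_weight i j) (word_ins a)
      - scale_wf ((- 1) ^ Suc N * beta_weight i (j + Suc N)) (word_id * comm_power a (Suc N))"
    unfolding Suc
    by (simp add: id word_id_comm_power_Suc beta_weight_split algebra_simps
        word_space.scale_left_diff_distrib word_space.scale_right_diff_distrib
        word_space.scale_right_distrib word_space.scale_minus_left)
  finally show ?case .
qed

text \<open>Using the recursion \<open>n\<close> times expands the inverse into a geometric series:
  the first sum is the derivative of the truncated logarithm, and the remainder carries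
  \<open>n\<close> factors J.\<close>

lemma comm_integral_expansion:
  "vanishes N (comm_integral a N 0 0
    - ((\<Sum>m<n. scale_wf ((- 1) ^ m / of_nat (Suc m)) (\<Sum>i\<le>m. word_aug ^ i * word_ins a * word_aug ^ (m - i)))
      + scale_wf ((- 1) ^ n) (\<Sum>i\<le>n. scale_wf (of_nat (n choose i))
          (word_aug ^ i * comm_integral a N i (n - i) * word_aug ^ (n - i)))))"
  (is "vanishes N (?V - (?S n + scale_wf _ (?R n)))")
proof (induction n)
  case 0
  show ?case by simp
next
  case (Suc n)
  let ?T = "\<lambda>i j. word_aug ^ i * comm_integral a N i j * word_aug ^ j"
  let ?E = "\<lambda>i j. scale_wf ((- 1) ^ N * beta_weight i (j + N)) (word_id * comm_power a N)"
  let ?M = "\<lambda>i j. word_aug ^ i * word_ins a * word_aug ^ j"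
  \<comment> \<open>The recursion solved for its first term and placed between powers of J.\<close>
  have step: "?T i j = scale_wf (beta_weight i j) (?M i j) - word_aug ^ i * ?E i j * word_aug ^ j
      - (?T (Suc i) j + ?T i (Suc j))" for i j
  proof -
    have T1: "?T (Suc i) j = word_aug ^ i * (word_aug * comm_integral a N (Suc i) j) * word_aug ^ j"
      by (simp only: power_Suc2 mult.assoc)
    have T2: "?T i (Suc j) = word_aug ^ i * (comm_integral a N i (Suc j) * word_aug) * word_aug ^ j"
      by (simp only: power_Suc mult.assoc)
    have "?T i j + (?T (Suc i) j + ?T i (Suc j)) = word_aug ^ i *
        (comm_integral a N i j + word_aug * comm_integral a N (Suc i) j
          + comm_integral a N i (Suc j) * word_aug) * word_aug ^ j"
      unfolding T1 T2 by (simp only: distrib_left distrib_right add.assoc)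
    then show ?thesis
      by (simp only: comm_integral_recursion) (simp add: algebra_simps)
  qed
  have "?R n = (\<Sum>i\<le>n. scale_wf (of_nat (n choose i)) (scale_wf (beta_weight i (n - i)) (?M i (n - i))))
      - (\<Sum>i\<le>n. scale_wf (of_nat (n choose i)) (word_aug ^ i * ?E i (n - i) * word_aug ^ (n - i)))
      - (\<Sum>i\<le>n. scale_wf (of_nat (n choose i)) (?T (Suc i) (n - i) + ?T i (Suc (n - i))))"
    by (subst step) (simp only: word_space.scale_right_diff_distrib sum_subtractf)
  \<comment> \<open>Both new terms have one more factor J; Pascal's rule collects them with the next
    row of binomial coefficients.\<close>
  also have "(\<Sum>i\<le>n. scale_wf (of_nat (n choose i)) (?T (Suc i) (n - i) + ?T i (Suc (n - i)))) =
      ?R (Suc n)"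
    by (subst word_space.sum_pascal[symmetric]) (auto intro!: sum.cong simp: Suc_diff_le)
  \<comment> \<open>The equal Bernstein integrals produce the coefficient 1 / (n + 1) of the
    logarithm.\<close>
  also have "(\<Sum>i\<le>n. scale_wf (of_nat (n choose i)) (scale_wf (beta_weight i (n - i)) (?M i (n - i)))) =
      scale_wf (1 / of_nat (Suc n)) (\<Sum>i\<le>n. ?M i (n - i))"
    by (simp add: binomial_beta_weight word_space.scale_sum_right del: of_nat_Suc)
  finally have eq: "?S (Suc n) + scale_wf ((- 1) ^ Suc n) (?R (Suc n)) =
      ?S n + scale_wf ((- 1) ^ n) (?R n)
      + scale_wf ((- 1) ^ n) (\<Sum>i\<le>n. scale_wf (of_nat (n choose i)) (word_aug ^ i * ?E i (n - i) * word_aug ^ (n - i)))"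
    by (simp add: word_space.scale_right_diff_distrib word_space.scale_minus_left del: of_nat_Suc)
  have "vanishes N (scale_wf ((- 1) ^ n) (\<Sum>i\<le>n. scale_wf (of_nat (n choose i)) (word_aug ^ i * ?E i (n - i) * word_aug ^ (n - i))))"
    by (intro vanishes_scale vanishes_sum) (simp add: vanishes_mult_left[of _ _ "_ * _"] mult.assoc,
      intro vanishes_scale vanishes_mult_left vanishes_mult[of N _ 0, simplified] vanishes_comm_power)
  from vanishes_diff[OF Suc this] show ?case
    by (simp only: eq diff_diff_eq)
qed

text \<open>Both sides are the integral \<open>comm_integral a N 0 0\<close>: the left one by
  expansion, the right one by definition. On the right, \<open>a\<close> enters through
  \<open>left_comm_ext a\<close> alone.\<close>

theorem dleft_word_log_eq:
  assumes "length u + length v < N"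
  shows "ev (dleft a (word_log N)) u v = left_comm_ext a (ev (log_derivative N) u v)"
proof -
  \<comment> \<open>After \<open>N\<close> steps the remainder carries \<open>N\<close> factors
    J.\<close>
  have "vanishes N (\<Sum>i\<le>N. scale_wf (of_nat (N choose i))
      (word_aug ^ i * comm_integral a N i (N - i) * word_aug ^ (N - i)))"
  proof (intro vanishes_sum vanishes_scale)
    fix i assume "i \<in> {..N}"
    then show "vanishes N (word_aug ^ i * comm_integral a N i (N - i) * word_aug ^ (N - i))"
      using vanishes_mult[OF vanishes_mult[OF vanishes_word_aug_power[of i] vanishes_0] vanishes_word_aug_power[of "N - i"]]
      by simp
  qed
  from vanishes_add[OF comm_integral_expansion[of N a N] vanishes_scale[OF this, of "(- 1) ^ N"]]
  have "vanishes N (comm_integral a N 0 0 - dleft a (word_log N) :: ('a, 'a list \<Rightarrow>\<^sub>0 'b) word_fun)"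
    by (simp add: dleft_word_log del: of_nat_Suc)
  from vanishesD[OF this assms] have "ev (comm_integral a N 0 0 :: ('a, 'a list \<Rightarrow>\<^sub>0 'b) word_fun) u v =
      ev (dleft a (word_log N)) u v"
    by simp
  moreover have "ev (comm_integral a N 0 0 :: ('a, 'a list \<Rightarrow>\<^sub>0 'b) word_fun) u v =
      left_comm_ext a (ev (log_derivative N) u v)"
    by (simp add: comm_integral_def log_derivative_def beta_weight_0 comm_power_def sum_distrib_left
        left_comm_ext_sum left_comm_ext_scalar)
  ultimately show ?thesis by simp
qed

text \<open>Moving a letter across the gap only affects the factor \<^const>\<open>word_right\<close>.\<close>

lemma log_derivative_shift:
  "ev (log_derivative N) u (y # v) - ev (log_derivative N) (y # u) v =
      letter y * ev (log_derivative N) u v"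
proof -
  have "dright y (log_derivative N) - dleft y (log_derivative N) = const (letter y) * log_derivative N"
    by (simp add: log_derivative_def dleft.mult dright.mult dleft_word_right dright_word_right
        dleft.sum dright.sum dleft_scale_wf dright_scale_wf dright_word_aug_power mult.assoc)
  then show ?thesis
    by (metis ev_diff ev_const_mult ev_dleft ev_dright)
qed

section \<open>The Eulerian functional\<close>

text \<open>\<open>M\<close> collects the letters that derivatives have inserted already.\<close>

definition has_content :: "'a multiset \<Rightarrow> ('a, 'a list \<Rightarrow>\<^sub>0 'k::field) word_fun \<Rightarrow> bool"
  where "has_content M f \<longleftrightarrow>
    (\<forall>u v. \<forall>w\<in>Poly_Mapping.keys (ev f u v). mset w = M + mset u + mset v)"

lemma has_content_dleft: "has_content M f \<Longrightarrow> has_content (add_mset x M) (dleft x f)"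
  by (simp add: has_content_def ev_dleft)

lemma has_content_dright: "has_content M f \<Longrightarrow> has_content (add_mset x M) (dright x f)"
  by (simp add: has_content_def ev_dright)

lemma has_content_mult:
  assumes "has_content M f" "has_content M' g"
  shows "has_content (M + M') (f * g)"
proof -
  have "mset w = M + M' + mset u + mset v" if "w \<in> Poly_Mapping.keys (ev (f * g) u v)" for u v w
    using that assms
  proof (induction u arbitrary: f g M M')
    case Nil
    then show ?case
    proof (induction v arbitrary: f g M M')
      case Nil
      then show ?case
        by (auto simp: has_content_def elim!: keys_multE)
    next
      case (Cons x v)
      then have "w \<in> Poly_Mapping.keys (ev (dright x f * g) [] v + ev (f * dright x g) [] v)"
        by (simp add: dright.mult flip: ev_dright)
      then consider "w \<in> Poly_Mapping.keys (ev (dright x f * g) [] v)"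
        | "w \<in> Poly_Mapping.keys (ev (f * dright x g) [] v)"
        by (meson UnE keys_add subsetD)
      then show ?case
      proof cases
        case 1
        from Cons.IH[OF this has_content_dright[OF Cons.prems(2)] Cons.prems(3)] show ?thesis by simp
      next
        case 2
        from Cons.IH[OF this Cons.prems(2) has_content_dright[OF Cons.prems(3)]] show ?thesis by simp
      qed
    qed
  next
    case (Cons x u)
    then have "w \<in> Poly_Mapping.keys (ev (dleft x f * g) u v + ev (f * dleft x g) u v)"
      by (simp add: dleft.mult flip: ev_dleft)
    then consider "w \<in> Poly_Mapping.keys (ev (dleft x f * g) u v)"
      | "w \<in> Poly_Mapping.keys (ev (f * dleft x g) u v)"
      by (meson UnE keys_add subsetD)
    then show ?case
    proof cases
      case 1
      from Cons.IH[OF this has_content_dleft[OF Cons.prems(2)] Cons.prems(3)] show ?thesis by simp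
    next
      case 2
      from Cons.IH[OF this Cons.prems(2) has_content_dleft[OF Cons.prems(3)]] show ?thesis by simp
    qed
  qed
  then show ?thesis by (simp add: has_content_def)
qed

lemma has_content_sum:
  assumes "\<And>i. i \<in> A \<Longrightarrow> has_content M (f i)"
  shows "has_content M (\<Sum>i\<in>A. f i)"
proof -
  have "mset w = M + mset u + mset v"
    if "w \<in> Poly_Mapping.keys (\<Sum>i\<in>A. ev (f i) u v)" for u v w
    using that keys_sum[of "\<lambda>i. ev (f i) u v" A] assms by (auto simp: has_content_def)
  then show ?thesis by (simp add: has_content_def)
qed

lemma has_content_scale: "has_content M f \<Longrightarrow> has_content M (scale_wf c f)"
  unfolding has_content_def ev_scale_wf by (meson keys_scalar_mult subsetD)

lemma has_content_diff: "has_content M f \<Longrightarrow> has_content M g \<Longrightarrow> has_content M (f - g)"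
  unfolding has_content_def ev_diff by (meson UnE keys_diff subsetD)

lemma has_content_1: "has_content {#} 1"
  by (simp add: has_content_def ev_1 zero_list_def)

lemma has_content_word_aug: "has_content {#} word_aug"
proof -
  have "has_content {#} word_left" "has_content {#} word_right"
    by (simp_all add: has_content_def ev_word_left ev_word_right monomial_def)
  from has_content_mult[OF this] have "has_content {#} word_id"
    by (simp add: word_id_def)
  then show ?thesis
    unfolding word_aug_def by (intro has_content_diff has_content_1)
qed

lemma has_content_word_aug_power: "has_content {#} (word_aug ^ n)"
proof (induction n)
  case 0
  show ?case by (simp add: has_content_1)
next
  case (Suc n)
  show ?case
    using has_content_mult[OF has_content_word_aug Suc] by simp
qed

lemma has_content_log_derivative: "has_content {#} (log_derivative N)"
proof -
  have right: "has_content {#} word_right"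
    by (simp add: has_content_def ev_word_right monomial_def)
  have sum: "has_content {#} (\<Sum>k<N. scale_wf ((- 1) ^ k / of_nat (Suc k)) (word_aug ^ k))"
    by (intro has_content_sum has_content_scale has_content_word_aug_power)
  show ?thesis
    using has_content_mult[OF right sum] by (simp add: log_derivative_def)
qed

lemma length_log_derivative:
  "w \<in> Poly_Mapping.keys (ev (log_derivative N) u v) \<Longrightarrow> length w = length u + length v"
  using has_content_log_derivative[of N]
  unfolding has_content_def by (metis add_0 size_mset size_union)

section \<open>Evaluation of words by Lie brackets\<close>

locale lie_algebra_char_0 = lie_algebra smul bracket
  for smul :: "'k::field_char_0 \<Rightarrow> 'g::ab_group_add \<Rightarrow> 'g" and bracket
begin

definition bracket_foldl :: "'g \<Rightarrow> ('g list \<Rightarrow>\<^sub>0 'k) \<Rightarrow> 'g"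
  where "bracket_foldl a = lin_ext smul (foldl bracket a)"

text \<open>The adjoint action of the polynomial \<open>P\<close> on \<open>y\<close>.\<close>

definition bracket_foldr :: "('g list \<Rightarrow>\<^sub>0 'k) \<Rightarrow> 'g \<Rightarrow> 'g"
  where "bracket_foldr P y = lin_ext smul (\<lambda>xs. foldr bracket xs y) P"

definition dynkin :: "('g list \<Rightarrow>\<^sub>0 'k) \<Rightarrow> 'g"
  where "dynkin = lin_ext smul (nested_bracket bracket)"

text \<open>Dynkin's operator divided by the degree fixes Lie polynomials, so this is the first
  Eulerian idempotent evaluated by brackets. For the empty word the truncated logarithm is an empty
  sum.\<close>

definition eulerian_word :: "'g list \<Rightarrow> 'g"
  where "eulerian_word w = smul (1 / of_nat (length w)) (dynkin (ev (word_log (length w)) [] w))"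

definition eulerian :: "('g list \<Rightarrow>\<^sub>0 'k) \<Rightarrow> 'g"
  where "eulerian = lin_ext smul eulerian_word"

lemma bracket_zero_left [simp]: "bracket 0 x = 0"
  using bracket_add_left[of 0 0 x] by simp

lemma bracket_zero_right [simp]: "bracket x 0 = 0"
  using bracket_add_right[of x 0 0] by simp

lemma bracket_swap: "bracket x y = - bracket y x"
  using bracket_self[of "x + y"] bracket_self[of x] bracket_self[of y]
  by (simp add: bracket_add_left bracket_add_right eq_neg_iff_add_eq_0 add.commute)

lemma bracket_minus_right: "bracket x (- y) = - bracket x y"
  using bracket_add_right[of x y "- y"] by (simp add: minus_unique)

lemma bracket_bracket:
  "bracket (bracket x y) z = bracket x (bracket y z) - bracket y (bracket x z)"
  using jacobi[of x y z] bracket_swap[of z "bracket x y"] bracket_swap[of z x]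
  by (simp add: bracket_minus_right algebra_simps)

lemma foldl_bracket_add: "foldl bracket (a + b) xs = foldl bracket a xs + foldl bracket b xs"
  by (induction xs arbitrary: a b) (simp_all add: bracket_add_left)

lemma foldl_bracket_smul: "foldl bracket (smul c a) xs = smul c (foldl bracket a xs)"
  by (induction xs arbitrary: a) (simp_all add: bracket_scale_left)

lemma bracket_foldl_add: "bracket_foldl (a + b) P = bracket_foldl a P + bracket_foldl b P"
  by (simp add: bracket_foldl_def foldl_bracket_add[abs_def] lin_ext_add_fun)

lemma bracket_foldl_smul: "bracket_foldl (smul c a) P = smul c (bracket_foldl a P)"
  by (simp add: bracket_foldl_def foldl_bracket_smul[abs_def] lin_ext_fun_comp scale_right_distrib mult.commute)

lemma bracket_foldl_letter_mult:
  "bracket_foldl a (letter x * P) = bracket_foldl (bracket a x) P"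
  by (simp add: bracket_foldl_def lin_ext_monomial_mult)

lemma nested_bracket_append: "nested_bracket bracket (xs @ [x]) = foldr bracket xs x"
proof (induction xs)
  case (Cons y xs)
  then show ?case by (cases xs) simp_all
qed simp

lemma dynkin_diff: "dynkin (P - Q) = dynkin P - dynkin Q"
  by (simp add: dynkin_def lin_ext_diff)

lemma dynkin_mult_letter: "dynkin (P * letter x) = bracket_foldr P x"
  by (simp add: dynkin_def bracket_foldr_def lin_ext_mult_monomial nested_bracket_append)

text \<open>The empty word is excluded because \<open>nested_bracket\<close> sends
  \<open>[x]\<close> to \<open>x\<close> itself, whereas \<open>bracket x (dynkin 1)\<close> is
  0.\<close>

lemma dynkin_letter_mult:
  assumes "[] \<notin> Poly_Mapping.keys P"
  shows "dynkin (letter x * P) = bracket x (dynkin P)"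
proof -
  have "nested_bracket bracket ([x] @ k) = bracket x (nested_bracket bracket k)"
    if "k \<in> Poly_Mapping.keys P" for k
    using that assms by (cases k) auto
  then have "dynkin (letter x * P) = lin_ext smul (\<lambda>k. bracket x (nested_bracket bracket k)) P"
    unfolding dynkin_def lin_ext_monomial_mult by (rule lin_ext_cong)
  also have "\<dots> = bracket x (dynkin P)"
    unfolding dynkin_def
    by (subst lin_ext_fun_comp[where h = "bracket x"]) (simp_all add: bracket_add_right bracket_scale_right)
  finally show ?thesis .
qed

lemma bracket_foldr_mult_letter:
  "bracket_foldr (P * letter x) y = bracket_foldr P (bracket x y)"
  by (simp add: bracket_foldr_def lin_ext_mult_monomial)

lemma bracket_foldr_letter_mult:
  "bracket_foldr (letter x * P) y = bracket x (bracket_foldr P y)"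
  by (subst bracket_foldr_def, subst lin_ext_monomial_mult, unfold bracket_foldr_def,
      subst lin_ext_fun_comp[where h = "bracket x"])
    (simp_all add: bracket_add_right bracket_scale_right)

lemma bracket_foldr_diff: "bracket_foldr (P - Q) y = bracket_foldr P y - bracket_foldr Q y"
  by (simp add: bracket_foldr_def lin_ext_diff)

text \<open>The Dynkin--Specht--Wever theorem for left-normed commutators.\<close>

lemma dynkin_left_comm:
  "dynkin (left_comm a w) = smul (of_nat (Suc (length w))) (foldl bracket a w)"
  and bracket_foldr_left_comm: "bracket_foldr (left_comm a w) y = bracket (foldl bracket a w) y"
proof (induction w arbitrary: y rule: rev_induct)
  case Nil
  {
    case 1
    show ?case by (simp add: dynkin_def left_comm_def)
  next
    case 2
    show ?case by (simp add: bracket_foldr_def left_comm_def)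
  }
next
  case (snoc x w)
  have step: "left_comm a (w @ [x]) = left_comm a w * letter x - letter x * left_comm a w"
    by (simp add: left_comm_def)
  have "[] \<notin> Poly_Mapping.keys (left_comm a w :: 'g list \<Rightarrow>\<^sub>0 'k)"
  proof (induction w rule: rev_induct)
    case Nil
    show ?case by (simp add: left_comm_def monomial_def)
  next
    case (snoc x w)
    let ?P = "left_comm a w :: 'g list \<Rightarrow>\<^sub>0 'k"
    have "left_comm a (w @ [x]) = ?P * letter x - letter x * ?P"
      by (simp add: left_comm_def)
    moreover have "[] \<notin> Poly_Mapping.keys (?P * letter x)" "[] \<notin> Poly_Mapping.keys (letter x * ?P)"
      using snoc by (auto elim!: keys_multE)
    ultimately show ?case
      using keys_diff[of "?P * letter x" "letter x * ?P"] by auto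
  qed
  note nonempty = this
  {
    case 1
    \<comment> \<open>The first term is one copy of the longer bracket; the second gives
      \<open>Suc (length w)\<close> further copies after a change of sign.\<close>
    have "dynkin (left_comm a (w @ [x])) = bracket_foldr (left_comm a w) x - bracket x (dynkin (left_comm a w))"
      using nonempty by (simp add: step dynkin_diff dynkin_mult_letter dynkin_letter_mult)
    also have "\<dots> = smul (of_nat (Suc (length (w @ [x])))) (foldl bracket a (w @ [x]))"
      using bracket_swap[of x "foldl bracket a w"] scale_left_distrib[of 1 1 "bracket (foldl bracket a w) x"]
      by (simp add: snoc.IH bracket_scale_right scale_left_distrib del: of_nat_Suc)
        (simp add: scale_left_distrib)
    finally show ?case .
  next
    case 2
    show ?case
      by (simp add: step bracket_foldr_diff bracket_foldr_mult_letter bracket_foldr_letter_mult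
          snoc.IH bracket_bracket)
  }
qed

lemma dynkin_left_comm_ext:
  assumes "\<And>w. w \<in> Poly_Mapping.keys P \<Longrightarrow> length w = n"
  shows "dynkin (left_comm_ext a P) = smul (of_nat (Suc n)) (bracket_foldl a P)"
proof -
  have "dynkin (left_comm_ext a P) = lin_ext smul (\<lambda>w. dynkin (left_comm a w)) P"
    by (induction P rule: single_induct)
      (simp_all add: left_comm_ext_def free_space.lin_ext_add lin_ext_add dynkin_def lin_ext_scalar)
  also have "\<dots> = lin_ext smul (\<lambda>w. smul (of_nat (Suc n)) (foldl bracket a w)) P"
    by (rule lin_ext_cong) (simp only: dynkin_left_comm assms)
  also have "\<dots> = smul (of_nat (Suc n)) (bracket_foldl a P)"
    unfolding bracket_foldl_def
    by (subst lin_ext_fun_comp[where h = "smul (of_nat (Suc n))"])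
      (simp_all add: scale_right_distrib mult.commute)
  finally show ?thesis .
qed

text \<open>Any letter can serve as base: the gap takes its place, and the factor from the
  Dynkin-Specht-Wever theorem cancels the division by the length. The bound \<open>N\<close> is left
  free so that words of different lengths can share a truncation.\<close>

lemma eulerian_word_base:
  assumes "length u + length v < N"
  shows "eulerian_word (rev u @ a # v) = bracket_foldl a (ev (log_derivative N) u v)"
proof -
  let ?w = "rev u @ a # v" and ?n = "length u + length v"
  have "ev (word_log (length ?w)) [] ?w = (ev (word_log N) [] ?w :: 'g list \<Rightarrow>\<^sub>0 'k)"
    using assms by (intro word_log_mono[symmetric]) simp_all
  also have "\<dots> = ev (dleft a (word_log N)) u v"
    by (metis ev_word_log ev_dright dright_word_log)
  also have "\<dots> = left_comm_ext a (ev (log_derivative N) u v)"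
    by (rule dleft_word_log_eq[OF assms])
  also have "dynkin \<dots> = smul (of_nat (Suc ?n)) (bracket_foldl a (ev (log_derivative N) u v))"
    by (rule dynkin_left_comm_ext) (rule length_log_derivative)
  finally have "dynkin (ev (word_log (length ?w)) [] ?w) =
      smul (of_nat (Suc ?n)) (bracket_foldl a (ev (log_derivative N) u v))"
    .
  then show ?thesis
    by (simp add: eulerian_word_def del: of_nat_Suc)
qed

lemma eulerian_monomial [simp]: "eulerian (monomial w) = eulerian_word w"
  by (simp add: eulerian_def)

lemma eulerian_add: "eulerian (P + Q) = eulerian P + eulerian Q"
  by (simp add: eulerian_def lin_ext_add)

lemma eulerian_diff: "eulerian (P - Q) = eulerian P - eulerian Q"
  by (simp add: eulerian_def lin_ext_diff)

lemma eulerian_0 [simp]: "eulerian 0 = 0"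
  by (simp add: eulerian_def)

lemma eulerian_sum: "eulerian (\<Sum>i\<in>A. P i) = (\<Sum>i\<in>A. eulerian (P i))"
  by (simp add: eulerian_def lin_ext_sum)

lemma eulerian_scalar: "eulerian (scalar c * P) = smul c (eulerian P)"
  by (simp add: eulerian_def lin_ext_scalar)

lemma eulerian_word_Nil [simp]: "eulerian_word [] = 0"
  by (simp add: eulerian_word_def)

lemma eulerian_word_letter [simp]: "eulerian_word [x] = x"
proof -
  have "ev (log_derivative 1) [] [] = (1 :: 'g list \<Rightarrow>\<^sub>0 'k)"
    by (simp add: log_derivative_def ev_word_right ev_1)
  then show ?thesis
    using eulerian_word_base[of "[]" "[]" 1 x] lin_ext_monomial[of "foldl bracket x" "[]"]
    by (simp add: bracket_foldl_def)
qed

text \<open>With the varied letter as base, it occurs in the first slot of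
  \<open>bracket_foldl\<close> alone.\<close>

lemma eulerian_word_add:
  "eulerian_word (p @ (x + y) # q) = eulerian_word (p @ x # q) + eulerian_word (p @ y # q)"
  using eulerian_word_base[of "rev p" q "Suc (length p + length q)"]
  by (simp add: bracket_foldl_add)

lemma eulerian_word_smul:
  "eulerian_word (p @ smul c x # q) = smul c (eulerian_word (p @ x # q))"
  using eulerian_word_base[of "rev p" q "Suc (length p + length q)"]
  by (simp add: bracket_foldl_smul)

lemma eulerian_word_commutator:
  "eulerian_word (p @ x # y # q) - eulerian_word (p @ y # x # q) = eulerian_word (p @ bracket x y # q)"
proof -
  let ?N = "Suc (Suc (length p + length q))"
  let ?E = "ev (log_derivative ?N) :: 'g list \<Rightarrow> 'g list \<Rightarrow> 'g list \<Rightarrow>\<^sub>0 'k"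
  \<comment> \<open>Base \<open>x\<close> in both longer words: they differ in the side of the gap
    on which \<open>y\<close> lies.\<close>
  have "eulerian_word (p @ x # y # q) = bracket_foldl x (?E (rev p) (y # q))"
    "eulerian_word (p @ y # x # q) = bracket_foldl x (?E (y # rev p) q)"
    "eulerian_word (p @ bracket x y # q) = bracket_foldl (bracket x y) (?E (rev p) q)"
    using eulerian_word_base[of "rev p" "y # q" ?N x] eulerian_word_base[of "y # rev p" q ?N x]
      eulerian_word_base[of "rev p" q ?N "bracket x y"] by simp_all
  \<comment> \<open>The leading \<open>letter y\<close> is then absorbed by the base, which turns
    \<open>x\<close> into \<open>bracket x y\<close>.\<close>
  moreover have "?E (rev p) (y # q) - ?E (y # rev p) q = letter y * ?E (rev p) q"
    by (rule log_derivative_shift)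
  ultimately show ?thesis
    by (metis bracket_foldl_letter_mult bracket_foldl_def lin_ext_diff)
qed

end

subsection \<open>Symmetric tensors\<close>

text \<open>Substitution of letters; it reduces words with possibly equal letters to the word of
  their positions.\<close>

definition map_letters :: "('a \<Rightarrow> 'b) \<Rightarrow> ('a list \<Rightarrow>\<^sub>0 'k::field) \<Rightarrow> ('b list \<Rightarrow>\<^sub>0 'k)"
  where "map_letters h = lin_ext (\<lambda>c P. scalar c * P) (\<lambda>xs. monomial (map h xs))"

lemma map_letters_single [simp]:
  "map_letters h (Poly_Mapping.single xs c) = Poly_Mapping.single (map h xs) c"
  by (simp add: map_letters_def scalar_mult_monomial)

lemma map_letters_0 [simp]: "map_letters h 0 = 0"
  by (simp add: map_letters_def)

lemma map_letters_1 [simp]: "map_letters h 1 = 1"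
  by (metis list.simps(8) map_letters_single monomial_Nil monomial_def)

lemma map_letters_add: "map_letters h (P + Q) = map_letters h P + map_letters h Q"
  by (simp add: map_letters_def free_space.lin_ext_add)

lemma map_letters_diff: "map_letters h (P - Q) = map_letters h P - map_letters h Q"
  by (simp add: map_letters_def free_space.lin_ext_diff)

lemma map_letters_sum: "map_letters h (\<Sum>i\<in>A. P i) = (\<Sum>i\<in>A. map_letters h (P i))"
  by (simp add: map_letters_def free_space.lin_ext_sum)

lemma map_letters_scalar: "map_letters h (scalar c * P) = scalar c * map_letters h P"
  by (simp add: map_letters_def free_space.lin_ext_scalar)

lemma map_letters_mult: "map_letters h (P * Q) = map_letters h P * map_letters h Q"
proof (induction P rule: single_induct)
  case (single xs c)
  show ?case
    by (induction Q rule: single_induct)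
      (simp_all add: map_letters_add distrib_left mult_single plus_list_def)
qed (simp add: map_letters_add distrib_right)

section \<open>Naturality of the logarithm under substitution\<close>

definition natural_along :: "('a \<Rightarrow> 'b) \<Rightarrow> ('a, 'a list \<Rightarrow>\<^sub>0 'k::field) word_fun
    \<Rightarrow> ('b, 'b list \<Rightarrow>\<^sub>0 'k) word_fun \<Rightarrow> bool"
  where "natural_along h f g \<longleftrightarrow> (\<forall>u v. ev g (map h u) (map h v) = map_letters h (ev f u v))"

lemma natural_along_mult:
  assumes "natural_along h f g" "natural_along h f' g'"
  shows "natural_along h (f * f') (g * g')"
proof -
  have left: "natural_along h (dleft x f) (dleft (h x) g)"
    and right: "natural_along h (dright x f) (dright (h x) g)" if "natural_along h f g" for f g x
    using that by (auto simp: natural_along_def ev_dleft ev_dright simp flip: list.simps(9))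
  have "ev (g * g') (map h u) (map h v) = map_letters h (ev (f * f') u v)" for u v
    using assms
  proof (induction u arbitrary: f g f' g')
    case Nil
    then show ?case
    proof (induction v arbitrary: f g f' g')
      case Nil
      then have "ev g [] [] = map_letters h (ev f [] [])" "ev g' [] [] = map_letters h (ev f' [] [])"
        unfolding natural_along_def by (metis list.simps(8))+
      then show ?case by (simp add: map_letters_mult)
    next
      case (Cons x v)
      show ?case
        using Cons.IH[OF right[OF Cons.prems(1), of x] Cons.prems(2)]
          Cons.IH[OF Cons.prems(1) right[OF Cons.prems(2), of x]]
        by (simp add: dright.mult map_letters_add flip: ev_dright)
    qed
  next
    case (Cons x u)
    show ?case
      using Cons.IH[OF left[OF Cons.prems(1), of x] Cons.prems(2)]
        Cons.IH[OF Cons.prems(1) left[OF Cons.prems(2), of x]]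
      by (simp add: dleft.mult map_letters_add flip: ev_dleft)
  qed
  then show ?thesis by (simp add: natural_along_def)
qed

lemma natural_along_1: "natural_along h 1 1"
  by (simp add: natural_along_def ev_1)

lemma natural_along_diff:
  "natural_along h f g \<Longrightarrow> natural_along h f' g' \<Longrightarrow> natural_along h (f - f') (g - g')"
  by (simp add: natural_along_def map_letters_diff)

lemma natural_along_sum:
  "(\<And>i. i \<in> A \<Longrightarrow> natural_along h (f i) (g i)) \<Longrightarrow> natural_along h (\<Sum>i\<in>A. f i) (\<Sum>i\<in>A. g i)"
  by (simp add: natural_along_def map_letters_sum)

lemma natural_along_scale:
  "natural_along h f g \<Longrightarrow> natural_along h (scale_wf c f) (scale_wf c g)"
  by (simp add: natural_along_def map_letters_scalar)

lemma natural_along_word_aug_power: "natural_along h (word_aug ^ n) (word_aug ^ n)"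
proof -
  have "natural_along h word_left word_left" "natural_along h word_right word_right"
    by (simp_all add: natural_along_def ev_word_left ev_word_right monomial_def rev_map)
  then have aug: "natural_along h word_aug word_aug"
    unfolding word_aug_def word_id_def by (intro natural_along_diff natural_along_mult natural_along_1)
  show ?thesis
    by (induction n) (simp_all add: natural_along_mult[OF aug] natural_along_1)
qed

lemma natural_along_word_log: "natural_along h (word_log N) (word_log N)"
  unfolding word_log_def
  by (intro natural_along_sum natural_along_scale natural_along_word_aug_power)

section \<open>Symmetrization of words\<close>

definition symmetrize_word :: "'a list \<Rightarrow> ('a list \<Rightarrow>\<^sub>0 'k::field_char_0)"
  where "symmetrize_word xs =
    (\<Sum>\<sigma> | \<sigma> permutes {..<length xs}. scalar (1 / fact (length xs)) * monomial (permute_list \<sigma> xs))"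

lemma scalar_mult_single:
  "scalar c * Poly_Mapping.single xs d = Poly_Mapping.single xs (c * d)"
  by (simp add: scalar_def mult_single plus_list_def)

lemma symmetrize_eq_lin_ext: "symmetrize = lin_ext (\<lambda>c P. scalar c * P) symmetrize_word"
  by (rule ext)
    (simp add: symmetrize_def lin_ext_def symmetrize_word_def sum_distrib_left
      scalar_mult_monomial scalar_mult_single)

lemma symmetrize_monomial: "symmetrize (monomial xs) = symmetrize_word xs"
  by (simp add: symmetrize_eq_lin_ext)

lemma symmetrize_single:
  "symmetrize (Poly_Mapping.single xs c) = scalar c * symmetrize_word xs"
  by (simp add: symmetrize_eq_lin_ext)

lemma symmetrize_add: "symmetrize (P + Q) = symmetrize P + symmetrize Q"
  by (simp add: symmetrize_eq_lin_ext free_space.lin_ext_add)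

lemma symmetrize_diff: "symmetrize (P - Q) = symmetrize P - symmetrize Q"
  by (simp add: symmetrize_eq_lin_ext free_space.lin_ext_diff)

lemma symmetrize_sum: "symmetrize (\<Sum>i\<in>A. P i) = (\<Sum>i\<in>A. symmetrize (P i))"
  by (simp add: symmetrize_eq_lin_ext free_space.lin_ext_sum)

lemma symmetrize_scalar: "symmetrize (scalar c * P) = scalar c * symmetrize P"
  by (simp add: symmetrize_eq_lin_ext free_space.lin_ext_scalar)

context lie_algebra_char_0 begin

lemma dynkin_sum: "dynkin (\<Sum>i\<in>A. P i) = (\<Sum>i\<in>A. dynkin (P i))"
  by (simp add: dynkin_def lin_ext_sum)

lemma dynkin_scalar: "dynkin (scalar c * P) = smul c (dynkin P)"
  by (simp add: dynkin_def lin_ext_scalar)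

lemma dynkin_map_letters:
  "dynkin (map_letters h P) = lin_ext smul (\<lambda>w. nested_bracket bracket (map h w)) P"
  by (induction P rule: single_induct) (simp_all add: map_letters_add lin_ext_add dynkin_def)

text \<open>Exchanging the last two letters of \<open>w\<close> changes the sign of the nested bracket.\<close>

lemma sum_permutes_nested_bracket:
  assumes "2 \<le> n" "mset w = mset [0..<n]"
  shows "(\<Sum>\<sigma> | \<sigma> permutes {..<n}. nested_bracket bracket (map (\<lambda>i. xs ! \<sigma> i) w)) = 0"
proof -
  have "length w = n"
    using assms(2) by (metis diff_zero length_upt size_mset)
  then have "length (drop (n - 2) w) = Suc (Suc 0)"
    using assms(1) by simp
  then obtain a b where "drop (n - 2) w = [a, b]"
    by (auto simp: length_Suc_conv simp del: length_drop)
  then obtain w' where w: "w = w' @ [a, b]"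
    by (metis append_take_drop_id)
  have dist: "distinct w" and set: "set w = {..<n}"
    using assms(2) by (metis distinct_upt mset_eq_imp_distinct_iff)
      (metis assms(2) atLeast_upt mset_eq_setD)
  let ?f = "\<lambda>\<sigma>. nested_bracket bracket (map (\<lambda>i. xs ! \<sigma> i) w)"
  have nested: "?f \<sigma> = foldr bracket (map (\<lambda>i. xs ! \<sigma> i) w') (bracket (xs ! \<sigma> a) (xs ! \<sigma> b))" for \<sigma>
    using nested_bracket_append[of "map (\<lambda>i. xs ! \<sigma> i) (w' @ [a])" "xs ! \<sigma> b"] by (simp add: w)
  have foldr_minus: "foldr bracket ys (- z) = - foldr bracket ys z" for ys z
    by (induction ys) (simp_all add: bracket_minus_right)
  let ?t = "Transposition.transpose a b"
  have "?f (\<sigma> \<circ> ?t) = - ?f \<sigma>" for \<sigma>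
  proof -
    have map: "map (\<lambda>i. xs ! (\<sigma> \<circ> ?t) i) w' = map (\<lambda>i. xs ! \<sigma> i) w'"
    proof (rule map_cong)
      fix i assume "i \<in> set w'"
      then have "i \<noteq> a" "i \<noteq> b" using dist by (auto simp: w)
      then show "xs ! (\<sigma> \<circ> ?t) i = xs ! \<sigma> i" by simp
    qed simp
    show ?thesis
      unfolding nested map
      using bracket_swap[of "xs ! \<sigma> b" "xs ! \<sigma> a"] by (simp add: foldr_minus)
  qed
  moreover have "?t permutes {..<n}"
    using set by (intro permutes_swap_id) (auto simp: w)
  ultimately have "sum ?f {\<sigma>. \<sigma> permutes {..<n}} = - sum ?f {\<sigma>. \<sigma> permutes {..<n}}" (is "?S = _")
    using sum_permutations_compose_right[of ?t "{..<n}" ?f] by (simp add: sum_negf)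
  then have "?S + ?S = 0"
    by (simp only: eq_neg_iff_add_eq_0)
  then have "smul 2 ?S = 0"
    using scale_left_distrib[of 1 1 ?S] by simp
  then show ?thesis by simp
qed

text \<open>By naturality the logarithms of all rearrangements come from one polynomial in the
  positions. Each of its words uses every position once, so its nested brackets cancel in the sum
  over permutations.\<close>

lemma sum_permutes_eulerian_word:
  assumes "2 \<le> length xs"
  shows "(\<Sum>\<sigma> | \<sigma> permutes {..<length xs}. eulerian_word (permute_list \<sigma> xs)) = 0"
proof -
  let ?n = "length xs"
  define E :: "nat list \<Rightarrow>\<^sub>0 'k" where "E = ev (word_log ?n) [] [0..<?n]"
  have content: "mset w = mset [0..<?n]" if "w \<in> Poly_Mapping.keys E" for w
  proof -
    have "has_content {#} (word_log ?n :: (nat, nat list \<Rightarrow>\<^sub>0 'k) word_fun)"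
      unfolding word_log_def by (intro has_content_sum has_content_scale has_content_word_aug_power)
    with that show ?thesis
      by (auto simp: has_content_def E_def)
  qed
  have word: "eulerian_word (permute_list \<sigma> xs) =
      smul (1 / of_nat ?n) (lin_ext smul (\<lambda>w. nested_bracket bracket (map (\<lambda>i. xs ! \<sigma> i) w)) E)"
    if "\<sigma> permutes {..<?n}" for \<sigma>
  proof -
    have eq: "permute_list \<sigma> xs = map (\<lambda>i. xs ! \<sigma> i) [0..<?n]"
      using that by (intro nth_equalityI) (simp_all add: permute_list_nth)
    have "ev (word_log ?n) (map h []) (map h [0..<?n]) = map_letters h E" for h :: "nat \<Rightarrow> 'g"
      using natural_along_word_log[of h ?n] unfolding natural_along_def E_def by blast
    then show ?thesis
      unfolding eq by (simp add: eulerian_word_def dynkin_map_letters)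
  qed
  have "(\<Sum>\<sigma> | \<sigma> permutes {..<?n}. eulerian_word (permute_list \<sigma> xs)) =
      (\<Sum>\<sigma> | \<sigma> permutes {..<?n}. smul (1 / of_nat ?n)
        (\<Sum>w\<in>Poly_Mapping.keys E. smul (Poly_Mapping.lookup E w) (nested_bracket bracket (map (\<lambda>i. xs ! \<sigma> i) w))))"
    by (rule sum.cong) (simp_all add: word lin_ext_def)
  also have "\<dots> = smul (1 / of_nat ?n) (\<Sum>w\<in>Poly_Mapping.keys E. smul (Poly_Mapping.lookup E w)
      (\<Sum>\<sigma> | \<sigma> permutes {..<?n}. nested_bracket bracket (map (\<lambda>i. xs ! \<sigma> i) w)))"
    unfolding scale_sum_right by (rule sum.swap)
  also have "\<dots> = 0"
    using sum_permutes_nested_bracket[OF assms content] by simp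
  finally show ?thesis .
qed

definition linear_part :: "('g list \<Rightarrow>\<^sub>0 'k) \<Rightarrow> 'g"
  where "linear_part = lin_ext smul (\<lambda>w. if length w = 1 then hd w else 0)"

lemma eulerian_symmetrize_word:
  "eulerian (symmetrize_word xs) = (if length xs = 1 then hd xs else 0)"
proof -
  have eq: "eulerian (symmetrize_word xs) = smul (1 / fact (length xs))
      (\<Sum>\<sigma> | \<sigma> permutes {..<length xs}. eulerian_word (permute_list \<sigma> xs))"
    by (simp add: symmetrize_word_def eulerian_sum eulerian_scalar scale_sum_right)
  consider "xs = []" | x where "xs = [x]" | "2 \<le> length xs"
    by (cases xs; cases "tl xs") auto
  then show ?thesis
  proof cases
    case 1
    show ?thesis by (simp add: 1 eq[unfolded 1])
  next
    case 2
    have "{\<sigma>. \<sigma> permutes {..<Suc 0}} = {id}"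
      by (auto simp: lessThan_Suc permutes_sing)
    then show ?thesis
      by (simp add: 2 eq[unfolded 2])
  qed (auto simp: eq sum_permutes_eulerian_word)
qed

lemma eulerian_symmetrize: "eulerian (symmetrize P) = linear_part P"
  by (induction P rule: single_induct)
    (simp_all add: linear_part_def lin_ext_add eulerian_add symmetrize_add symmetrize_single
      eulerian_scalar eulerian_symmetrize_word)

end

section \<open>The Baker-Campbell-Hausdorff series\<close>

text \<open>For the derivation \<open>dleft \<xi> + dright \<eta>\<close>, the Taylor coefficients at the empty word turn convolution
  into multiplication of power series, and the identity into \<open>exp (t \<xi>) exp (t \<eta>)\<close>.\<close>

definition bch_deriv :: "'a \<Rightarrow> 'a \<Rightarrow> ('a, 'r::ring_1) word_fun \<Rightarrow> ('a, 'r) word_fun"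
  where "bch_deriv x y f = dleft x f + dright y f"

interpretation bch_deriv: derivation "bch_deriv x y :: ('a, 'r::ring_1) word_fun \<Rightarrow> _"
  by unfold_locales
    (simp_all add: bch_deriv_def dleft.add dright.add dleft.mult dright.mult algebra_simps)

definition taylor :: "'a \<Rightarrow> 'a \<Rightarrow> ('a, 'a list \<Rightarrow>\<^sub>0 'k::field_char_0) word_fun \<Rightarrow> ('a list \<Rightarrow>\<^sub>0 'k) fps"
  where "taylor x y f = Abs_fps (\<lambda>n. scalar (1 / fact n) * ev ((bch_deriv x y ^^ n) f) [] [])"

lemma bch_deriv_power_zero: "(bch_deriv x y ^^ n) 0 = 0"
  by (induction n) simp_all

lemma bch_deriv_power_add:
  "(bch_deriv x y ^^ n) (f + g) = (bch_deriv x y ^^ n) f + (bch_deriv x y ^^ n) g"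
  by (induction n) (simp_all add: bch_deriv.add)

lemma bch_deriv_power_diff:
  "(bch_deriv x y ^^ n) (f - g) = (bch_deriv x y ^^ n) f - (bch_deriv x y ^^ n) g"
  by (induction n) (simp_all add: bch_deriv.diff)

lemma bch_deriv_power_scale:
  "(bch_deriv x y ^^ n) (scale_wf c f) = scale_wf c ((bch_deriv x y ^^ n) f)"
  by (induction n)
    (simp_all add: bch_deriv_def dleft_scale_wf dright_scale_wf word_space.scale_right_distrib)

lemma taylor_add: "taylor x y (f + g) = taylor x y f + taylor x y g"
  by (rule fps_ext) (simp add: taylor_def bch_deriv_power_add distrib_left)

lemma taylor_diff: "taylor x y (f - g) = taylor x y f - taylor x y g"
  by (rule fps_ext) (simp add: taylor_def bch_deriv_power_diff right_diff_distrib)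

lemma taylor_scale_nth:
  "fps_nth (taylor x y (scale_wf c f)) n = scalar c * fps_nth (taylor x y f) n"
  by (simp add: taylor_def bch_deriv_power_scale scalar_mult mult.commute flip: mult.assoc)

lemma taylor_0: "taylor x y 0 = 0"
  using taylor_add[of x y 0 0] by simp

lemma taylor_sum: "taylor x y (\<Sum>i\<in>A. f i) = (\<Sum>i\<in>A. taylor x y (f i))"
  by (induction A rule: infinite_finite_induct) (simp_all add: taylor_add taylor_0)

lemma of_nat_eq_scalar: "of_nat n = (scalar (of_nat n) :: 'a list \<Rightarrow>\<^sub>0 'k::field)"
  by (induction n) (simp_all add: scalar_add)

lemma fps_deriv_taylor: "fps_deriv (taylor x y f) = taylor x y (bch_deriv x y f)"
proof (rule fps_ext)
  fix n
  have "of_nat (Suc n) * scalar (1 / fact (Suc n)) = (scalar (1 / fact n) :: 'a list \<Rightarrow>\<^sub>0 'b)"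
    unfolding of_nat_eq_scalar scalar_mult by (simp add: fact_Suc del: of_nat_Suc)
  then show "fps_nth (fps_deriv (taylor x y f)) n = fps_nth (taylor x y (bch_deriv x y f)) n"
    by (simp add: taylor_def funpow_swap1 del: of_nat_Suc flip: mult.assoc)
qed

text \<open>The constant coefficients agree, and by the Leibniz rule so do the derivatives up to the
  degree covered by induction; a division by n + 1 remains.\<close>

lemma taylor_mult: "taylor x y (f * g) = taylor x y f * taylor x y g"
proof (rule fps_ext)
  fix n
  show "fps_nth (taylor x y (f * g)) n = fps_nth (taylor x y f * taylor x y g) n"
  proof (induction n arbitrary: f g)
    case 0
    show ?case by (simp add: taylor_def)
  next
    case (Suc n)
    have cancel: "P = Q" if "of_nat (Suc n) * P = of_nat (Suc n) * Q" for P Q :: "'a list \<Rightarrow>\<^sub>0 'b"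
    proof -
      have "scalar (1 / of_nat (Suc n)) * (of_nat (Suc n) * R) = R" for R :: "'a list \<Rightarrow>\<^sub>0 'b"
        unfolding of_nat_eq_scalar by (simp add: scalar_mult del: of_nat_Suc flip: mult.assoc)
      with that show ?thesis by metis
    qed
    have deriv: "fps_nth (fps_deriv (taylor x y (f * g))) n =
        fps_nth (fps_deriv (taylor x y f * taylor x y g)) n"
      by (simp add: fps_deriv_taylor bch_deriv.mult taylor_add Suc add.commute del: fps_deriv_nth)
    show ?case
      by (rule cancel) (use deriv in \<open>simp only: fps_deriv_nth Suc_eq_plus1\<close>)
  qed
qed

text \<open>The derivation acts on \<open>word_left\<close> by appending \<open>x\<close> and on
  \<open>word_right\<close> by prepending \<open>y\<close>, so each factor has an exponential
  series.\<close>

lemma taylor_word_id: "taylor x y word_id = exp_series x * exp_series y"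
proof -
  have left: "(bch_deriv x y ^^ n) word_left = word_left * const (monomial (replicate n x))" for n
    by (induction n)
      (simp_all add: bch_deriv.mult, simp add: bch_deriv_def dleft_word_left dright_word_left mult.assoc
        const_mult monomial_mult)
  have right: "(bch_deriv x y ^^ n) word_right = const (monomial (replicate n y)) * word_right" for n
    by (induction n)
      (simp_all add: bch_deriv.mult, simp add: bch_deriv_def dleft_word_right dright_word_right
        const_mult monomial_mult replicate_append_same flip: mult.assoc)
  show ?thesis
    unfolding word_id_def taylor_mult
    by (simp add: taylor_def exp_series_def left right ev_word_left ev_word_right ev_const)
qed

lemma taylor_word_aug_power:
  "taylor x y (word_aug ^ n) = (exp_series x * exp_series y - 1) ^ n"
proof -
  have one: "taylor x y 1 = 1"
  proof (rule fps_ext)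
    fix n
    show "fps_nth (taylor x y 1) n = fps_nth 1 n"
      by (cases n) (simp_all add: taylor_def ev_1 funpow_Suc_right bch_deriv_power_zero del: funpow.simps(2))
  qed
  show ?thesis
    by (induction n) (simp_all add: one taylor_mult word_aug_def taylor_diff taylor_word_id)
qed

lemma bch_polynomial_eq: "bch_polynomial n x y = fps_nth (taylor x y (word_log n)) n"
proof -
  have "bch_polynomial n x y = (\<Sum>k<n. scalar ((- 1) ^ k / of_nat (Suc k)) *
      fps_nth ((exp_series x * exp_series y - 1) ^ Suc k) n)"
    unfolding bch_polynomial_def
    by (simp add: sum.atLeast1_atMost_eq del: power_Suc of_nat_Suc, simp)
  also have "\<dots> = fps_nth (taylor x y (word_log n)) n"
    unfolding word_log_def taylor_sum fps_sum_nth taylor_scale_nth taylor_word_aug_power ..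
  finally show ?thesis .
qed

text \<open>The binomial theorem for the insertions of \<open>x\<close> on the left and of
  \<open>y\<close> on the right.\<close>

lemma ev_bch_deriv_power:
  "ev ((bch_deriv x y ^^ n) f) [] [] =
    (\<Sum>i\<le>n. scalar (of_nat (n choose i)) * ev f (replicate i x) (replicate (n - i) y))"
proof (induction n arbitrary: f)
  case (Suc n)
  have "ev ((bch_deriv x y ^^ Suc n) f) [] [] = (\<Sum>i\<le>n. scalar (of_nat (n choose i)) *
      (ev f (replicate (Suc i) x) (replicate (n - i) y) + ev f (replicate i x) (replicate (Suc n - i) y)))"
    by (simp add: funpow_Suc_right Suc bch_deriv_def ev_dleft ev_dright Suc_diff_le del: funpow.simps)
  also have "\<dots> = (\<Sum>i\<le>Suc n. scalar (of_nat (Suc n choose i)) * ev f (replicate i x) (replicate (Suc n - i) y))"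
    by (rule free_space.sum_pascal[of n "\<lambda>i j. ev f (replicate i x) (replicate j y)"])
  finally show ?case .
qed simp

context lie_algebra_char_0 begin

text \<open>The Taylor coefficient puts \<open>i\<close> letters \<open>x\<close> left of the gap
  and \<open>n - i\<close> letters \<open>y\<close> right of it. As the logarithm does not see the
  gap, the part of each bidegree is a value at a sorted word.\<close>

lemma BCH_eq_sum_eulerian_word:
  assumes "0 < n"
  shows "BCH smul bracket n x y =
    (\<Sum>i\<le>n. smul (1 / (fact i * fact (n - i))) (eulerian_word (replicate i x @ replicate (n - i) y)))"
proof -
  have "BCH smul bracket n x y = smul (1 / of_nat n) (dynkin (bch_polynomial n x y))"
    by (simp add: BCH_def Let_def dynkin_def lin_ext_def scale_sum_right divide_inverse mult.commute)
  also have "\<dots> = smul (1 / of_nat n) (dynkin (scalar (1 / fact n) *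
      (\<Sum>i\<le>n. scalar (of_nat (n choose i)) * ev (word_log n) (replicate i x) (replicate (n - i) y))))"
    by (simp add: bch_polynomial_eq taylor_def ev_bch_deriv_power)
  also have "\<dots> = (\<Sum>i\<le>n. smul (1 / fact n * of_nat (n choose i))
      (smul (1 / of_nat n) (dynkin (ev (word_log n) (replicate i x) (replicate (n - i) y)))))"
    by (simp add: dynkin_scalar dynkin_sum scale_sum_right mult_ac)
  also have "\<dots> = (\<Sum>i\<le>n. smul (1 / (fact i * fact (n - i)))
      (eulerian_word (replicate i x @ replicate (n - i) y)))"
  proof (rule sum.cong)
    fix i assume "i \<in> {..n}"
    then have "i \<le> n" by simp
    then have "1 / fact n * of_nat (n choose i) = (1 / (fact i * fact (n - i)) :: 'k)"
      by (simp add: binomial_fact)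
    moreover have "ev (word_log n) (replicate i x) (replicate (n - i) y) =
        (ev (word_log n) [] (replicate i x @ replicate (n - i) y) :: 'g list \<Rightarrow>\<^sub>0 'k)"
      by (subst ev_word_log) simp
    ultimately show "smul (1 / fact n * of_nat (n choose i))
        (smul (1 / of_nat n) (dynkin (ev (word_log n) (replicate i x) (replicate (n - i) y)))) =
      smul (1 / (fact i * fact (n - i))) (eulerian_word (replicate i x @ replicate (n - i) y))"
      using \<open>i \<le> n\<close> by (simp add: eulerian_word_def)
  qed simp
  finally show ?thesis .
qed

end

section \<open>The quotient algebras\<close>

lemma free_algebra_sel [simp]:
  "carrier (free_algebra :: ('g list \<Rightarrow>\<^sub>0 'k::field) ring) = UNIV"
  "f \<otimes>\<^bsub>free_algebra\<^esub> g = f * g"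
  "f \<oplus>\<^bsub>free_algebra\<^esub> g = f + g"
  "\<zero>\<^bsub>free_algebra\<^esub> = (0 :: 'g list \<Rightarrow>\<^sub>0 'k)"
  "\<one>\<^bsub>free_algebra\<^esub> = (1 :: 'g list \<Rightarrow>\<^sub>0 'k)"
  by (simp_all add: ring_of_type_algebra_def)

interpretation free_ring: ring "free_algebra :: ('g list \<Rightarrow>\<^sub>0 'k::field) ring"
proof -
  have "\<exists>g. f + g = 0" for f :: "'g list \<Rightarrow>\<^sub>0 'k"
    using add.right_inverse by blast
  then show "ring (free_algebra :: ('g list \<Rightarrow>\<^sub>0 'k) ring)"
    unfolding ring_of_type_algebra_def by unfold_locales (auto simp: algebra_simps Units_def)
qed

lemma free_ring_minus: "\<ominus>\<^bsub>free_algebra\<^esub> f = - (f :: 'g list \<Rightarrow>\<^sub>0 'k::field)"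
  by (rule free_ring.minus_equality) simp_all

lemma ideal_genideal:
  "ideal (genideal free_algebra S) (free_algebra :: ('g list \<Rightarrow>\<^sub>0 'k::field) ring)"
  by (rule free_ring.genideal_ideal) simp

lemma genideal_mem: "f \<in> S \<Longrightarrow> f \<in> genideal (free_algebra :: ('g list \<Rightarrow>\<^sub>0 'k::field) ring) S"
  using free_ring.genideal_self[of S] by auto

context
  fixes I :: "('g list \<Rightarrow>\<^sub>0 'k::field) set"
  assumes I: "ideal I free_algebra"
begin

interpretation ideal I free_algebra by (fact I)

lemma ideal_0: "0 \<in> I"
  using additive_subgroup.zero_closed[OF is_additive_subgroup] by simp

lemma ideal_add: "f \<in> I \<Longrightarrow> g \<in> I \<Longrightarrow> f + g \<in> I"
  using additive_subgroup.a_closed[OF is_additive_subgroup] by simp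

lemma ideal_mult_left: "f \<in> I \<Longrightarrow> g * f \<in> I"
  using I_l_closed[of f g] by simp

lemma ideal_mult_right: "f \<in> I \<Longrightarrow> f * g \<in> I"
  using I_r_closed[of f g] by simp

lemma ideal_uminus: "f \<in> I \<Longrightarrow> - f \<in> I"
  using ideal_mult_left[of f "- 1"] by simp

lemma ideal_diff: "f \<in> I \<Longrightarrow> g \<in> I \<Longrightarrow> f - g \<in> I"
  using ideal_add[of f "- g"] by (simp add: ideal_uminus)

lemma ideal_sum: "(\<And>i. i \<in> A \<Longrightarrow> f i \<in> I) \<Longrightarrow> (\<Sum>i\<in>A. f i) \<in> I"
  by (induction A rule: infinite_finite_induct) (simp_all add: ideal_0 ideal_add)

lemma mem_coset_iff: "f \<in> I +>\<^bsub>free_algebra\<^esub> g \<longleftrightarrow> f - g \<in> I"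
proof
  assume "f \<in> I +>\<^bsub>free_algebra\<^esub> g"
  then show "f - g \<in> I" by (auto simp: a_r_coset_def')
next
  assume "f - g \<in> I"
  then show "f \<in> I +>\<^bsub>free_algebra\<^esub> g"
    unfolding a_r_coset_def' by (auto intro!: bexI[of _ "f - g"])
qed

lemma coset_eq_iff: "I +>\<^bsub>free_algebra\<^esub> f = I +>\<^bsub>free_algebra\<^esub> g \<longleftrightarrow> f - g \<in> I"
proof
  assume "I +>\<^bsub>free_algebra\<^esub> f = I +>\<^bsub>free_algebra\<^esub> g"
  moreover have "f \<in> I +>\<^bsub>free_algebra\<^esub> f"
    by (simp add: mem_coset_iff ideal_0)
  ultimately show "f - g \<in> I" by (simp add: mem_coset_iff)
next
  assume fg: "f - g \<in> I"
  show "I +>\<^bsub>free_algebra\<^esub> f = I +>\<^bsub>free_algebra\<^esub> g"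
  proof (rule Set.set_eqI)
    fix h
    show "h \<in> I +>\<^bsub>free_algebra\<^esub> f \<longleftrightarrow> h \<in> I +>\<^bsub>free_algebra\<^esub> g"
      using ideal_add[OF _ fg, of "h - f"] ideal_diff[OF _ fg, of "h - g"] by (auto simp: mem_coset_iff)
  qed
qed

lemma coset_add:
  "(I +>\<^bsub>free_algebra\<^esub> f) \<oplus>\<^bsub>free_algebra Quot I\<^esub> (I +>\<^bsub>free_algebra\<^esub> g) = I +>\<^bsub>free_algebra\<^esub> (f + g)"
  using a_rcos_sum[of f g] by (simp add: FactRing_def)

lemma coset_mult:
  "(I +>\<^bsub>free_algebra\<^esub> f) \<otimes>\<^bsub>free_algebra Quot I\<^esub> (I +>\<^bsub>free_algebra\<^esub> g) = I +>\<^bsub>free_algebra\<^esub> (f * g)"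
  using rcoset_mult_add[of f g] by (simp add: FactRing_def)

end

text \<open>The elements \<open>f\<close> with \<open>Q (u * f * v)\<close> for all
  \<open>u\<close>, \<open>v\<close> form a two-sided ideal; by linearity it suffices to put words
  around the generators.\<close>

lemma genideal_induct [consumes 1, case_names generator zero add scalar]:
  fixes f :: "'g list \<Rightarrow>\<^sub>0 'k::field"
  assumes "f \<in> genideal free_algebra S"
    and gen: "\<And>s p q. s \<in> S \<Longrightarrow> Q (monomial p * s * monomial q)"
    and zero: "Q 0" and add: "\<And>f g. Q f \<Longrightarrow> Q g \<Longrightarrow> Q (f + g)"
    and scalar: "\<And>c f. Q f \<Longrightarrow> Q (scalar c * f)"
  shows "Q f"
proof -
  let ?J = "{f. \<forall>u v. Q (u * f * v)}"
  have "ideal ?J (free_algebra :: ('g list \<Rightarrow>\<^sub>0 'k) ring)"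
  proof (rule idealI)
    have "Q (- f)" if "Q f" for f
      using scalar[OF that, of "- 1"] by (simp add: scalar_uminus)
    then show "subgroup ?J (add_monoid (free_algebra :: ('g list \<Rightarrow>\<^sub>0 'k) ring))"
      by unfold_locales
        (simp_all add: zero add distrib_left distrib_right free_ring_minus[unfolded a_inv_def, simplified])
  next
    fix f g :: "'g list \<Rightarrow>\<^sub>0 'k"
    assume "f \<in> ?J"
    then have "Q ((u * g) * f * v)" "Q (u * f * (g * v))" for u v
      by blast+
    then show "g \<otimes>\<^bsub>free_algebra\<^esub> f \<in> ?J" "f \<otimes>\<^bsub>free_algebra\<^esub> g \<in> ?J"
      by (simp_all add: mult.assoc)
  qed (fact free_ring.ring_axioms)
  moreover have "S \<subseteq> ?J"
  proof
    fix s assume s: "s \<in> S"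
    have "Q (u * s * v)" for u v
    proof (induction u rule: single_induct)
      case (single p c)
      show ?case
      proof (induction v rule: single_induct)
        case (single q d)
        have "Poly_Mapping.single p c * s * Poly_Mapping.single q d =
            scalar c * (monomial p * s * (scalar d * monomial q))"
          by (simp add: mult.assoc flip: scalar_mult_monomial)
        also have "\<dots> = scalar c * (scalar d * (monomial p * s * monomial q))"
          by (simp only: mult_scalar[of "monomial p * s"])
        finally show ?case
          by (simp add: gen[OF s] scalar)
      qed (simp add: distrib_left add)
    qed (simp add: distrib_right add)
    then show "s \<in> ?J" by simp
  qed
  ultimately have "genideal free_algebra S \<subseteq> ?J"
    by (rule free_ring.genideal_minimal)
  then have "Q (1 * f * 1)"
    using assms(1) by blast
  then show ?thesis by simp
qed

section \<open>The tensor ideal and the enveloping ideal\<close>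

lemmas ideal_tensor = ideal_genideal[of "linearity_relations _", folded tensor_ideal_def]
lemmas ideal_enveloping =
  ideal_genideal[of "linearity_relations _ \<union> commutator_relations _", folded enveloping_ideal_def]

lemma tensor_class_eq_iff:
  "tensor_class smul f = tensor_class smul g \<longleftrightarrow> f - g \<in> tensor_ideal smul"
  by (simp add: tensor_class_def coset_eq_iff[OF ideal_tensor])

lemma mem_tensor_class_iff: "f \<in> tensor_class smul g \<longleftrightarrow> f - g \<in> tensor_ideal smul"
  by (simp add: tensor_class_def mem_coset_iff[OF ideal_tensor])

lemma tensor_add_class:
  "tensor_add smul (tensor_class smul f) (tensor_class smul g) = tensor_class smul (f + g)"
  by (simp add: tensor_add_def tensor_class_def tensor_algebra_def coset_add[OF ideal_tensor])

lemma tensor_scale_class: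
  "tensor_scale smul c (tensor_class smul f) = tensor_class smul (scalar c * f)"
  by (simp add: tensor_scale_def tensor_class_def tensor_algebra_def coset_mult[OF ideal_tensor])

lemma enveloping_class_eq_iff:
  "enveloping_class smul br f = enveloping_class smul br g \<longleftrightarrow> f - g \<in> enveloping_ideal smul br"
  by (simp add: enveloping_class_def coset_eq_iff[OF ideal_enveloping])

lemma enveloping_class_mult:
  "enveloping_class smul br f \<otimes>\<^bsub>enveloping_algebra smul br\<^esub> enveloping_class smul br g =
    enveloping_class smul br (f * g)"
  by (simp add: enveloping_class_def enveloping_algebra_def coset_mult[OF ideal_enveloping])

lemma some_mem_tensor_class: "(SOME f. f \<in> tensor_class smul g) - g \<in> tensor_ideal smul"
proof -
  have "g \<in> tensor_class smul g"
    by (simp add: mem_tensor_class_iff ideal_0[OF ideal_tensor])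
  then show ?thesis
    by (metis mem_tensor_class_iff someI_ex)
qed

lemma tensor_ideal_add_letter:
  "monomial (p @ (x + y) # q) - monomial (p @ x # q) - monomial (p @ y # q) \<in> tensor_ideal smul"
proof -
  have "letter (x + y) - letter x - letter y \<in> tensor_ideal smul"
    unfolding tensor_ideal_def by (rule genideal_mem) (auto simp: linearity_relations_def)
  then have "monomial p * (letter (x + y) - letter x - letter y) * monomial q \<in> tensor_ideal smul"
    by (intro ideal_mult_left ideal_mult_right ideal_tensor)
  then show ?thesis
    by (simp add: algebra_simps monomial_mult)
qed

lemma tensor_ideal_scale_letter:
  "monomial (p @ smul c x # q) - scalar c * monomial (p @ x # q) \<in> tensor_ideal smul"
proof -
  have "letter (smul c x) - scalar c * letter x \<in> tensor_ideal smul"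
    unfolding tensor_ideal_def by (rule genideal_mem) (auto simp: linearity_relations_def)
  then have "monomial p * (letter (smul c x) - scalar c * letter x) * monomial q \<in> tensor_ideal smul"
    by (intro ideal_mult_left ideal_mult_right ideal_tensor)
  moreover have "monomial p * (scalar c * letter x) * monomial q = scalar c * monomial (p @ x # q)"
    by (simp add: mult_scalar[of "monomial p"] mult.assoc monomial_mult)
  ultimately show ?thesis
    by (simp add: algebra_simps monomial_mult)
qed

text \<open>The position \<open>inv \<sigma> (length p)\<close> at which \<open>z\<close> lands does
  not depend on \<open>z\<close>, so a permuted linearity relation is a linearity relation
  again.\<close>

lemma permute_list_insert:
  assumes "\<sigma> permutes {..<Suc (length p + length q)}"
  obtains p' q' where "\<And>z. permute_list \<sigma> (p @ z # q) = p' @ z # q'"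
proof -
  let ?L = "\<lambda>z. permute_list \<sigma> (p @ z # q)" and ?j = "Hilbert_Choice.inv \<sigma> (length p)"
  have \<sigma>: "\<sigma> permutes {..<length (p @ z # q)}" for z
    using assms by simp
  have j: "?j < Suc (length p + length q)" "\<sigma> ?j = length p"
    using permutes_in_image[OF permutes_inv[OF assms], of "length p"] permutes_inverses(1)[OF assms] by auto
  have "?L z = (?L undefined)[?j := z]" for z
  proof (rule nth_equalityI)
    fix i assume "i < length (?L z)"
    then have i: "i < length (p @ z # q)" by simp
    \<comment> \<open>All other entries are independent of \<open>z\<close>, which is why
      \<open>undefined\<close> can serve as placeholder.\<close>
    have "\<sigma> i = length p \<longleftrightarrow> i = ?j"
      using j permutes_inj[OF assms] by (metis injD)
    then show "?L z ! i = (?L undefined)[?j := z] ! i"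
      using i permute_list_nth[OF \<sigma>] by (auto simp: nth_list_update nth_append nth_Cons')
  qed simp
  moreover have "(?L undefined)[?j := z] = take ?j (?L undefined) @ z # drop (Suc ?j) (?L undefined)" for z
    using j by (simp add: upd_conv_take_nth_drop)
  ultimately show thesis
    using that by metis
qed

lemma symmetrize_tensor_ideal:
  assumes "f \<in> tensor_ideal smul"
  shows "symmetrize f \<in> tensor_ideal smul"
  using assms unfolding tensor_ideal_def[of smul]
proof (induction rule: genideal_induct)
  case (generator s p q)
  let ?n = "Suc (length p + length q)"
  let ?W = "\<lambda>\<sigma> z. scalar (1 / fact ?n) * monomial (permute_list \<sigma> (p @ z # q)) :: 'a list \<Rightarrow>\<^sub>0 'b"
  let ?P = "{\<sigma>. \<sigma> permutes {..<?n}}"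
  have word: "symmetrize (monomial (p @ z # q)) = (\<Sum>\<sigma>\<in>?P. ?W \<sigma> z)" for z
    by (simp add: symmetrize_monomial symmetrize_word_def)
  from generator consider x y where "s = letter (x + y) - letter x - letter y"
    | c x where "s = letter (smul c x) - scalar c * letter x"
    by (auto simp: linearity_relations_def)
  then have "symmetrize (monomial p * s * monomial q) \<in> tensor_ideal smul"
  proof cases
    case 1
    have "?W \<sigma> (x + y) - ?W \<sigma> x - ?W \<sigma> y \<in> tensor_ideal smul" if \<sigma>: "\<sigma> \<in> ?P" for \<sigma>
    proof -
      obtain p' q' where "\<And>z. permute_list \<sigma> (p @ z # q) = p' @ z # q'"
        using permute_list_insert \<sigma> by blast
      then show ?thesis
        using ideal_mult_left[OF ideal_tensor tensor_ideal_add_letter[of p' x y q' smul], of "scalar (1 / fact ?n)"]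
        by (simp add: right_diff_distrib)
    qed
    then have "(\<Sum>\<sigma>\<in>?P. ?W \<sigma> (x + y) - ?W \<sigma> x - ?W \<sigma> y) \<in> tensor_ideal smul"
      by (intro ideal_sum ideal_tensor)
    then show ?thesis
      by (simp add: 1 algebra_simps monomial_mult symmetrize_diff word sum_subtractf symmetrize_add sum.distrib)
  next
    case 2
    have "?W \<sigma> (smul c x) - scalar c * ?W \<sigma> x \<in> tensor_ideal smul" if \<sigma>: "\<sigma> \<in> ?P" for \<sigma>
    proof -
      obtain p' q' where "\<And>z. permute_list \<sigma> (p @ z # q) = p' @ z # q'"
        using permute_list_insert \<sigma> by blast
      moreover have "scalar (1 / fact ?n) * (scalar c * R) = scalar c * (scalar (1 / fact ?n) * R)"
        for R :: "'a list \<Rightarrow>\<^sub>0 'b"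
        by (simp add: scalar_mult mult.commute flip: mult.assoc)
      ultimately show ?thesis
        using ideal_mult_left[OF ideal_tensor tensor_ideal_scale_letter[of p' smul c x q'], of "scalar (1 / fact ?n)"]
        by (simp add: right_diff_distrib)
    qed
    then have "(\<Sum>\<sigma>\<in>?P. ?W \<sigma> (smul c x) - scalar c * ?W \<sigma> x) \<in> tensor_ideal smul"
      by (intro ideal_sum ideal_tensor)
    moreover have "monomial p * (scalar c * letter x) * monomial q = scalar c * monomial (p @ x # q)"
      by (simp add: mult_scalar[of "monomial p"] mult.assoc monomial_mult)
    ultimately show ?thesis
      by (simp add: 2 left_diff_distrib right_diff_distrib monomial_mult symmetrize_diff symmetrize_scalar
          word sum_subtractf sum_distrib_left)
  qed
  then show ?case by (simp add: tensor_ideal_def)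
next
  case zero
  show ?case
    by (simp add: symmetrize_eq_lin_ext ideal_0[OF ideal_genideal])
next
  case (add f g)
  then show ?case by (simp add: symmetrize_add ideal_add[OF ideal_genideal])
next
  case (scalar c f)
  then show ?case by (simp add: symmetrize_scalar ideal_mult_left[OF ideal_genideal])
qed

lemma tensor_ideal_subset_enveloping_ideal: "tensor_ideal smul \<subseteq> enveloping_ideal smul br"
  unfolding tensor_ideal_def
  by (rule free_ring.genideal_minimal[OF ideal_enveloping])
    (auto simp: enveloping_ideal_def intro!: genideal_mem)

lemma symmetrization_map_class:
  "symmetrization_map smul br (tensor_class smul f) = enveloping_class smul br (symmetrize f)"
proof -
  have "symmetrize ((SOME g. g \<in> tensor_class smul f) - f) \<in> enveloping_ideal smul br"
    using some_mem_tensor_class symmetrize_tensor_ideal tensor_ideal_subset_enveloping_ideal by blast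
  then show ?thesis
    by (simp add: symmetrization_map_def enveloping_class_eq_iff symmetrize_diff)
qed

subsection \<open>Surjectivity of the symmetrization map\<close>

text \<open>The elements congruent modulo \<open>I\<close> to combinations of words shorter than
  \<open>n\<close>: a step of the length filtration of the quotient.\<close>

definition lower_words :: "nat \<Rightarrow> ('g list \<Rightarrow>\<^sub>0 'k::field) set \<Rightarrow> ('g list \<Rightarrow>\<^sub>0 'k) set"
  where "lower_words n I = {P. \<exists>Q. (\<forall>w\<in>Poly_Mapping.keys Q. length w < n) \<and> P - Q \<in> I}"

context
  fixes I :: "('g list \<Rightarrow>\<^sub>0 'k::field) set"
  assumes I: "ideal I free_algebra"
begin

lemma lower_words_ideal: "P \<in> I \<Longrightarrow> P \<in> lower_words n I"
  unfolding lower_words_def by (auto intro!: exI[of _ 0])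

lemma lower_words_add:
  assumes "P \<in> lower_words n I" "P' \<in> lower_words n I"
  shows "P + P' \<in> lower_words n I"
proof -
  from assms obtain Q Q' where "\<forall>w\<in>Poly_Mapping.keys Q. length w < n" "P - Q \<in> I"
    "\<forall>w\<in>Poly_Mapping.keys Q'. length w < n" "P' - Q' \<in> I"
    by (auto simp: lower_words_def)
  moreover from this have "(P - Q) + (P' - Q') \<in> I"
    by (intro ideal_add[OF I])
  ultimately show ?thesis
    using keys_add[of Q Q'] unfolding lower_words_def
    by (auto intro!: exI[of _ "Q + Q'"] simp: algebra_simps)
qed

lemma lower_words_scalar:
  assumes "P \<in> lower_words n I"
  shows "scalar c * P \<in> lower_words n I"
proof -
  from assms obtain Q where "\<forall>w\<in>Poly_Mapping.keys Q. length w < n" "P - Q \<in> I"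
    by (auto simp: lower_words_def)
  moreover from this have "scalar c * (P - Q) \<in> I"
    by (intro ideal_mult_left[OF I])
  ultimately show ?thesis
    using keys_scalar_mult[of c Q] unfolding lower_words_def
    by (auto intro!: exI[of _ "scalar c * Q"] simp: right_diff_distrib)
qed

lemma lower_words_sum: "(\<And>i. i \<in> A \<Longrightarrow> P i \<in> lower_words n I) \<Longrightarrow> (\<Sum>i\<in>A. P i) \<in> lower_words n I"
  by (induction A rule: infinite_finite_induct)
    (simp_all add: lower_words_add lower_words_ideal ideal_0[OF I])

lemma lower_words_letter_mult:
  assumes "P \<in> lower_words n I"
  shows "letter x * P \<in> lower_words (Suc n) I"
proof -
  from assms obtain Q where Q: "\<forall>w\<in>Poly_Mapping.keys Q. length w < n" "P - Q \<in> I"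
    by (auto simp: lower_words_def)
  then have "letter x * (P - Q) \<in> I"
    by (intro ideal_mult_left[OF I])
  moreover have "length w < Suc n" if "w \<in> Poly_Mapping.keys (letter x * Q)" for w
    using that Q(1) by (auto simp: monomial_def elim!: keys_multE)
  ultimately show ?thesis
    unfolding lower_words_def by (auto intro!: exI[of _ "letter x * Q"] simp: right_diff_distrib)
qed

end

lemma enveloping_ideal_swap:
  "monomial (p @ x # y # q) - monomial (p @ y # x # q) - monomial (p @ br x y # q)
      \<in> enveloping_ideal smul br"
proof -
  have "letter x * letter y - letter y * letter x - letter (br x y) \<in> enveloping_ideal smul br"
    unfolding enveloping_ideal_def by (rule genideal_mem) (auto simp: commutator_relations_def)
  then have "monomial p * (letter x * letter y - letter y * letter x - letter (br x y)) * monomial q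
      \<in> enveloping_ideal smul br"
    by (intro ideal_mult_left ideal_mult_right ideal_enveloping)
  then show ?thesis
    by (simp add: left_diff_distrib right_diff_distrib monomial_mult)
qed

text \<open>Exchanging neighbours costs one bracket, that is, a word shorter by one. The first
  letter of \<open>v\<close> is moved to the front of \<open>w\<close> in this way, and the rest
  follows by induction.\<close>

lemma monomial_diff_lower_words:
  assumes "mset v = mset w"
  shows "monomial v - monomial w \<in> lower_words (length v) (enveloping_ideal smul br)"
  using assms
proof (induction v arbitrary: w)
  case Nil
  then show ?case
    by (simp add: lower_words_ideal[OF ideal_enveloping] ideal_0[OF ideal_enveloping])
next
  case (Cons x v)
  let ?L = "\<lambda>n. lower_words n (enveloping_ideal smul br)"
  from Cons.prems have "x \<in> set w"
    by (metis list.set_intros(1) mset_eq_setD)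
  then obtain p q where w: "w = p @ x # q"
    by (meson split_list)
  have move: "monomial (x # p @ q) - monomial (p @ x # q) \<in> ?L (Suc (length p + length q))" for p
  proof (induction p)
    case Nil
    show ?case
      by (simp add: lower_words_ideal[OF ideal_enveloping] ideal_0[OF ideal_enveloping])
  next
    case (Cons y p)
    have "monomial (x # y # p @ q) - monomial (y # x # p @ q) \<in> ?L (Suc (Suc (length p + length q)))"
      using enveloping_ideal_swap[of "[]" x y "p @ q" br smul] unfolding lower_words_def
      by (auto intro!: exI[of _ "monomial (br x y # p @ q)"] simp: monomial_def)
    from lower_words_add[OF ideal_enveloping this lower_words_letter_mult[OF ideal_enveloping Cons, of y]]
    show ?case
      by (simp add: right_diff_distrib monomial_mult)
  qed
  have "monomial v - monomial (p @ q) \<in> ?L (length v)"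
    using Cons.prems by (intro Cons.IH) (simp add: w)
  from lower_words_letter_mult[OF ideal_enveloping this, of x]
  have "monomial (x # v) - monomial (x # p @ q) \<in> ?L (Suc (length v))"
    by (simp add: right_diff_distrib monomial_mult)
  moreover have "length v = length p + length q"
    using arg_cong[OF Cons.prems, of size] by (simp add: w)
  ultimately show ?case
    using lower_words_add[OF ideal_enveloping _ move[of p]] by (fastforce simp: w)
qed

text \<open>A word differs from its symmetrization by shorter words modulo the ideal, and induction
  on the length applies to these.\<close>

lemma symmetrize_surj:
  fixes P :: "'a::ab_group_add list \<Rightarrow>\<^sub>0 'b::field_char_0" and smul :: "'b \<Rightarrow> 'a \<Rightarrow> 'a"
  shows "\<exists>f. P - symmetrize f \<in> enveloping_ideal smul br"
proof -
  let ?R = "\<lambda>P. \<exists>f. P - symmetrize f \<in> enveloping_ideal smul br"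
  have R_add: "?R (P + Q)" if "?R P" "?R Q" for P Q :: "'a list \<Rightarrow>\<^sub>0 'b"
  proof -
    from that obtain f g where "P - symmetrize f \<in> enveloping_ideal smul br" "Q - symmetrize g
        \<in> enveloping_ideal smul br"
      by blast
    from ideal_add[OF ideal_enveloping this] have "(P + Q) - symmetrize (f + g)
        \<in> enveloping_ideal smul br"
      by (simp add: symmetrize_add algebra_simps)
    then show ?thesis by blast
  qed
  have R_scalar: "?R (scalar c * P)" if P: "?R P" for P :: "'a list \<Rightarrow>\<^sub>0 'b" and c
  proof -
    from P obtain f where "P - symmetrize f \<in> enveloping_ideal smul br" by blast
    from ideal_mult_left[OF ideal_enveloping this, of "scalar c"]
    have "scalar c * P - symmetrize (scalar c * f) \<in> enveloping_ideal smul br"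
      by (simp add: symmetrize_scalar right_diff_distrib)
    then show ?thesis by blast
  qed
  have R_sum: "?R (\<Sum>i\<in>A. P i)" if "\<And>i. i \<in> A \<Longrightarrow> ?R (P i)" for A :: "'a list set"
      and P :: "'a list \<Rightarrow> 'a list \<Rightarrow>\<^sub>0 'b"
    using that
  proof (induction A rule: infinite_finite_induct)
    case (insert a A)
    then show ?case by (simp add: R_add)
  qed (auto intro!: exI[of _ 0] simp: symmetrize_eq_lin_ext ideal_0[OF ideal_enveloping])
  have word: "?R (monomial w)" for w :: "'a list"
  proof (induction w rule: length_induct)
    case (1 w)
    let ?n = "length w"
    let ?P = "{\<sigma>. \<sigma> permutes {..<?n}}"
    have "(\<Sum>\<sigma>\<in>?P. scalar (1 / fact ?n) * (monomial w - monomial (permute_list \<sigma> w)))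
        \<in> lower_words ?n (enveloping_ideal smul br)"
      by (intro lower_words_sum lower_words_scalar ideal_enveloping monomial_diff_lower_words)
        (simp add: mset_permute_list)
    moreover have "(\<Sum>\<sigma>\<in>?P. scalar (1 / fact ?n) * (monomial w - monomial (permute_list \<sigma> w))) =
        monomial w - (symmetrize (monomial w) :: 'a list \<Rightarrow>\<^sub>0 'b)"
    proof -
      \<comment> \<open>There are \<open>fact ?n\<close> permutations, so the copies of
        \<open>monomial w\<close> add up to one.\<close>
      have "of_nat (fact ?n) * (scalar (1 / fact ?n) * monomial w) = (monomial w :: 'a list \<Rightarrow>\<^sub>0 'b)"
        unfolding of_nat_eq_scalar by (simp add: scalar_mult flip: mult.assoc)
      then show ?thesis
        by (simp add: right_diff_distrib sum_subtractf symmetrize_monomial symmetrize_word_def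
            card_permutations del: of_nat_fact)
    qed
    ultimately obtain Q where Q: "\<forall>v\<in>Poly_Mapping.keys Q. length v < ?n"
      "monomial w - symmetrize (monomial w) - Q \<in> enveloping_ideal smul br"
      by (auto simp: lower_words_def)
    have "?R (\<Sum>v\<in>Poly_Mapping.keys Q. scalar (Poly_Mapping.lookup Q v) * monomial v)"
      using 1 Q(1) by (intro R_sum R_scalar) blast
    then have "?R Q"
      by (simp add: scalar_mult_monomial poly_mapping_sum_single)
    then obtain f where "Q - symmetrize f \<in> enveloping_ideal smul br" by blast
    from ideal_add[OF ideal_enveloping Q(2) this]
    have "monomial w - symmetrize (monomial w + f) \<in> enveloping_ideal smul br"
      by (simp add: symmetrize_add algebra_simps)
    then show ?case by blast
  qed
  have "?R (\<Sum>v\<in>Poly_Mapping.keys P. scalar (Poly_Mapping.lookup P v) * monomial v)"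
    by (intro R_sum R_scalar word)
  then show ?thesis
    by (simp add: scalar_mult_monomial poly_mapping_sum_single)
qed

subsection \<open>The linear part of the star product\<close>

definition word_projection :: "nat \<Rightarrow> 'g list \<Rightarrow> ('g list \<Rightarrow>\<^sub>0 'k::field)"
  where "word_projection n w = (if length w = n then monomial w else 0)"

lemma homogeneous_part_eq_lin_ext:
  "homogeneous_part n = lin_ext (\<lambda>c P. scalar c * P) (word_projection n)"
proof
  fix f :: "'a list \<Rightarrow>\<^sub>0 'b"
  have "lin_ext (\<lambda>c P. scalar c * P) (word_projection n) f =
      (\<Sum>w\<in>Poly_Mapping.keys f. if length w = n then Poly_Mapping.single w (Poly_Mapping.lookup f w) else 0)"
    unfolding lin_ext_def word_projection_def by (rule sum.cong) (simp_all add: scalar_mult_monomial)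
  then show "homogeneous_part n f = lin_ext (\<lambda>c P. scalar c * P) (word_projection n) f"
    by (simp add: homogeneous_part_def sum.inter_filter)
qed

lemma homogeneous_part_homogeneous:
  assumes "f \<in> homogeneous n"
  shows "homogeneous_part n f = f"
proof -
  have "{w. w \<in> Poly_Mapping.keys f \<and> length w = n} = Poly_Mapping.keys f"
    using assms by (auto simp: homogeneous_def)
  then show ?thesis
    by (simp add: homogeneous_part_def poly_mapping_sum_single)
qed

lemma symmetrize_permute_list:
  assumes "\<sigma> permutes {..<length w}"
  shows "symmetrize_word (permute_list \<sigma> w) = (symmetrize_word w :: 'a list \<Rightarrow>\<^sub>0 'k::field_char_0)"
  using assms setum_permutations_compose_left[OF assms,
      of "\<lambda>\<tau>. scalar (1 / fact (length w)) * monomial (permute_list \<tau> w) :: 'a list \<Rightarrow>\<^sub>0 'k"]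
  by (simp add: symmetrize_word_def permute_list_compose)

lemma symmetrize_symmetrize:
  fixes f :: "'a list \<Rightarrow>\<^sub>0 'k::field_char_0"
  shows "symmetrize (symmetrize f) = symmetrize f"
proof (induction f rule: single_induct)
  case (single w c)
  let ?P = "{\<sigma>. \<sigma> permutes {..<length w}}"
  have "symmetrize (symmetrize_word w :: 'a list \<Rightarrow>\<^sub>0 'k) =
      (\<Sum>\<sigma>\<in>?P. scalar (1 / fact (length w)) * symmetrize_word (permute_list \<sigma> w))"
    by (simp only: symmetrize_word_def[of w] symmetrize_sum symmetrize_scalar symmetrize_monomial)
  also have "\<dots> = (\<Sum>\<sigma>\<in>?P. scalar (1 / fact (length w)) * symmetrize_word w)"
    by (rule sum.cong) (simp_all add: symmetrize_permute_list)
  also have "\<dots> = symmetrize_word w"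
    by (simp add: card_permutations of_nat_eq_scalar scalar_mult del: of_nat_fact flip: mult.assoc) simp
  finally show ?case
    by (simp add: symmetrize_single symmetrize_scalar)
qed (simp add: symmetrize_add)

context lie_algebra_char_0 begin

abbreviation "TI \<equiv> tensor_ideal smul"
abbreviation "EI \<equiv> enveloping_ideal smul bracket"

lemma eulerian_enveloping_ideal:
  assumes "f \<in> EI"
  shows "eulerian f = 0"
  using assms unfolding enveloping_ideal_def
proof (induction rule: genideal_induct)
  case (generator s p q)
  have scalar: "eulerian (monomial p * (scalar c * P) * monomial q) =
      smul c (eulerian (monomial p * P * monomial q))" for c P
    by (simp add: mult_scalar[of "monomial p"] mult.assoc eulerian_scalar)
  from generator consider x y where "s = letter (x + y) - letter x - letter y"
    | c x where "s = letter (smul c x) - scalar c * letter x"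
    | x y where "s = letter x * letter y - letter y * letter x - letter (bracket x y)"
    by (auto simp: linearity_relations_def commutator_relations_def)
  then show ?case
  proof cases
    case 1
    then show ?thesis
      by (simp add: left_diff_distrib right_diff_distrib eulerian_diff monomial_mult eulerian_word_add)
  next
    case 2
    then show ?thesis
      by (simp add: left_diff_distrib right_diff_distrib eulerian_diff scalar)
        (simp add: monomial_mult eulerian_word_smul)
  next
    case 3
    then show ?thesis
      using eulerian_word_commutator[of p x y q]
      by (simp add: left_diff_distrib right_diff_distrib eulerian_diff monomial_mult)
  qed
qed (simp_all add: eulerian_add eulerian_scalar)

text \<open>Symmetrization maps the tensor ideal into the enveloping ideal, where
  \<open>eulerian\<close> vanishes, and \<open>eulerian\<close> of a symmetrization is the linear
  part.\<close>

lemma linear_part_tensor_ideal: "f \<in> TI \<Longrightarrow> linear_part f = 0"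
  using symmetrize_tensor_ideal[of f smul] tensor_ideal_subset_enveloping_ideal[of smul bracket]
  by (metis eulerian_enveloping_ideal eulerian_symmetrize subsetD)

lemma linear_part_diff: "linear_part (P - Q) = linear_part P - linear_part Q"
  by (simp add: linear_part_def lin_ext_diff)

lemma linear_part_letter [simp]: "linear_part (letter x) = x"
  by (simp add: linear_part_def)

lemma tensor_class_linear_part:
  "tensor_class smul (homogeneous_part 1 f) = tensor_class smul (letter (linear_part f))"
proof -
  have zero: "letter 0 \<in> TI"
    using tensor_ideal_scale_letter[of "[]" smul 0 0 "[]"] by simp
  have "homogeneous_part 1 f - letter (linear_part f) \<in> TI"
  proof (induction f rule: single_induct)
    case (single w c)
    show ?case
    proof (cases "length w = 1")
      case True
      then obtain x where w: "w = [x]"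
        by (auto simp: length_Suc_conv)
      have "scalar c * letter x - letter (smul c x) \<in> TI"
        using ideal_uminus[OF ideal_tensor tensor_ideal_scale_letter[of "[]" smul c x "[]"]] by simp
      then show ?thesis
        by (simp add: homogeneous_part_eq_lin_ext word_projection_def linear_part_def w)
    next
      case False
      then show ?thesis
        using ideal_uminus[OF ideal_tensor zero]
        by (simp add: homogeneous_part_eq_lin_ext word_projection_def linear_part_def)
    qed
  next
    case (add f g)
    from ideal_diff[OF ideal_tensor ideal_add[OF ideal_tensor add]
        tensor_ideal_add_letter[of "[]" "linear_part f" "linear_part g" "[]" smul]]
    show ?case
      by (simp add: homogeneous_part_eq_lin_ext free_space.lin_ext_add linear_part_def lin_ext_add algebra_simps)
  qed
  then show ?thesis
    by (simp add: tensor_class_eq_iff)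
qed

lemma sym_projection_1:
  "sym_projection smul 1 (tensor_class smul f) = tensor_class smul (letter (linear_part f))"
proof -
  have "linear_part ((SOME g. g \<in> tensor_class smul f) - f) = 0"
    by (rule linear_part_tensor_ideal[OF some_mem_tensor_class])
  then show ?thesis
    unfolding sym_projection_def tensor_class_linear_part by (simp add: linear_part_diff)
qed

lemma sym_algebra_class: "tensor_class smul (symmetrize f) \<in> sym_algebra smul"
  by (simp add: sym_algebra_def)

text \<open>Surjectivity makes \<open>inv_into\<close> return a genuine preimage of the class of
  \<open>?u\<close>. Its symmetrization is congruent to \<open>?u\<close>, so
  \<open>eulerian\<close> reads its degree one part off from \<open>?u\<close>.\<close>

lemma sym_projection_gutt_star:
  fixes f g :: "'g list \<Rightarrow>\<^sub>0 'k"
  defines "r \<equiv> gutt_star smul bracket (tensor_class smul f) (tensor_class smul g)"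
  shows "sym_projection smul 1 r =
      tensor_class smul (letter (eulerian (symmetrize f * symmetrize g)))"
proof -
  let ?q = "symmetrization_map smul bracket" and ?u = "symmetrize f * symmetrize g"
  obtain h where h: "?u - symmetrize h \<in> EI"
    using symmetrize_surj by blast
  then have h_eq: "?q (tensor_class smul (symmetrize h)) = enveloping_class smul bracket ?u"
    unfolding symmetrization_map_class symmetrize_symmetrize enveloping_class_eq_iff
    by (metis ideal_enveloping ideal_uminus minus_diff_eq)
  have r: "r = inv_into (sym_algebra smul) ?q (enveloping_class smul bracket ?u)"
    by (simp add: r_def gutt_star_def symmetrization_map_class enveloping_class_mult)
  have "enveloping_class smul bracket ?u \<in> ?q ` sym_algebra smul"
    using h_eq sym_algebra_class by (metis imageI)
  then have mem: "r \<in> sym_algebra smul" and q: "?q r = enveloping_class smul bracket ?u"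
    unfolding r by (rule inv_into_into, rule f_inv_into_f)
  from mem obtain k where k: "r = tensor_class smul (symmetrize k)"
    by (auto simp: sym_algebra_def)
  with q have "symmetrize k - ?u \<in> EI"
    by (simp add: symmetrization_map_class symmetrize_symmetrize enveloping_class_eq_iff)
  from eulerian_enveloping_ideal[OF this] have "eulerian (symmetrize k) = eulerian ?u"
    by (simp add: eulerian_diff)
  then show "sym_projection smul 1 r = tensor_class smul (letter (eulerian ?u))"
    unfolding k sym_projection_1 by (metis eulerian_symmetrize symmetrize_symmetrize)
qed

end

section \<open>Seminorms\<close>

lemma seminorm_nonneg: "is_seminorm V vadd vscale p \<Longrightarrow> x \<in> V \<Longrightarrow> 0 \<le> p x"
  and seminorm_triangle: "is_seminorm V vadd vscale p \<Longrightarrow> x \<in> V \<Longrightarrow> y \<in> V \<Longrightarrow> p (vadd x y) \<le> p x + p y"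
  and seminorm_scale: "is_seminorm V vadd vscale p \<Longrightarrow> x \<in> V \<Longrightarrow> p (vscale c x) = norm c * p x"
  by (simp_all add: is_seminorm_def)

text \<open>The carriers are sets of cosets, so the vector space facts used with seminorms are
  collected here; \<open>vadd x (vscale (- 1) y)\<close> is the difference.\<close>

locale carrier_space =
  fixes V :: "'v set" and vadd :: "'v \<Rightarrow> 'v \<Rightarrow> 'v" and vscale :: "'k::real_normed_field \<Rightarrow> 'v \<Rightarrow> 'v"
    and vzero :: 'v
  assumes add_mem: "x \<in> V \<Longrightarrow> y \<in> V \<Longrightarrow> vadd x y \<in> V"
    and scale_mem: "x \<in> V \<Longrightarrow> vscale c x \<in> V"
    and zero_mem: "vzero \<in> V"
    and zero_add: "x \<in> V \<Longrightarrow> vadd vzero x = x"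
    and scale_zero: "x \<in> V \<Longrightarrow> vscale 0 x = vzero"
    and diff_self: "x \<in> V \<Longrightarrow> vadd x (vscale (- 1) x) = vzero"
    and diff_add: "x \<in> V \<Longrightarrow> y \<in> V \<Longrightarrow> vadd (vadd x (vscale (- 1) y)) y = x"
    and minus_diff: "x \<in> V \<Longrightarrow> y \<in> V \<Longrightarrow>
      vscale (- 1) (vadd x (vscale (- 1) y)) = vadd y (vscale (- 1) x)"
begin

lemma topspace_seminorm_topology: "topspace (seminorm_topology V vadd vscale P) = V"
  unfolding seminorm_topology_def by (auto simp: topology_generated_by_topspace)

lemma openin_seminorm_ball:
  "p \<in> P \<Longrightarrow> x \<in> V \<Longrightarrow> 0 < e \<Longrightarrow>
    openin (seminorm_topology V vadd vscale P) {y \<in> V. p (vadd y (vscale (- 1) x)) < e}"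
  unfolding seminorm_topology_def by (rule topology_generated_by_Basis) blast

lemma seminorm_zero: "is_seminorm V vadd vscale p \<Longrightarrow> p vzero = 0"
  using seminorm_scale[of V vadd vscale p vzero 0] by (simp add: scale_zero zero_mem)

lemma seminorm_dist:
  assumes p: "is_seminorm V vadd vscale p" and "x \<in> V" "y \<in> V"
  shows "\<bar>p y - p x\<bar> \<le> p (vadd y (vscale (- 1) x))"
proof -
  have le: "p a \<le> p (vadd a (vscale (- 1) b)) + p b" if "a \<in> V" "b \<in> V" for a b
    using seminorm_triangle[OF p add_mem[OF that(1) scale_mem[OF that(2), of "- 1"]] that(2)]
    by (simp add: diff_add that)
  have "p (vadd x (vscale (- 1) y)) = norm (- 1 :: 'k) * p (vadd y (vscale (- 1) x))"
    using seminorm_scale[OF p add_mem[OF assms(3) scale_mem[OF assms(2), of "- 1"]], of "- 1"]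
    by (simp add: minus_diff assms)
  then show ?thesis
    using le[of x y] le[of y x] assms(2,3) by simp
qed

lemma continuous_seminorm_generator:
  assumes p: "is_seminorm V vadd vscale p" "p \<in> P"
  shows "continuous_seminorm V vadd vscale (seminorm_topology V vadd vscale P) p"
proof -
  let ?T = "seminorm_topology V vadd vscale P"
  have "openin ?T {x \<in> topspace ?T. p x \<in> U}" if "open U" for U
  proof (subst openin_subopen, intro ballI)
    fix x assume "x \<in> {x \<in> topspace ?T. p x \<in> U}"
    then have x: "x \<in> V" "p x \<in> U"
      by (simp_all add: topspace_seminorm_topology)
    then obtain e where e: "0 < e" "\<And>r. \<bar>r - p x\<bar> < e \<Longrightarrow> r \<in> U"
      using \<open>open U\<close> by (metis open_real)
    let ?B = "{y \<in> V. p (vadd y (vscale (- 1) x)) < e}"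
    have "x \<in> ?B"
      using x e p by (simp add: diff_self seminorm_zero)
    moreover have "?B \<subseteq> {x \<in> topspace ?T. p x \<in> U}"
      using seminorm_dist[OF p(1) x(1)] e(2) by (fastforce simp: topspace_seminorm_topology)
    ultimately show "\<exists>B. openin ?T B \<and> x \<in> B \<and> B \<subseteq> {x \<in> topspace ?T. p x \<in> U}"
      using openin_seminorm_ball[OF p(2) x(1) e(1)] by blast
  qed
  then show ?thesis
    using p(1) by (simp add: continuous_seminorm_def continuous_map_def)
qed

lemma continuous_seminorm_add:
  assumes "continuous_seminorm V vadd vscale T p" "continuous_seminorm V vadd vscale T q"
  shows "continuous_seminorm V vadd vscale T (\<lambda>x. p x + q x)"
proof -
  have p: "is_seminorm V vadd vscale p" and q: "is_seminorm V vadd vscale q"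
    using assms by (simp_all add: continuous_seminorm_def)
  have "p (vadd x y) + q (vadd x y) \<le> p x + q x + (p y + q y)" if "x \<in> V" "y \<in> V" for x y
    using seminorm_triangle[OF p that] seminorm_triangle[OF q that] by simp
  then have "is_seminorm V vadd vscale (\<lambda>x. p x + q x)"
    by (simp add: is_seminorm_def seminorm_nonneg[OF p] seminorm_nonneg[OF q]
        seminorm_scale[OF p] seminorm_scale[OF q] distrib_left)
  moreover have "continuous_map T euclideanreal (\<lambda>x. p x + q x)"
    using assms by (intro continuous_map_add) (simp_all add: continuous_seminorm_def)
  ultimately show ?thesis by (simp add: continuous_seminorm_def)
qed

lemma continuous_seminorm_divide:
  assumes "continuous_seminorm V vadd vscale T p" "0 < (d :: real)"
  shows "continuous_seminorm V vadd vscale T (\<lambda>x. p x / d)"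
proof -
  have "continuous_map T euclideanreal (\<lambda>x. p x / d)"
    using assms by (intro continuous_map_real_divide) (auto simp: continuous_seminorm_def)
  moreover have "is_seminorm V vadd vscale (\<lambda>x. p x / d)"
    using assms unfolding continuous_seminorm_def is_seminorm_def
    by (auto simp: divide_right_mono simp flip: add_divide_distrib)
  ultimately show ?thesis by (simp add: continuous_seminorm_def)
qed

text \<open>Induction over the topology generated by the balls: sums of seminorms handle
  intersections, and a ball about another point is shrunk to one about the origin.\<close>

lemma zero_neighbourhood_seminorm:
  assumes P: "\<And>p. p \<in> P \<Longrightarrow> is_seminorm V vadd vscale p"
    and U: "openin (seminorm_topology V vadd vscale P) U" "vzero \<in> U"
  shows "\<exists>q. continuous_seminorm V vadd vscale (seminorm_topology V vadd vscale P) q \<and> {x \<in> V. q x < 1} \<subseteq> U"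
proof -
  let ?T = "seminorm_topology V vadd vscale P"
  have "generate_topology_on
      (insert V {{y \<in> V. p (vadd y (vscale (- 1) x)) < e} | p x e. p \<in> P \<and> x \<in> V \<and> 0 < e}) U"
    using U(1) by (simp add: seminorm_topology_def openin_topology_generated_by_iff)
  then show ?thesis
    using U(2)
  proof (induction rule: generate_topology_on.induct)
    case (Int A B)
    then obtain q q' where "continuous_seminorm V vadd vscale ?T q" "{x \<in> V. q x < 1} \<subseteq> A"
      "continuous_seminorm V vadd vscale ?T q'" "{x \<in> V. q' x < 1} \<subseteq> B"
      by blast
    moreover from this have "0 \<le> q x" "0 \<le> q' x" if "x \<in> V" for x
      using that by (simp_all add: continuous_seminorm_def is_seminorm_def)
    ultimately show ?case
      by (intro exI[of _ "\<lambda>x. q x + q' x"] conjI continuous_seminorm_add) force+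
  next
    case (UN K)
    then show ?case by blast
  next
    case (Basis B)
    have const: "continuous_seminorm V vadd vscale ?T (\<lambda>x. 0)"
      by (simp add: continuous_seminorm_def is_seminorm_def)
    from Basis consider "B = V"
      | p x e where "p \<in> P" "x \<in> V" "0 < e" "B = {y \<in> V. p (vadd y (vscale (- 1) x)) < e}"
      by blast
    then show ?case
    proof cases
      case 1
      then show ?thesis using const by blast
    next
      case 2
      \<comment> \<open>\<open>?d\<close> is what the radius leaves after the distance from the
        center to the origin; it is positive because the origin lies in \<open>B\<close>.\<close>
      let ?x = "vscale (- 1) x" and ?d = "e - p (vscale (- 1) x)"
      have p: "is_seminorm V vadd vscale p" and x: "?x \<in> V"
        using 2 P scale_mem by auto
      have d: "0 < ?d"
        using Basis(2) x by (simp add: 2 zero_add)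
      have "{y \<in> V. p y / ?d < 1} \<subseteq> B"
      proof
        fix y assume "y \<in> {y \<in> V. p y / ?d < 1}"
        then have "y \<in> V" "p y < ?d"
          using d by (simp_all add: divide_less_eq)
        moreover from this have "p (vadd y ?x) \<le> p y + p ?x"
          using p x by (simp add: is_seminorm_def)
        ultimately show "y \<in> B" by (simp add: 2)
      qed
      then show ?thesis
        using continuous_seminorm_divide[OF continuous_seminorm_generator[OF p 2(1)] d] by blast
    qed
  qed simp
qed

end

lemma tensor_carrier_space:
  assumes sub: "V \<subseteq> range (tensor_class smul)" and zero: "tensor_class smul 0 \<in> V"
    and add: "\<And>s t. s \<in> V \<Longrightarrow> t \<in> V \<Longrightarrow> tensor_add smul s t \<in> V"
    and scale: "\<And>c s. s \<in> V \<Longrightarrow> tensor_scale smul c s \<in> V"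
  shows "carrier_space V (tensor_add smul) (tensor_scale smul) (tensor_class smul 0)"
proof
  fix s t assume "s \<in> V" "t \<in> V"
  then obtain f g where "s = tensor_class smul f" "t = tensor_class smul g"
    using sub by blast
  then show "tensor_add smul (tensor_add smul s (tensor_scale smul (- 1) t)) t = s"
    "tensor_scale smul (- 1) (tensor_add smul s (tensor_scale smul (- 1) t)) =
      tensor_add smul t (tensor_scale smul (- 1) s)"
    by (simp_all add: tensor_add_class tensor_scale_class scalar_uminus)
next
  fix s assume "s \<in> V"
  then obtain f where "s = tensor_class smul f"
    using sub by blast
  then show "tensor_add smul (tensor_class smul 0) s = s" "tensor_scale smul 0 s = tensor_class smul 0"
    "tensor_add smul s (tensor_scale smul (- 1) s) = tensor_class smul 0"
    by (simp_all add: tensor_add_class tensor_scale_class scalar_uminus)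
qed (simp_all add: zero add scale)

section \<open>Convergence\<close>

locale lie_algebra_normed_field = lie_algebra smul bracket
  for smul :: "'k::real_normed_field \<Rightarrow> 'g::ab_group_add \<Rightarrow> 'g" and bracket
begin

sublocale lie_algebra_char_0 smul bracket ..

lemma tensor_class_letter_add:
  "tensor_add smul (tensor_class smul (letter x)) (tensor_class smul (letter y)) =
      tensor_class smul (letter (x + y))"
  using ideal_uminus[OF ideal_tensor tensor_ideal_add_letter[of "[]" x y "[]" smul]]
  by (simp add: tensor_add_class tensor_class_eq_iff algebra_simps)

lemma tensor_class_letter_scale:
  "tensor_scale smul c (tensor_class smul (letter x)) = tensor_class smul (letter (smul c x))"
  using ideal_uminus[OF ideal_tensor tensor_ideal_scale_letter[of "[]" smul c x "[]"]]
  by (simp add: tensor_scale_class tensor_class_eq_iff)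

lemma tensor_class_letter_0: "tensor_class smul (letter 0) = tensor_class smul 0"
  using tensor_class_letter_scale[of 0 0] by (simp add: tensor_scale_class)

lemma tensor_power_1: "tensor_power smul 1 = range (\<lambda>x. tensor_class smul (letter x))"
proof -
  have "letter x \<in> homogeneous 1" for x :: 'g
    by (simp add: homogeneous_def monomial_def)
  moreover have "tensor_class smul f = tensor_class smul (letter (linear_part f))"
      if "f \<in> homogeneous 1" for f
    using tensor_class_linear_part[of f] homogeneous_part_homogeneous[OF that] by simp
  ultimately show ?thesis
    unfolding tensor_power_def by blast
qed

lemma carrier_space_tensor_power_1:
  "carrier_space (tensor_power smul 1) (tensor_add smul) (tensor_scale smul) (tensor_class smul 0)"
  unfolding tensor_power_1
  by (rule tensor_carrier_space)
    (auto simp: tensor_class_letter_add tensor_class_letter_scale simp flip: tensor_class_letter_0)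

lemma seminorm_sum:
  assumes p: "is_seminorm UNIV (+) smul p"
  shows "p (\<Sum>i\<in>A. f i) \<le> (\<Sum>i\<in>A. p (f i))"
proof (induction A rule: infinite_finite_induct)
  case (insert a A)
  then show ?case
    using seminorm_triangle[OF p, of "f a" "sum f A"] by simp
qed (use seminorm_scale[OF p, of 0 0] in simp_all)

text \<open>The infimum is attained at \<open>letter x\<close>. Every other representative has
  linear part \<open>x\<close> too, so the triangle inequality bounds its cost from below.\<close>

lemma projective_seminorm_letter:
  assumes p: "is_seminorm UNIV (+) smul p"
  shows "projective_seminorm [p] (tensor_class smul (letter x)) = p x"
proof -
  let ?s = "\<lambda>f. \<Sum>xs\<in>Poly_Mapping.keys f. norm (Poly_Mapping.lookup f xs) * (\<Prod>i<length [p]. ([p] ! i) (xs ! i))"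
  let ?A = "{?s f | f. f \<in> tensor_class smul (letter x) \<and> f \<in> homogeneous (length [p])}"
  have "p x \<le> ?s f" if f: "f \<in> tensor_class smul (letter x)" "f \<in> homogeneous 1" for f
  proof -
    have len: "length w = 1" if "w \<in> Poly_Mapping.keys f" for w
      using f(2) that by (simp add: homogeneous_def)
    have "linear_part f = x"
      using f(1) linear_part_tensor_ideal[of "f - letter x"]
        by (simp add: mem_tensor_class_iff linear_part_diff)
    then have "p x = p (\<Sum>w\<in>Poly_Mapping.keys f. smul (Poly_Mapping.lookup f w) (hd w))"
      using len by (simp add: linear_part_def lin_ext_def)
    also have "\<dots> \<le> (\<Sum>w\<in>Poly_Mapping.keys f. p (smul (Poly_Mapping.lookup f w) (hd w)))"
      by (rule seminorm_sum[OF p])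
    also have "\<dots> = ?s f"
    proof (rule sum.cong)
      fix w assume "w \<in> Poly_Mapping.keys f"
      then have "w \<noteq> []" using len[of w] by auto
      then show "p (smul (Poly_Mapping.lookup f w) (hd w)) =
          norm (Poly_Mapping.lookup f w) * (\<Prod>i<length [p]. ([p] ! i) (w ! i))"
        by (simp add: seminorm_scale[OF p] hd_conv_nth)
    qed simp
    finally show ?thesis .
  qed
  moreover have "p x \<in> ?A"
    by (intro CollectI exI[of _ "letter x"])
      (simp add: mem_tensor_class_iff ideal_0[OF ideal_tensor] homogeneous_def monomial_def)
  ultimately show ?thesis
    unfolding projective_seminorm_def by (intro cInf_eq_minimum) auto
qed

lemma is_seminorm_projective_seminorm:
  assumes p: "is_seminorm UNIV (+) smul p"
  shows "is_seminorm (tensor_power smul 1) (tensor_add smul) (tensor_scale smul) (projective_seminorm [p])"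
  using p unfolding tensor_power_1
  by (auto simp: is_seminorm_def tensor_class_letter_add tensor_class_letter_scale projective_seminorm_letter[OF p])

lemma continuous_map_projective_seminorm:
  assumes p: "continuous_seminorm UNIV (+) smul T p"
  shows "continuous_map (sym_power_topology smul T 1) euclideanreal (projective_seminorm [p])"
proof -
  interpret carrier_space "tensor_power smul 1" "tensor_add smul" "tensor_scale smul" "tensor_class smul 0"
    by (rule carrier_space_tensor_power_1)
  have "projective_seminorm [p] \<in>
      {projective_seminorm ps | ps. length ps = 1 \<and> (\<forall>p\<in>set ps. continuous_seminorm UNIV (+) smul T p)}"
    using p by (auto intro!: exI[of _ "[p]"])
  from continuous_seminorm_generator[OF is_seminorm_projective_seminorm this] p
  show ?thesis
    unfolding sym_power_topology_def tensor_power_topology_def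
    by (intro continuous_map_from_subtopology) (simp add: continuous_seminorm_def)
qed

lemma carrier_space_sym_algebra:
  "carrier_space (sym_algebra smul) (tensor_add smul) (tensor_scale smul) (tensor_class smul 0)"
proof (rule tensor_carrier_space)
  show "tensor_class smul 0 \<in> sym_algebra smul"
    using sym_algebra_class[of 0] by (simp add: symmetrize_eq_lin_ext)
qed (auto simp: sym_algebra_def tensor_add_class tensor_scale_class simp flip: symmetrize_add symmetrize_scalar)

text \<open>Near the origin, continuity bounds \<open>p\<close> of the degree one part by 1 on a
  product of seminorm balls, and bilinearity allows rescaling. The strict bounds \<open>r\<close>
  and \<open>r'\<close> are automatically positive, so one can divide by them even where
  \<open>q\<close> or \<open>q'\<close> is 0.\<close>

lemma star_continuity_estimate:
  assumes lc: "locally_convex_topology (sym_algebra smul) (tensor_add smul) (tensor_scale smul) \<tau>"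
    and star: "continuous_map (prod_topology \<tau> \<tau>) \<tau> (\<lambda>(s, t). gutt_star smul bracket s t)"
    and proj: "continuous_map \<tau> (sym_power_topology smul T 1) (sym_projection smul 1)"
    and p: "continuous_seminorm UNIV (+) smul T p"
  obtains q q' where
    "continuous_seminorm (sym_algebra smul) (tensor_add smul) (tensor_scale smul) \<tau> q"
    "continuous_seminorm (sym_algebra smul) (tensor_add smul) (tensor_scale smul) \<tau> q'"
    "\<And>f g r r'. q (tensor_class smul (symmetrize f)) < r \<Longrightarrow> q' (tensor_class smul (symmetrize g)) < r' \<Longrightarrow>
      p (eulerian (symmetrize f * symmetrize g)) \<le> r * r'"
proof -
  let ?S = "sym_algebra smul" and ?c = "\<lambda>f. tensor_class smul (symmetrize f)" and ?z =
      "tensor_class smul 0"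
  interpret carrier_space ?S "tensor_add smul" "tensor_scale smul" ?z
    by (rule carrier_space_sym_algebra)
  from lc obtain P where P: "\<And>p. p \<in> P \<Longrightarrow> is_seminorm ?S (tensor_add smul) (tensor_scale smul) p"
    and \<tau>: "\<tau> = seminorm_topology ?S (tensor_add smul) (tensor_scale smul) P"
    by (auto simp: locally_convex_topology_def)
  have top: "topspace \<tau> = ?S"
    unfolding \<tau> by (rule topspace_seminorm_topology)
  have sp: "is_seminorm UNIV (+) smul p"
    using p by (simp add: continuous_seminorm_def)
  define B where "B = (\<lambda>(s, t). projective_seminorm [p] (sym_projection smul 1 (gutt_star smul bracket s t)))"
  have "B = projective_seminorm [p] \<circ> (sym_projection smul 1 \<circ> (\<lambda>(s, t). gutt_star smul bracket s t))"
    by (auto simp: B_def)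
  then have cont: "continuous_map (prod_topology \<tau> \<tau>) euclideanreal B"
    using continuous_map_compose[OF continuous_map_compose[OF star proj] continuous_map_projective_seminorm[OF p]]
    by simp
  have B: "B (tensor_class smul f, tensor_class smul g) =
      p (eulerian (symmetrize f * symmetrize g))" for f g
    by (simp add: B_def sym_projection_gutt_star projective_seminorm_letter[OF sp] del: One_nat_def)
  have "openin (prod_topology \<tau> \<tau>) {x \<in> topspace (prod_topology \<tau> \<tau>). B x \<in> {..<1}}"
    by (rule openin_continuous_map_preimage[OF cont]) simp
  moreover have "(?z, ?z) \<in> {x \<in> topspace (prod_topology \<tau> \<tau>). B x \<in> {..<1}}"
    using seminorm_scale[OF sp, of 0 0] by (simp add: top zero_mem B symmetrize_eq_lin_ext)
  ultimately obtain U U' where U: "openin \<tau> U" "?z \<in> U" and U': "openin \<tau> U'" "?z \<in> U'"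
    and sub: "U \<times> U' \<subseteq> {x \<in> topspace (prod_topology \<tau> \<tau>). B x \<in> {..<1}}"
    unfolding openin_prod_topology_alt by blast
  obtain q where q: "continuous_seminorm ?S (tensor_add smul) (tensor_scale smul) \<tau> q" "{x \<in> ?S. q x < 1} \<subseteq> U"
    using zero_neighbourhood_seminorm[of P U] P U unfolding \<tau> by blast
  obtain q' where q': "continuous_seminorm ?S (tensor_add smul) (tensor_scale smul) \<tau> q'" "{x \<in> ?S. q' x < 1} \<subseteq> U'"
    using zero_neighbourhood_seminorm[of P U'] P U' unfolding \<tau> by blast
  have small: "tensor_class smul (symmetrize (scalar (of_real (1 / r)) * f)) \<in> {x \<in> ?S. q x < 1} \<and> 0 < r"
    if q: "is_seminorm ?S (tensor_add smul) (tensor_scale smul) q" and "q (?c f) < r" for q r f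
  proof -
    have r: "0 < r"
      using seminorm_nonneg[OF q sym_algebra_class] that(2) by (rule le_less_trans)
    have "?c (scalar (of_real (1 / r)) * f) = tensor_scale smul (of_real (1 / r)) (?c f)"
      by (simp only: symmetrize_scalar tensor_scale_class)
    then have "q (?c (scalar (of_real (1 / r)) * f)) = q (?c f) / r"
      using seminorm_scale[OF q sym_algebra_class, of "of_real (1 / r)"] r by (simp add: norm_divide)
    then show ?thesis
      using that(2) r by (simp add: sym_algebra_class)
  qed
  have "p (eulerian (symmetrize f * symmetrize g)) \<le> r * r'"
      if "q (?c f) < r" "q' (?c g) < r'" for f g r r'
  proof -
    let ?f = "scalar (of_real (1 / r)) * f" and ?g = "scalar (of_real (1 / r')) * g"
    have r: "0 < r" "0 < r'" and "(?c ?f, ?c ?g) \<in> U \<times> U'"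
      using small[of q f r] small[of q' g r'] that q q' by (auto simp: continuous_seminorm_def)
    then have "B (?c ?f, ?c ?g) < 1"
      using sub by blast
    moreover have "symmetrize ?f * symmetrize ?g =
        scalar (of_real (1 / r)) * (scalar (of_real (1 / r')) * (symmetrize f * symmetrize g))"
      by (simp only: symmetrize_scalar mult_scalar[of "symmetrize f"] mult.assoc)
    ultimately have "p (eulerian (symmetrize f * symmetrize g)) / (r * r') < 1"
      using r by (simp add: B symmetrize_symmetrize eulerian_scalar seminorm_scale[OF sp] norm_divide norm_mult)
    then show ?thesis
      using r by (simp add: divide_less_eq)
  qed
  with q(1) q'(1) show thesis
    by (rule that)
qed

lemma symmetrize_replicate:
  "symmetrize (monomial (replicate n x)) = (monomial (replicate n x) :: 'g list \<Rightarrow>\<^sub>0 'k)"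
proof -
  have "permute_list \<sigma> (replicate n x) = replicate n x" if "\<sigma> permutes {..<n}" for \<sigma>
    using that permutes_in_image[OF that]
    by (intro nth_equalityI) (simp_all add: permute_list_nth flip: lessThan_iff)
  then have "symmetrize (monomial (replicate n x)) =
      (\<Sum>\<sigma> | \<sigma> permutes {..<n}. scalar (1 / fact n) * (monomial (replicate n x) :: 'g list \<Rightarrow>\<^sub>0 'k))"
    unfolding symmetrize_monomial symmetrize_word_def by (intro sum.cong) simp_all
  also have "\<dots> = monomial (replicate n x)"
    by (simp add: card_permutations of_nat_eq_scalar scalar_mult del: of_nat_fact flip: mult.assoc) simp
  finally show ?thesis .
qed

lemma summable_BCH:
  assumes lc: "locally_convex_topology (sym_algebra smul) (tensor_add smul) (tensor_scale smul) \<tau>"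
    and star: "continuous_map (prod_topology \<tau> \<tau>) \<tau> (\<lambda>(s, t). gutt_star smul bracket s t)"
    and exp: "\<And>\<xi>. abs_convergent_in_completion (sym_algebra smul) (tensor_add smul) (tensor_scale smul) \<tau>
      (\<lambda>n. tensor_scale smul (1 / fact n) (sym_product smul (replicate n \<xi>)))"
    and proj: "continuous_map \<tau> (sym_power_topology smul T 1) (sym_projection smul 1)"
    and p: "continuous_seminorm UNIV (+) smul T p"
  shows "summable (\<lambda>n. p (BCH smul bracket (Suc n) \<xi> \<eta>))"
proof -
  have sp: "is_seminorm UNIV (+) smul p"
    using p by (simp add: continuous_seminorm_def)
  obtain q q' where q: "continuous_seminorm (sym_algebra smul) (tensor_add smul) (tensor_scale smul) \<tau> q"
    and q': "continuous_seminorm (sym_algebra smul) (tensor_add smul) (tensor_scale smul) \<tau> q'"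
    and est: "\<And>f g r r'. q (tensor_class smul (symmetrize f)) < r \<Longrightarrow> q' (tensor_class smul (symmetrize g)) < r' \<Longrightarrow>
      p (eulerian (symmetrize f * symmetrize g)) \<le> r * r'"
    using star_continuity_estimate[OF lc star proj p] by blast
  let ?e = "\<lambda>x n. scalar (1 / fact n) * monomial (replicate n x) :: 'g list \<Rightarrow>\<^sub>0 'k"
  have sym: "symmetrize (?e x n) = ?e x n" for x n
    by (simp add: symmetrize_scalar symmetrize_replicate)
  \<comment> \<open>The summable positive term \<open>(1 / 2) ^ n\<close> makes the bounds
    strict.\<close>
  define a where "a n = q (tensor_class smul (?e \<xi> n)) + (1 / 2) ^ n" for n
  define b where "b n = q' (tensor_class smul (?e \<eta> n)) + (1 / 2) ^ n" for n
  have nonneg: "0 \<le> s (tensor_class smul (?e x n))"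
    if "continuous_seminorm (sym_algebra smul) (tensor_add smul) (tensor_scale smul) \<tau> s" for s x n
    using that seminorm_nonneg[of _ "tensor_add smul" "tensor_scale smul" s, OF _ sym_algebra_class[of "?e x n"]]
      by (simp add: continuous_seminorm_def sym)
  have ex: "tensor_scale smul (1 / fact n) (sym_product smul (replicate n x)) =
      tensor_class smul (?e x n)" for x n
    by (simp add: sym_product_def symmetrize_replicate tensor_scale_class)
  have "summable a" "summable b"
    unfolding a_def b_def
    using exp q q' by (auto intro!: summable_add simp: abs_convergent_in_completion_def ex)
  moreover have "0 \<le> a n" "0 \<le> b n" for n
    using nonneg[OF q] nonneg[OF q'] by (simp_all add: a_def b_def)
  ultimately have "summable (\<lambda>n. \<Sum>i\<le>n. a i * b (n - i))"
    by (intro summable_Cauchy_product) simp_all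
  \<comment> \<open>The Cauchy product groups the double series by total degree; the
    Baker-Campbell-Hausdorff series starts in degree 1, hence the shift.\<close>
  then have summ: "summable (\<lambda>n. \<Sum>i\<le>Suc n. a i * b (Suc n - i))"
    by (subst summable_Suc_iff)
  have "p (BCH smul bracket (Suc n) \<xi> \<eta>) \<le> (\<Sum>i\<le>Suc n. a i * b (Suc n - i))" for n
  proof -
    have term_le: "p (smul (1 / (fact i * fact j)) (eulerian_word (replicate i \<xi> @ replicate j \<eta>)))
        \<le> a i * b j" for i j
    proof -
      have "?e \<xi> i * ?e \<eta> j = scalar (1 / fact i) * (scalar (1 / fact j) * (monomial (replicate i \<xi>) * monomial (replicate j \<eta>)))"
        by (simp only: mult_scalar[of "monomial _"] mult.assoc)
      then have "smul (1 / (fact i * fact j)) (eulerian_word (replicate i \<xi> @ replicate j \<eta>)) =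
          eulerian (?e \<xi> i * ?e \<eta> j)"
        by (simp add: eulerian_scalar monomial_mult)
      moreover have "p (eulerian (?e \<xi> i * ?e \<eta> j)) \<le> a i * b j"
        using est[of "?e \<xi> i" "a i" "?e \<eta> j" "b j"] unfolding sym by (simp add: a_def b_def)
      ultimately show ?thesis by simp
    qed
    have "p (BCH smul bracket (Suc n) \<xi> \<eta>) \<le> (\<Sum>i\<le>Suc n. p (smul (1 / (fact i * fact (Suc n - i)))
        (eulerian_word (replicate i \<xi> @ replicate (Suc n - i) \<eta>))))"
      unfolding BCH_eq_sum_eulerian_word[OF zero_less_Suc] by (rule seminorm_sum[OF sp])
    also have "\<dots> \<le> (\<Sum>i\<le>Suc n. a i * b (Suc n - i))"
      by (intro sum_mono term_le)
    finally show ?thesis .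
  qed
  then show ?thesis
    using seminorm_nonneg[OF sp] by (intro summable_comparison_test'[OF summ]) simp
qed

text \<open>Completeness is formulated with filters; it is applied to the image of
  \<open>sequentially\<close> under the partial sums, whose tails are small in every continuous
  seminorm.\<close>

lemma series_converges:
  assumes complete: "lc_complete UNIV (+) smul T"
    and summable: "\<And>p. continuous_seminorm UNIV (+) smul T p \<Longrightarrow> summable (\<lambda>n. p (x (Suc n)))"
  shows "\<exists>l. limitin T (\<lambda>N. \<Sum>n = 1..N. x n) l sequentially"
proof -
  define s where "s N = (\<Sum>n = 1..N. x n)" for N :: nat
  have "lc_cauchy_filter UNIV (+) smul T (filtermap s sequentially)"
    unfolding lc_cauchy_filter_def
  proof (intro conjI allI impI)
    show "filtermap s sequentially \<noteq> bot"
      by (simp add: filtermap_bot_iff)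
  next
    fix p :: "'g \<Rightarrow> real" and e :: real
    assume pe: "continuous_seminorm UNIV (+) smul T p \<and> 0 < e"
    then have p: "is_seminorm UNIV (+) smul p" by (simp add: continuous_seminorm_def)
    obtain N where N: "\<And>m n. N \<le> m \<Longrightarrow> norm (\<Sum>k = m..<n. p (x (Suc k))) < e"
      using summable[of p] pe unfolding summable_Cauchy by blast
    have diff: "p (s n - s m) < e" if "N \<le> m" "m \<le> n" for m n
    proof -
      have eq: "s n = s m + (\<Sum>k = m..<n. x (Suc k))"
        using that(2) unfolding s_def by (induction rule: dec_induct) simp_all
      have "p (s n - s m) \<le> (\<Sum>k = m..<n. p (x (Suc k)))"
        unfolding eq by (simp add: seminorm_sum[OF p])
      also have "\<dots> < e"
        using N[OF that(1), of n] by simp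
      finally show ?thesis .
    qed
    have minus: "p (u - v) = p (v - u)" for u v
      using seminorm_scale[OF p, of "v - u" "- 1"] by (simp add: scale_minus_left)
    have "p (s m + smul (- 1) (s n)) < e" if "N \<le> m" "N \<le> n" for m n
      using diff[of m n] diff[of n m] that minus[of "s m" "s n"] by (cases "m
          \<le> n") (simp_all add: scale_minus_left)
    then show "\<exists>A\<subseteq>UNIV. eventually (\<lambda>x. x \<in> A) (filtermap s sequentially) \<and>
        (\<forall>x\<in>A. \<forall>y\<in>A. p (x + smul (- 1) y) < e)"
      by (intro exI[of _ "s ` {N..}"]) (auto simp: eventually_filtermap eventually_sequentially)
  qed
  then obtain l where "limitin T (\<lambda>x. x) l (filtermap s sequentially)"
    using complete unfolding lc_complete_def by blast
  then have "limitin T s l sequentially"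
    by (simp add: limitin_def eventually_filtermap)
  then show ?thesis
    unfolding s_def by blast
qed

end

theorem proposition5p4p1:
  fixes smul :: "'k::real_or_complex \<Rightarrow> 'g::ab_group_add \<Rightarrow> 'g"
    and bracket :: "'g \<Rightarrow> 'g \<Rightarrow> 'g"
    and T :: "'g topology"
  assumes "ae_lie_algebra smul bracket T"
    and "lc_complete UNIV (+) smul T"
    and "\<exists>\<xi> \<eta>. \<not> BCH_converges smul bracket T \<xi> \<eta>"
  shows "\<not> (\<exists>\<tau>.
    locally_convex_topology (sym_algebra smul) (tensor_add smul) (tensor_scale smul) \<tau> \<and>
    continuous_map (prod_topology \<tau> \<tau>) \<tau> (\<lambda>(f, g). gutt_star smul bracket f g) \<and>
    (\<forall>\<xi>. abs_convergent_in_completion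
      (sym_algebra smul) (tensor_add smul) (tensor_scale smul) \<tau>
      (\<lambda>n. tensor_scale smul (1 / fact n) (sym_product smul (replicate n \<xi>)))) \<and>
    (\<forall>n. continuous_map \<tau> (sym_power_topology smul T n) (sym_projection smul n) \<and>
         continuous_map (sym_power_topology smul T n) \<tau> (\<lambda>t. t)))"
proof
  interpret ae_lie_algebra smul bracket T by (fact assms(1))
  interpret lie_algebra_normed_field smul bracket ..
  assume "\<exists>\<tau>.
    locally_convex_topology (sym_algebra smul) (tensor_add smul) (tensor_scale smul) \<tau> \<and>
    continuous_map (prod_topology \<tau> \<tau>) \<tau> (\<lambda>(f, g). gutt_star smul bracket f g) \<and>
    (\<forall>\<xi>. abs_convergent_in_completion
      (sym_algebra smul) (tensor_add smul) (tensor_scale smul) \<tau>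
      (\<lambda>n. tensor_scale smul (1 / fact n) (sym_product smul (replicate n \<xi>)))) \<and>
    (\<forall>n. continuous_map \<tau> (sym_power_topology smul T n) (sym_projection smul n) \<and>
         continuous_map (sym_power_topology smul T n) \<tau> (\<lambda>t. t))"
  then have "summable (\<lambda>n. p (BCH smul bracket (Suc n) \<xi> \<eta>))"
    if "continuous_seminorm UNIV (+) smul T p" for p \<xi> \<eta>
    \<comment> \<open>The continuity of the projections enters in degree one.\<close>
    using that by (elim exE conjE) (rule summable_BCH, blast+)
  then have "BCH_converges smul bracket T \<xi> \<eta>" for \<xi> \<eta>
    unfolding BCH_converges_def by (intro series_converges assms(2))
  with assms(3) show False by blast
qed

end
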